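(* Let $s\geq 3$ be an odd integer and let $\left(\left(\tfrac{s-1}{2}\right)^3,\mu_4,\ldots,\mu_r\right)$ denote a sub-homaloidal multiplicity set in degree $s$. Assume that the associated "doubled" homaloidal set $((s-1)^3,2\mu_4,\ldots,2\mu_r)$ gives a proper homaloidal type in degree $2s-1$. Let $I\subset R=k[x,y,z]$ denote the base ideal of a Cremona map $\mathfrak{F}$ on $r$ general points having this homaloidal type. Then there are three principal curves of $\mathfrak{F}$ of degree $s-1$, with defining forms $f_1,f_2,f_3\in R$, and three linearly independent linear forms $\ell_1,\ell_2,\ell_3\in R$ such that $$I=(\ell_3f_1f_2,\ \ell_2f_1f_3,\ \ell_1f_2f_3).$$
   Context: $k$ is an algebraically closed field and $R=k[x,y,z]$ has the standard grading. Exponents denote repetition. A set (with repetitions) of nonnegative integers $\{\mu_1,\ldots,\mu_r\}$ is a sub-homaloidal multiplicity set in degree $s$ if $\sum_i\mu_i=3(s-1)$ and $\sum_i\mu_i^2=s(s-1)$. A plane Cremona map of degree $d$ is a birational map $\mathbb{P}^2\dashrightarrow\mathbb{P}^2$ defined by three $k$-linearly independent forms of degree $d$ without common factor; the ideal $I$ they generate is its base ideal. A homaloidal type of degree $d$ is a tuple $(d;\nu_1,\ldots,\nu_r)$ with $\sum\nu_i=3d-3$, $\sum\nu_i^2=d^2-1$; the type of a Cremona map is given by its degree and its virtual multiplicities at all its base points (proper and infinitely near), where the virtual multiplicity at a point is the minimum of the multiplicities there of members of the defining linear system (after blowing up for infinitely near points). A homaloidal type is proper if it is the type of some plane Cremona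 map. If $\boldsymbol\mu$ is sub-homaloidal in degree $s$, then $(2s-1;2\boldsymbol\mu)$ is a homaloidal type. "A Cremona map on $r$ general points" of a given type means one whose base points are proper points $p_1,\ldots,p_r\in\mathbb{P}^2$ with $(p_1,\ldots,p_r)$ in a suitable non-empty Zariski open subset of $(\mathbb{P}^2)^r$, the multiplicities being attached to the points in order. A principal curve of $\mathfrak{F}$ is an irreducible plane curve contracted by $\mathfrak{F}$ to a point (a base point of $\mathfrak{F}^{-1}$). *)

theory Defs
  imports
    "HOL-Computational_Algebra.Computational_Algebra"
    "HOL-Library.Poly_Mapping"
    "HOL-Library.Numeral_Type"
begin

section \<open>Polynomials\<close>

text \<open>
  Polynomials are finitely supported families of coefficients indexed by exponent vectors. The
  variables of \<open>R = k[x,y,z]\<close> are indexed by the three-element type \<^typ>\<open>3\<close>, whose arithmetic is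
  modulo 3; its elements are \<open>0\<close>, \<open>1\<close>, \<open>2\<close>.
\<close>

type_synonym ('v, 'k) mpoly = "('v \<Rightarrow>\<^sub>0 nat) \<Rightarrow>\<^sub>0 'k"

definition const :: "'k::comm_ring_1 \<Rightarrow> ('v, 'k) mpoly" where
  "const c = Poly_Mapping.single 0 c"

definition var :: "'v \<Rightarrow> ('v, 'k::comm_ring_1) mpoly" where
  "var x = Poly_Mapping.single (Poly_Mapping.single x 1) 1"

definition mon_degree :: "('v \<Rightarrow>\<^sub>0 nat) \<Rightarrow> nat" where
  "mon_degree m = (\<Sum>x\<in>Poly_Mapping.keys m. Poly_Mapping.lookup m x)"

definition poly_eval :: "('v, 'k::comm_ring_1) mpoly \<Rightarrow> ('v \<Rightarrow> 'k) \<Rightarrow> 'k" where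
  "poly_eval f a =
     (\<Sum>m\<in>Poly_Mapping.keys f. Poly_Mapping.lookup f m *
        (\<Prod>x\<in>Poly_Mapping.keys m. a x ^ Poly_Mapping.lookup m x))"

definition poly_subst ::
    "('v, 'k::comm_ring_1) mpoly \<Rightarrow> ('v \<Rightarrow> ('w, 'k) mpoly) \<Rightarrow> ('w, 'k) mpoly" where
  "poly_subst f g =
     (\<Sum>m\<in>Poly_Mapping.keys f. const (Poly_Mapping.lookup f m) *
        (\<Prod>x\<in>Poly_Mapping.keys m. g x ^ Poly_Mapping.lookup m x))"

text \<open>As usual, the zero polynomial is a form of every degree.\<close>

definition form :: "nat \<Rightarrow> ('v, 'k::comm_ring_1) mpoly \<Rightarrow> bool" where
  "form d f \<longleftrightarrow> (\<forall>m\<in>Poly_Mapping.keys f. mon_degree m = d)"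

definition ideal_gen :: "'a::comm_ring_1 set \<Rightarrow> 'a set" where
  "ideal_gen S = module.span (*) S"

definition lin_indep :: "(3 \<Rightarrow> (3, 'k::field) mpoly) \<Rightarrow> bool" where
  "lin_indep F \<longleftrightarrow> (\<forall>c. (\<Sum>i\<in>UNIV. const (c i) * F i) = 0 \<longrightarrow> (\<forall>i. c i = 0))"

definition no_common_factor :: "(3 \<Rightarrow> (3, 'k::field) mpoly) \<Rightarrow> bool" where
  "no_common_factor F \<longleftrightarrow> (\<forall>h. (\<forall>i. h dvd F i) \<longrightarrow> h dvd 1)"


section \<open>The projective plane and the Zariski topology of its powers\<close>

definition proj_rel :: "(3 \<Rightarrow> 'k::field) \<Rightarrow> (3 \<Rightarrow> 'k) \<Rightarrow> bool" where
  "proj_rel v w \<longleftrightarrow> (\<exists>i. v i \<noteq> 0) \<and> (\<exists>c. c \<noteq> 0 \<and> w = (\<lambda>i. c * v i))"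

lemma part_equivp_proj_rel: "part_equivp (proj_rel :: (3 \<Rightarrow> 'k::field) \<Rightarrow> _)"
proof (rule part_equivpI)
  have "proj_rel (\<lambda>_. 1::'k) (\<lambda>_. 1)"
    unfolding proj_rel_def by (auto intro: exI[of _ 1])
  then show "\<exists>v::3 \<Rightarrow> 'k. proj_rel v v" by blast
  show "symp (proj_rel :: (3 \<Rightarrow> 'k) \<Rightarrow> _)"
  proof (rule sympI)
    fix v w :: "3 \<Rightarrow> 'k"
    assume "proj_rel v w"
    then obtain i c where "v i \<noteq> 0" "c \<noteq> 0" "w = (\<lambda>i. c * v i)"
      unfolding proj_rel_def by blast
    then show "proj_rel w v"
      unfolding proj_rel_def by (auto intro!: exI[of _ i] exI[of _ "inverse c"])
  qed
  show "transp (proj_rel :: (3 \<Rightarrow> 'k) \<Rightarrow> _)"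
  proof (rule transpI)
    fix u v w :: "3 \<Rightarrow> 'k"
    assume "proj_rel u v" "proj_rel v w"
    then obtain i c c' where "u i \<noteq> 0" "c \<noteq> 0" "v = (\<lambda>i. c * u i)" "c' \<noteq> 0" "w = (\<lambda>i. c' * v i)"
      unfolding proj_rel_def by blast
    then show "proj_rel u w"
      unfolding proj_rel_def by (auto intro!: exI[of _ i] exI[of _ "c' * c"] simp: mult.assoc)
  qed
qed

quotient_type (overloaded) 'k proj2 = "3 \<Rightarrow> 'k::field" / partial: proj_rel
  by (rule part_equivp_proj_rel)

text \<open>
  Homogeneous coordinates of a point: an arbitrary but fixed representative. Its choice is immaterial:
  \<open>coords\<close> is only used for the vanishing of (multi)homogeneous polynomials, inside \<open>abs_proj2\<close>, and
  for choosing local coordinates, which only affects how the infinitely near points are labelled.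
\<close>

definition coords :: "'k::field proj2 \<Rightarrow> 3 \<Rightarrow> 'k" where
  "coords P = rep_proj2 P"

lemma coords_nonzero: "\<exists>i. coords P i \<noteq> 0"
  using Quotient3_rep_reflp[OF Quotient3_proj2, of P]
  unfolding coords_def proj_rel_def by blast

definition vanishes_at :: "(3, 'k::field) mpoly \<Rightarrow> 'k proj2 \<Rightarrow> bool" where
  "vanishes_at f P \<longleftrightarrow> poly_eval f (coords P) = 0"

text \<open>
  The variable \<open>(i, j)\<close> is the \<open>j\<close>-th homogeneous coordinate of the \<open>i\<close>-th point; \<open>e i\<close> is the
  degree in the coordinates of the \<open>i\<close>-th point, and only the points with \<open>i < r\<close> occur.
\<close>

definition multiform :: "nat \<Rightarrow> (nat \<times> 3, 'k::field) mpoly \<Rightarrow> bool" where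
  "multiform r g \<longleftrightarrow>
     (\<exists>e. (\<forall>i\<ge>r. e i = 0) \<and>
          (\<forall>m\<in>Poly_Mapping.keys g. \<forall>i. (\<Sum>j\<in>UNIV. Poly_Mapping.lookup m (i, j)) = e i))"

text \<open>Points of \<open>(\<P>\<^sup>2)\<^sup>r\<close> are lists of length \<open>r\<close>; open sets are complements of zero loci.\<close>

definition zariski_open :: "nat \<Rightarrow> 'k::field proj2 list set \<Rightarrow> bool" where
  "zariski_open r U \<longleftrightarrow>
     (\<exists>G. (\<forall>g\<in>G. multiform r g) \<and>
          U = {ps. length ps = r \<and> (\<exists>g\<in>G. poly_eval g (\<lambda>(i, j). coords (ps ! i) j) \<noteq> 0)})"


section \<open>Plane Cremona maps\<close>

text \<open>
  A triple of forms \<open>G\<close> represents the rational inverse of \<open>F\<close>: the compositions \<open>G \<circ> F\<close> and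
  \<open>F \<circ> G\<close> are \<open>(h x, h y, h z)\<close> and \<open>(h' x, h' y, h' z)\<close> with \<open>h\<close>, \<open>h'\<close> nonzero.
\<close>

definition represents_inverse ::
    "(3 \<Rightarrow> (3, 'k::field) mpoly) \<Rightarrow> (3 \<Rightarrow> (3, 'k) mpoly) \<Rightarrow> bool" where
  "represents_inverse F G \<longleftrightarrow>
     (\<exists>e. \<forall>i. form e (G i)) \<and>
     (\<exists>h. h \<noteq> 0 \<and> (\<forall>i. poly_subst (G i) F = h * var i)) \<and>
     (\<exists>h. h \<noteq> 0 \<and> (\<forall>i. poly_subst (F i) G = h * var i))"

definition cremona :: "nat \<Rightarrow> (3 \<Rightarrow> (3, 'k::field) mpoly) \<Rightarrow> bool" where
  "cremona d F \<longleftrightarrow>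
     (\<forall>i. form d (F i)) \<and> lin_indep F \<and> no_common_factor F \<and> (\<exists>G. represents_inverse F G)"

definition base_ideal :: "(3 \<Rightarrow> (3, 'k::field) mpoly) \<Rightarrow> (3, 'k) mpoly set" where
  "base_ideal F = ideal_gen {F 0, F 1, F 2}"

definition linear_system :: "(3 \<Rightarrow> (3, 'k::field) mpoly) \<Rightarrow> (3, 'k) mpoly set" where
  "linear_system F = {\<Sum>i\<in>UNIV. const (c i) * F i | c. True}"


subsection \<open>Proper and infinitely near points\<close>

text \<open>
  A proper or infinitely near point is a pair \<open>(P, ts)\<close>, where \<open>P\<close> is a proper point and each entry of
  \<open>ts\<close> selects a point on the exceptional line of the blow-up of the point reached so far (the first
  entry belongs to the first blow-up). In local coordinates \<open>u\<close>, \<open>v\<close> at the point that is blown up,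
  the blow-up has the charts \<open>(u, v) = (u', u' v')\<close> and \<open>(u, v) = (u' v', v')\<close>; \<open>Some t\<close> is
  the point \<open>u' = 0, v' = t\<close> of the first chart, and \<open>None\<close> is the origin of the second chart, which is
  the only point of the exceptional line missing from the first one. The empty list gives \<open>P\<close> itself.
\<close>

type_synonym 'k bubble_point = "'k proj2 \<times> 'k option list"

text \<open>
  Local equation at \<open>P\<close>: choose \<open>i\<close> with \<open>i\<close>-th coordinate \<open>a i \<noteq> 0\<close>, put \<open>x i = a i\<close>, and use
  \<open>u = x (i + 1) - a (i + 1)\<close>, \<open>v = x (i + 2) - a (i + 2)\<close> (indices mod 3) as local coordinates. The
  variables \<open>u\<close>, \<open>v\<close> of the local polynomial ring have the indices \<open>0\<close>, \<open>1\<close>.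
\<close>

definition chart_index :: "'k::field proj2 \<Rightarrow> 3" where
  "chart_index P = (SOME i. coords P i \<noteq> 0)"

definition local_eq :: "'k::field proj2 \<Rightarrow> (3, 'k) mpoly \<Rightarrow> (2, 'k) mpoly" where
  "local_eq P f =
     poly_subst f (\<lambda>j. const (coords P j) +
       (if j = chart_index P then 0 else if j = chart_index P + 1 then var 0 else var 1))"

definition mult_origin :: "(2, 'k::field) mpoly \<Rightarrow> nat" where
  "mult_origin g = Min (mon_degree ` Poly_Mapping.keys g)"

definition system_mult :: "(2, 'k::field) mpoly set \<Rightarrow> nat" where
  "system_mult V = Inf (mult_origin ` (V - {0}))"

primrec exceptional_eq :: "'k::field option \<Rightarrow> (2, 'k) mpoly" where
  "exceptional_eq (Some t) = var 0"
| "exceptional_eq None = var 1"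

text \<open>Pull-back to the blow-up, in local coordinates centred at the selected point.\<close>

primrec blowup_pullback :: "'k::field option \<Rightarrow> (2, 'k) mpoly \<Rightarrow> (2, 'k) mpoly" where
  "blowup_pullback (Some t) f =
     poly_subst f (\<lambda>j. if j = 0 then var 0 else var 0 * (var 1 + const t))"
| "blowup_pullback None f =
     poly_subst f (\<lambda>j. if j = 0 then var 0 * var 1 else var 1)"

text \<open>The linear system after blowing up: the exceptional curve is removed \<open>system_mult V\<close> times.\<close>

definition blowup_system :: "'k::field option \<Rightarrow> (2, 'k) mpoly set \<Rightarrow> (2, 'k) mpoly set" where
  "blowup_system t V =
     {g. \<exists>f\<in>V. exceptional_eq t ^ system_mult V * g = blowup_pullback t f}"

primrec local_virtual_mult :: "(2, 'k::field) mpoly set \<Rightarrow> 'k option list \<Rightarrow> nat" where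
  "local_virtual_mult V [] = system_mult V"
| "local_virtual_mult V (t # ts) = local_virtual_mult (blowup_system t V) ts"

definition virtual_mult :: "(3 \<Rightarrow> (3, 'k::field) mpoly) \<Rightarrow> 'k bubble_point \<Rightarrow> nat" where
  "virtual_mult F q = local_virtual_mult (local_eq (fst q) ` linear_system F) (snd q)"

text \<open>
  The distinct points \<open>qs\<close> comprise all (proper and infinitely near) base points of \<open>F\<close>, with virtual
  multiplicities \<open>\<nu>\<close> in this order. A zero entry of \<open>\<nu>\<close> is allowed and means that the
  corresponding point is not a base point.
\<close>

definition base_points_with_mults ::
    "(3 \<Rightarrow> (3, 'k::field) mpoly) \<Rightarrow> 'k bubble_point list \<Rightarrow> nat list \<Rightarrow> bool" where
  "base_points_with_mults F qs \<nu> \<longleftrightarrow>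
     distinct qs \<and> map (virtual_mult F) qs = \<nu> \<and> (\<forall>q. q \<notin> set qs \<longrightarrow> virtual_mult F q = 0)"

text \<open>A Cremona map of type \<open>(d; \<nu>)\<close> based at proper points \<open>ps\<close>, with \<open>\<nu>\<close> attached in order.\<close>

definition cremona_on_points ::
    "nat \<Rightarrow> nat list \<Rightarrow> 'k::field proj2 list \<Rightarrow> (3 \<Rightarrow> (3, 'k) mpoly) \<Rightarrow> bool" where
  "cremona_on_points d \<nu> ps F \<longleftrightarrow>
     cremona d F \<and> base_points_with_mults F (map (\<lambda>P. (P, [])) ps) \<nu>"


section \<open>Homaloidal types\<close>

definition sub_homaloidal :: "nat \<Rightarrow> nat list \<Rightarrow> bool" where
  "sub_homaloidal s \<mu> \<longleftrightarrow>
     int (sum_list \<mu>) = 3 * (int s - 1) \<and> int (\<Sum>m\<leftarrow>\<mu>. m ^ 2) = int s * (int s - 1)"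

definition homaloidal_type :: "nat \<Rightarrow> nat list \<Rightarrow> bool" where
  "homaloidal_type d \<nu> \<longleftrightarrow>
     int (sum_list \<nu>) = 3 * int d - 3 \<and> int (\<Sum>m\<leftarrow>\<nu>. m ^ 2) = int d ^ 2 - 1"

text \<open>The ground field is passed as a type argument.\<close>

definition proper_homaloidal_type :: "'k::field itself \<Rightarrow> nat \<Rightarrow> nat list \<Rightarrow> bool" where
  "proper_homaloidal_type _ d \<nu> \<longleftrightarrow>
     homaloidal_type d \<nu> \<and>
     (\<exists>F :: 3 \<Rightarrow> (3, 'k) mpoly. cremona d F \<and> (\<exists>qs. base_points_with_mults F qs \<nu>))"


section \<open>Principal curves\<close>

definition base_point_of_inverse :: "(3 \<Rightarrow> (3, 'k::field) mpoly) \<Rightarrow> 'k proj2 \<Rightarrow> bool" where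
  "base_point_of_inverse F Q \<longleftrightarrow> (\<forall>G. represents_inverse F G \<longrightarrow> (\<forall>i. vanishes_at (G i) Q))"

text \<open>
  \<open>f\<close> is the defining form, of degree \<open>e\<close>, of an irreducible curve all of whose points outside the base
  locus of \<open>F\<close> are mapped to the same point \<open>Q\<close>.
\<close>

definition principal_curve ::
    "(3 \<Rightarrow> (3, 'k::field) mpoly) \<Rightarrow> nat \<Rightarrow> (3, 'k) mpoly \<Rightarrow> bool" where
  "principal_curve F e f \<longleftrightarrow>
     form e f \<and> irreducible f \<and>
     (\<exists>Q. base_point_of_inverse F Q \<and>
          (\<forall>P. vanishes_at f P \<and> (\<exists>i. \<not> vanishes_at (F i) P) \<longrightarrow>
               abs_proj2 (\<lambda>i. poly_eval (F i) (coords P)) = Q))"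

definition same_curve :: "(3, 'k::field) mpoly \<Rightarrow> (3, 'k) mpoly \<Rightarrow> bool" where
  "same_curve f g \<longleftrightarrow> (\<exists>c. c \<noteq> 0 \<and> g = const c * f)"

end

theory Submission
  imports Defs "HOL-Library.Product_Lexorder"
begin

text \<open>
  The proof is Noether's reduction. Among the multiplicities of a net of degree \<open>d \<ge> 2\<close> that satisfy
  the homaloidal equations there are three whose sum exceeds \<open>d\<close>, and the quadratic map based at the
  corresponding points transforms the net into one of smaller degree on points that are again in general
  position. Two properties are pulled back along this reduction from the net of lines, where they are
  evident: the net contains every form of its degree with the assigned multiplicities, and every
  numerical \<open>(-1)\<close>-class orthogonal to the net is the class of an exceptional curve over one of the
  points or of a contracted irreducible plane curve. The second property yields the curves \<open>f i\<close>; by the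
  first, the products of two of them with the line through two of the first three points lie in the net,
  and being linearly independent they span it.
\<close>

section \<open>Evaluation homomorphisms\<close>

text \<open>Blow-ups are replaced by polynomial identities valid in every characteristic.
  Multiplicity is divisibility by a power of an indeterminate, so no derivatives occur. The bridge
  to the quadratic map is \<open>mult_ge_iff_lf_power_dvd\<close>: the multiplicity of a form at a
  vertex of the triangle is the exponent of the opposite side in its pull-back. Transforms are
  therefore quotients by powers of three prime linear forms, and since the map is an involution up
  to explicit factors, statements about transforms can be read in both directions.

  On classes the map acts as a reflection that preserves intersection numbers and the canonical
  class, so orthogonal (-1)-classes stay such. Their geometric nature may change: exceptional curves
  over vertices and sides of the triangle are interchanged, so neither alternative of the second
  property can be carried through the induction alone.

  General position is expressed by polynomials in coordinate vectors, because the quadratic map is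
  polynomial there; the passage to an open set of projective points comes at the end and uses
  invariance under rescaling.\<close>

definition is_hom :: "('a::comm_ring_1 \<Rightarrow> 'b::comm_ring_1) \<Rightarrow> bool" where
  "is_hom h \<longleftrightarrow> h 1 = 1 \<and> (\<forall>a b. h (a + b) = h a + h b) \<and> (\<forall>a b. h (a * b) = h a * h b)"

lemma is_homI:
  "h 1 = 1 \<Longrightarrow> (\<And>a b. h (a + b) = h a + h b) \<Longrightarrow> (\<And>a b. h (a * b) = h a * h b) \<Longrightarrow> is_hom h"
  by (auto simp: is_hom_def)

context
  fixes h :: "'a::comm_ring_1 \<Rightarrow> 'b::comm_ring_1"
  assumes h: "is_hom h"
begin

lemma hom_one: "h 1 = 1" and hom_add: "h (a + b) = h a + h b" and hom_mult: "h (a * b) = h a * h b"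
  using h by (auto simp: is_hom_def)

lemma hom_zero: "h 0 = 0"
  using hom_add[of 0 0] by simp

lemma hom_minus: "h (- a) = - h a"
  using hom_add[of a "- a"] hom_zero by (simp add: eq_neg_iff_add_eq_0 add.commute)

lemma hom_diff: "h (a - b) = h a - h b"
  using hom_add[of a "- b"] hom_minus by simp

lemma hom_power: "h (a ^ n) = h a ^ n"
  by (induction n) (auto simp: hom_one hom_mult)

lemma hom_sum: "h (sum f A) = (\<Sum>x\<in>A. h (f x))"
  by (induction A rule: infinite_finite_induct) (auto simp: hom_zero hom_add)

lemma hom_prod: "h (prod f A) = (\<Prod>x\<in>A. h (f x))"
  by (induction A rule: infinite_finite_induct) (auto simp: hom_one hom_mult)

lemma hom_dvd: "a dvd b \<Longrightarrow> h a dvd h b"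
  by (auto simp: dvd_def hom_mult)

lemmas hom_simps = hom_zero hom_one hom_add hom_mult hom_minus hom_diff hom_power hom_sum hom_prod

end

definition mon :: "('v \<Rightarrow> 'a) \<Rightarrow> ('v \<Rightarrow>\<^sub>0 nat) \<Rightarrow> 'a::comm_ring_1" where
  "mon a m = (\<Prod>x\<in>Poly_Mapping.keys m. a x ^ Poly_Mapping.lookup m x)"

text \<open>\<open>poly_eval\<close>, \<open>poly_subst\<close> and \<open>homog\<close> are
  instances, with \<phi> the identity, \<open>const\<close> and the constant polynomials;
  homomorphism and composition laws are thus proved once.\<close>

definition ev :: "('k \<Rightarrow> 'a) \<Rightarrow> ('v \<Rightarrow> 'a) \<Rightarrow> ('v, 'k::comm_ring_1) mpoly \<Rightarrow> 'a::comm_ring_1" where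
  "ev \<phi> a f = (\<Sum>m\<in>Poly_Mapping.keys f. \<phi> (Poly_Mapping.lookup f m) * mon a m)"

lemma poly_subst_ev: "poly_subst f a = ev const a f"
  by (simp add: poly_subst_def ev_def mon_def)

lemma poly_eval_ev: "poly_eval f a = ev (\<lambda>c. c) a f"
  by (simp add: poly_eval_def ev_def mon_def)

lemma mon_superset:
  assumes "finite S" "Poly_Mapping.keys m \<subseteq> S"
  shows "mon a m = (\<Prod>x\<in>S. a x ^ Poly_Mapping.lookup m x)"
  unfolding mon_def using assms
  by (intro prod.mono_neutral_left) (auto simp: in_keys_iff)

lemma mon_zero [simp]: "mon a 0 = 1"
  by (simp add: mon_def)

lemma mon_add: "mon a (m + n) = mon a m * mon a n"
proof -
  let ?S = "Poly_Mapping.keys m \<union> Poly_Mapping.keys n"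
  have "Poly_Mapping.keys (m + n) \<subseteq> ?S" by (rule keys_add)
  then show ?thesis
    by (simp add: mon_superset[of ?S] lookup_add power_add prod.distrib)
qed

lemma mon_single: "mon a (Poly_Mapping.single x n) = a x ^ n"
  by (cases "n = 0") (simp_all add: mon_def)

lemma mon_sum: "mon a (sum f A) = (\<Prod>x\<in>A. mon a (f x))"
  by (induction A rule: infinite_finite_induct) (auto simp: mon_add)

lemma hom_mon:
  assumes "is_hom h" shows "h (mon a m) = mon (\<lambda>x. h (a x)) m"
  by (simp add: mon_def hom_prod[OF assms] hom_power[OF assms])

lemma poly_mapping_sum_single:
  "f = (\<Sum>m\<in>Poly_Mapping.keys f. Poly_Mapping.single m (Poly_Mapping.lookup f m))"
  by (rule poly_mapping_eqI)
     (auto simp: lookup_sum lookup_single when_def sum.delta in_keys_iff)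

context
  fixes \<phi> :: "'k::comm_ring_1 \<Rightarrow> 'a::comm_ring_1"
  assumes \<phi>: "is_hom \<phi>"
begin

lemma ev_superset:
  assumes "finite S" "Poly_Mapping.keys f \<subseteq> S"
  shows "ev \<phi> a f = (\<Sum>m\<in>S. \<phi> (Poly_Mapping.lookup f m) * mon a m)"
  unfolding ev_def using assms
  by (intro sum.mono_neutral_left) (auto simp: in_keys_iff hom_zero[OF \<phi>])

lemma ev_add: "ev \<phi> a (f + g) = ev \<phi> a f + ev \<phi> a g"
proof -
  let ?S = "Poly_Mapping.keys f \<union> Poly_Mapping.keys g"
  have "Poly_Mapping.keys (f + g) \<subseteq> ?S" by (rule keys_add)
  then show ?thesis
    by (simp add: ev_superset[of ?S] lookup_add hom_add[OF \<phi>] sum.distrib ring_distribs)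
qed

lemma ev_zero: "ev \<phi> a 0 = 0"
  by (simp add: ev_def)

lemma ev_sum: "ev \<phi> a (sum f A) = (\<Sum>x\<in>A. ev \<phi> a (f x))"
  by (induction A rule: infinite_finite_induct) (auto simp: ev_zero ev_add)

lemma ev_single: "ev \<phi> a (Poly_Mapping.single m c) = \<phi> c * mon a m"
  by (cases "c = 0") (auto simp: ev_def hom_zero[OF \<phi>])

lemma ev_mult: "ev \<phi> a (f * g) = ev \<phi> a f * ev \<phi> a g"
proof -
  have "f * g = (\<Sum>m\<in>Poly_Mapping.keys f. \<Sum>n\<in>Poly_Mapping.keys g.
      Poly_Mapping.single (m + n) (Poly_Mapping.lookup f m * Poly_Mapping.lookup g n))"
    by (subst (1) poly_mapping_sum_single[of f], subst (1) poly_mapping_sum_single[of g])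
       (simp add: sum_product mult_single)
  then have "ev \<phi> a (f * g) = (\<Sum>m\<in>Poly_Mapping.keys f. \<Sum>n\<in>Poly_Mapping.keys g.
      (\<phi> (Poly_Mapping.lookup f m) * mon a m) * (\<phi> (Poly_Mapping.lookup g n) * mon a n))"
    by (simp add: ev_sum ev_single hom_mult[OF \<phi>] mon_add mult_ac)
  then show ?thesis by (simp add: ev_def sum_product)
qed

lemma is_hom_ev: "is_hom (ev \<phi> a)"
proof (rule is_homI)
  show "ev \<phi> a 1 = 1"
    using ev_single[of a 0 1] by (simp add: hom_one[OF \<phi>])
qed (simp_all add: ev_add ev_mult)

lemma ev_const: "ev \<phi> a (const c) = \<phi> c"
  by (simp add: const_def ev_single)

lemma ev_var: "ev \<phi> a (var x) = a x"
  by (simp add: var_def ev_single mon_single hom_one[OF \<phi>])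

lemma hom_ev:
  assumes "is_hom h" shows "h (ev \<phi> a f) = ev (\<lambda>c. h (\<phi> c)) (\<lambda>x. h (a x)) f"
  by (simp add: ev_def hom_sum[OF assms] hom_mult[OF assms] hom_mon[OF assms])

end

lemma is_hom_id: "is_hom (\<lambda>c. c)"
  by (simp add: is_hom_def)

lemma is_hom_const: "is_hom const"
  by (simp add: is_hom_def const_def single_add mult_single)

lemmas const_simps = hom_simps[OF is_hom_const]

lemma const_eq_iff [simp]: "const a = const b \<longleftrightarrow> a = b"
  unfolding const_def by (metis lookup_single_eq)

lemma const_eq_0_iff [simp]: "const a = 0 \<longleftrightarrow> a = 0"
  using const_eq_iff[of a 0] by (simp add: const_simps)

lemma is_hom_subst: "is_hom (\<lambda>f. poly_subst f a)"
  unfolding poly_subst_ev by (rule is_hom_ev[OF is_hom_const])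

lemma is_hom_eval: "is_hom (\<lambda>f. poly_eval f a)"
  unfolding poly_eval_ev by (rule is_hom_ev[OF is_hom_id])

lemmas subst_hom = hom_simps[OF is_hom_subst]
lemmas eval_hom = hom_simps[OF is_hom_eval]

lemma subst_const [simp]: "poly_subst (const c) a = const c"
  by (simp add: poly_subst_ev ev_const[OF is_hom_const])

lemma subst_var [simp]: "poly_subst (var x) a = a x"
  by (simp add: poly_subst_ev ev_var[OF is_hom_const])

lemma eval_const [simp]: "poly_eval (const c) a = c"
  by (simp add: poly_eval_ev ev_const[OF is_hom_id])

lemma eval_var [simp]: "poly_eval (var x) a = a x"
  by (simp add: poly_eval_ev ev_var[OF is_hom_id])

lemma ev_subst:
  assumes "is_hom \<phi>" shows "ev \<phi> b (poly_subst f a) = ev \<phi> (\<lambda>x. ev \<phi> b (a x)) f"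
  using hom_ev[OF is_hom_const is_hom_ev[OF assms]]
  by (simp add: poly_subst_ev ev_const[OF assms])

lemma subst_subst: "poly_subst (poly_subst f a) b = poly_subst f (\<lambda>x. poly_subst (a x) b)"
  by (simp add: poly_subst_ev[of _ b] poly_subst_ev[of _ "\<lambda>x. ev const b (a x)"]
      ev_subst[OF is_hom_const])

lemma eval_subst: "poly_eval (poly_subst f a) b = poly_eval f (\<lambda>x. poly_eval (a x) b)"
  by (simp add: poly_eval_ev ev_subst[OF is_hom_id])

lemma mon_var:
  fixes m :: "'v \<Rightarrow>\<^sub>0 nat"
  shows "mon var m = Poly_Mapping.single m (1::'k::comm_ring_1)"
proof -
  have "mon var m = (\<Prod>x\<in>Poly_Mapping.keys m. Poly_Mapping.single (Poly_Mapping.single x (Poly_Mapping.lookup m x)) (1::'k))"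
    unfolding mon_def
  proof (rule prod.cong[OF refl])
    fix x :: 'v
    have "var x ^ n = Poly_Mapping.single (Poly_Mapping.single x n) (1::'k)" for n
      by (induction n) (simp_all add: var_def mult_single flip: single_add)
    then show "var x ^ Poly_Mapping.lookup m x =
      Poly_Mapping.single (Poly_Mapping.single x (Poly_Mapping.lookup m x)) (1::'k)" .
  qed
  also have "\<dots> = Poly_Mapping.single (\<Sum>x\<in>Poly_Mapping.keys m. Poly_Mapping.single x (Poly_Mapping.lookup m x)) 1"
  proof -
    have "(\<Prod>x\<in>A. Poly_Mapping.single (g x) (1::'k)) = Poly_Mapping.single (\<Sum>x\<in>A. g x) 1"
      if "finite A" for A and g :: "'v \<Rightarrow> 'v \<Rightarrow>\<^sub>0 nat"
      using that by induction (simp_all add: mult_single)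
    then show ?thesis by simp
  qed
  finally show ?thesis by (simp flip: poly_mapping_sum_single)
qed

lemma single_conv_mon: "Poly_Mapping.single m c = const c * mon var m"
  by (simp add: mon_var const_def mult_single)

lemma subst_id: "poly_subst f var = f"
proof -
  have "poly_subst f var = (\<Sum>m\<in>Poly_Mapping.keys f. Poly_Mapping.single m (Poly_Mapping.lookup f m))"
    by (simp add: poly_subst_ev ev_def single_conv_mon)
  then show ?thesis by (simp flip: poly_mapping_sum_single)
qed

section \<open>Homogeneous components\<close>

text \<open>The coefficient of \<open>homog f\<close> at \<open>n\<close> is the component of degree \<open>n\<close> of \<open>f\<close>.\<close>

definition homog :: "('v, 'k::comm_ring_1) mpoly \<Rightarrow> ('v, 'k) mpoly poly" where
  "homog f = ev (\<lambda>c. [:const c:]) (\<lambda>x. monom (var x) 1) f"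

lemma is_hom_pconst: "is_hom (\<lambda>c. [:const c:])"
  by (rule is_homI) (simp_all add: const_simps one_pCons)

lemma is_hom_homog: "is_hom homog"
  unfolding homog_def by (rule is_hom_ev[OF is_hom_pconst])

lemmas homog_hom = hom_simps[OF is_hom_homog]

lemma homog_const [simp]: "homog (const c) = [:const c:]"
  by (simp add: homog_def ev_const[OF is_hom_pconst])

lemma homog_var [simp]: "homog (var x) = monom (var x) 1"
  by (simp add: homog_def ev_var[OF is_hom_pconst])

lemma is_hom_poly: "is_hom (\<lambda>p. poly p x)"
  by (simp add: is_hom_def)

lemma poly_homog_1 [simp]: "poly (homog f) 1 = f"
  using hom_ev[OF is_hom_pconst is_hom_poly[of 1], where a = "\<lambda>x. monom (var x) 1" and f = f]
  by (simp add: homog_def poly_monom subst_id flip: poly_subst_ev)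

lemma mon_monom:
  fixes m :: "'v \<Rightarrow>\<^sub>0 nat"
  shows "mon (\<lambda>x. monom (var x) 1) m = monom (Poly_Mapping.single m (1::'k::comm_ring_1)) (mon_degree m)"
proof -
  have "mon (\<lambda>x. monom (var x :: ('v, 'k) mpoly) 1) m =
      (\<Prod>x\<in>Poly_Mapping.keys m. [:var x ^ Poly_Mapping.lookup m x:] * monom 1 (Poly_Mapping.lookup m x))"
    unfolding mon_def by (intro prod.cong) (simp_all add: monom_power smult_monom)
  also have "\<dots> = [:mon var m:] * monom 1 (mon_degree m)"
  proof -
    have "(\<Prod>x\<in>A. [:f x:] * monom 1 (g x)) = [:\<Prod>x\<in>A. f x:] * monom 1 (\<Sum>x\<in>A. g x)"
      if "finite A" for A and f :: "'v \<Rightarrow> ('v, 'k) mpoly" and g :: "'v \<Rightarrow> nat"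
      using that by induction (simp_all add: one_pCons mult_monom smult_monom monom_0)
    from this[of "Poly_Mapping.keys m" "\<lambda>x. var x ^ Poly_Mapping.lookup m x" "Poly_Mapping.lookup m"]
    show ?thesis unfolding mon_def mon_degree_def by simp
  qed
  finally show ?thesis by (simp add: mon_var smult_monom)
qed

lemma homog_sum_monom:
  "homog f = (\<Sum>m\<in>Poly_Mapping.keys f. monom (Poly_Mapping.single m (Poly_Mapping.lookup f m)) (mon_degree m))"
  unfolding homog_def ev_def mon_monom
  by (simp add: smult_monom const_def mult_single)

lemma lookup_coeff_homog:
  "Poly_Mapping.lookup (coeff (homog f) n) m = (if mon_degree m = n then Poly_Mapping.lookup f m else 0)"
proof -
  have "Poly_Mapping.lookup (coeff (homog f) n) m =
      (\<Sum>k\<in>Poly_Mapping.keys f. if k = m then if mon_degree m = n then Poly_Mapping.lookup f m else 0 else 0)"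
    unfolding homog_sum_monom coeff_sum lookup_sum
    by (intro sum.cong) (auto simp: lookup_single when_def)
  then show ?thesis by (simp add: in_keys_iff)
qed

text \<open>\<open>homog\<close> multiplies each variable by a new one, whose exponent records the
  degree. Closure rules for forms and degrees of factors become arithmetic of monomials in one
  variable.\<close>

lemma form_iff_homog: "form n f \<longleftrightarrow> homog f = monom f n"
proof
  assume "form n f"
  then show "homog f = monom f n"
    by (intro poly_eqI poly_mapping_eqI)
       (auto simp: lookup_coeff_homog form_def in_keys_iff)
next
  assume *: "homog f = monom f n"
  show "form n f"
    unfolding form_def
  proof
    fix m assume "m \<in> Poly_Mapping.keys f"
    then have "Poly_Mapping.lookup (coeff (homog f) (mon_degree m)) m \<noteq> 0"
      by (simp add: lookup_coeff_homog in_keys_iff)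
    with * show "mon_degree m = n" by (auto split: if_splits)
  qed
qed

lemma form_coeff_homog: "form n (coeff (homog f) n)"
  by (auto simp: form_def in_keys_iff lookup_coeff_homog split: if_splits)

lemma form_0 [simp]: "form n 0"
  by (simp add: form_def)

lemma form_const [simp]: "form 0 (const c)"
  by (simp add: form_iff_homog monom_0)

lemma form_one [simp]: "form 0 1"
  using form_const[of 1] by (simp add: const_simps)

lemma form_var [simp]: "form 1 (var x)" "form (Suc 0) (var x)"
  by (simp_all add: form_iff_homog)

lemma form_add: "form n f \<Longrightarrow> form n g \<Longrightarrow> form n (f + g)"
  by (simp add: form_iff_homog homog_hom add_monom)

lemma form_diff: "form n f \<Longrightarrow> form n g \<Longrightarrow> form n (f - g)"
  by (simp add: form_iff_homog homog_hom diff_monom)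

lemma form_mult: "form m f \<Longrightarrow> form n g \<Longrightarrow> form (m + n) (f * g)"
  by (simp add: form_iff_homog homog_hom mult_monom)

lemma form_cmult: "form n g \<Longrightarrow> form n (const c * g)"
  using form_mult[of 0 "const c" n g] by simp

lemma form_sum: "(\<And>x. x \<in> A \<Longrightarrow> form n (f x)) \<Longrightarrow> form n (sum f A)"
  by (induction A rule: infinite_finite_induct) (auto intro: form_add)

lemma form_power: "form m f \<Longrightarrow> form (k * m) (f ^ k)"
  by (induction k) (auto intro: form_mult)

lemma form_prod: "finite A \<Longrightarrow> (\<And>x. x \<in> A \<Longrightarrow> form (n x) (f x)) \<Longrightarrow> form (sum n A) (prod f A)"
  by (induction A rule: finite_induct) (auto intro: form_mult)

lemma form_unique: "form m f \<Longrightarrow> form n f \<Longrightarrow> f \<noteq> 0 \<Longrightarrow> m = n"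
  by (metis form_iff_homog degree_monom_eq)

lemma mon_mult_const: "mon (\<lambda>x. t * a x) m = t ^ mon_degree m * mon a m"
  by (simp add: mon_def mon_degree_def power_mult_distrib prod.distrib power_sum)

lemma ev_scale:
  assumes "form n f" shows "ev \<phi> (\<lambda>x. t * a x) f = t ^ n * ev \<phi> a f"
proof -
  have "ev \<phi> (\<lambda>x. t * a x) f = (\<Sum>m\<in>Poly_Mapping.keys f. t ^ n * (\<phi> (Poly_Mapping.lookup f m) * mon a m))"
    unfolding ev_def using assms by (intro sum.cong) (auto simp: mon_mult_const form_def)
  then show ?thesis by (simp add: ev_def sum_distrib_left)
qed

lemma subst_scale: "form n f \<Longrightarrow> poly_subst f (\<lambda>x. t * a x) = t ^ n * poly_subst f a"
  unfolding poly_subst_ev by (rule ev_scale)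

lemma eval_scale: "form n f \<Longrightarrow> poly_eval f (\<lambda>x. t * a x) = t ^ n * poly_eval f a"
  unfolding poly_eval_ev by (rule ev_scale)

lemma form_mon: "(\<And>x. form k (a x)) \<Longrightarrow> form (mon_degree m * k) (mon a m)"
  unfolding mon_def mon_degree_def sum_distrib_right by (intro form_prod form_power) auto

lemma form_subst:
  assumes "form n f" "\<And>x. form k (a x)" shows "form (n * k) (poly_subst f a)"
  unfolding poly_subst_ev ev_def using assms(1) form_mon[of k a, OF assms(2)]
  by (intro form_sum form_cmult) (auto simp: form_def[of n f])

lemma form_const_if_form_0:
  fixes f :: "('v, 'k::comm_ring_1) mpoly"
  assumes "form 0 f" obtains c where "f = const c"
proof
  show "f = const (Poly_Mapping.lookup f 0)"
  proof (rule poly_mapping_eqI)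
    fix m :: "'v \<Rightarrow>\<^sub>0 nat"
    have "m = 0" if "mon_degree m = 0"
      using that by (intro poly_mapping_eqI) (auto simp: mon_degree_def in_keys_iff)
    then show "Poly_Mapping.lookup f m = Poly_Mapping.lookup (const (Poly_Mapping.lookup f 0)) m"
      using assms by (cases "m \<in> Poly_Mapping.keys f") (auto simp: const_def lookup_single when_def form_def in_keys_iff)
  qed
qed

text \<open>Order at 0 and degree are both additive, and the order is at most the degree; they agree
  for the product, hence for each factor.\<close>

lemma idom_mult_eq_monom:
  fixes p q :: "'a::idom poly"
  assumes "p * q = monom c n" "c \<noteq> 0"
  obtains a k where "p = monom a k"
proof -
  have nz: "p * q \<noteq> 0" using assms by simp
  have o: "order 0 (p * q) = n" using assms by (simp add: order_0_monom)
  have "degree (p * q) = n" using assms by (simp add: degree_monom_eq)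
  then have "order 0 p + order 0 q = degree p + degree q"
    using order_mult[OF nz, of 0] o degree_mult_eq[of p q] nz by auto
  moreover have "order 0 p \<le> degree p" "order 0 q \<le> degree q"
    using nz by (auto intro: order_degree)
  ultimately have *: "order 0 p = degree p" by linarith
  have "[:-0, 1:] ^ order 0 p dvd p" by (rule order_1)
  then have "monom 1 (degree p) dvd p" by (simp add: monom_altdef *)
  then obtain r where r: "p = monom 1 (degree p) * r" by (auto simp: dvd_def)
  have "degree r = 0"
    using nz r degree_mult_eq[of "monom 1 (degree p)" r]
    by (metis add_cancel_left_right degree_monom_eq mult_eq_0_iff one_neq_zero)
  then obtain a where "r = [:a:]" by (metis degree_eq_zeroE)
  then have "p = monom a (degree p)" using r by (simp add: smult_monom)
  then show ?thesis using that by blast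
qed

text \<open>\<open>homog f\<close> and \<open>homog g\<close> multiply to a monomial, so each is
  one. The order on the variables supplies the integral domain structure; for pairs of indices it is
  the lexicographic one.\<close>

lemma form_factor:
  fixes f :: "('v::linorder, 'k::field) mpoly"
  assumes "form n (f * g)" "f * g \<noteq> 0"
  obtains k where "k \<le> n" "form k f" "form (n - k) g"
proof -
  have e: "homog f * homog g = monom (f * g) n"
    using assms by (simp add: form_iff_homog homog_hom)
  obtain a k where a: "homog f = monom a k"
    using idom_mult_eq_monom[OF e] assms by blast
  obtain b l where b: "homog g = monom b l"
    using idom_mult_eq_monom[of "homog g" "homog f"] e assms by (metis mult.commute)
  have "f = a" "g = b"
    using a b poly_homog_1[of f] poly_homog_1[of g] by (auto simp: poly_monom)
  with a b have f: "form k f" and g: "form l g" by (simp_all add: form_iff_homog)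
  have "k + l = n" using form_unique[OF form_mult[OF f g] assms] .
  with f g that[of k] show ?thesis by auto
qed

lemma form_quotient:
  fixes f :: "('v::linorder, 'k::field) mpoly"
  assumes "form n (f * g)" "f * g \<noteq> 0" "form k f"
  shows "k \<le> n" "form (n - k) g"
proof -
  obtain k' where "k' \<le> n" "form k' f" "form (n - k') g"
    using form_factor[OF assms(1,2)] .
  moreover have "k' = k" using form_unique[of k' f k] \<open>form k' f\<close> assms by auto
  ultimately show "k \<le> n" "form (n - k) g" by auto
qed

lemma const_unit: "c \<noteq> 0 \<Longrightarrow> const (c::'k::field) dvd 1"
  by (rule dvdI[of _ _ "const (inverse c)"]) (simp flip: const_simps)

lemma form_unit_iff:
  fixes f :: "('v::linorder, 'k::field) mpoly"
  assumes "form n f" "f \<noteq> 0" shows "f dvd 1 \<longleftrightarrow> n = 0"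
proof
  assume "f dvd 1"
  then obtain g where "1 = f * g" by (auto simp: dvd_def)
  then show "n = 0" using form_quotient(1)[of 0 f g n] assms by (metis form_one le_0_eq zero_neq_one)
next
  assume "n = 0"
  with assms obtain c where "f = const c" "c \<noteq> 0" by (metis const_eq_0_iff form_const_if_form_0)
  then show "f dvd 1" by (simp add: const_unit)
qed

section \<open>Polynomials over infinite fields\<close>

lemma alg_closed_infinite: "infinite (UNIV :: 'k::alg_closed_field set)"
proof
  assume fin: "finite (UNIV :: 'k set)"
  \<comment> \<open>Takes the value 1 at every element of the field, yet has positive
    degree.\<close>
  let ?p = "(\<Prod>a\<in>(UNIV::'k set). [:- a, 1:]) + 1"
  have deg: "degree (\<Prod>a\<in>(UNIV::'k set). [:- a, 1:]) = card (UNIV::'k set)"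
    by (subst degree_prod_eq_sum_degree) auto
  have "card (UNIV::'k set) > 0" using fin by (simp add: finite_UNIV_card_ge_0)
  then have "degree ?p > 0" using deg by (simp add: degree_add_eq_left)
  then obtain z where "poly ?p z = 0" using alg_closed_imp_poly_has_root by blast
  moreover have "poly (\<Prod>a\<in>(UNIV::'k set). [:- a, 1:]) z = 0"
    using fin by (simp add: poly_prod)
  ultimately show False by simp
qed

text \<open>Induction over the variables that occur: one variable at a time is specialised.\<close>

lemma nonzero_point_aux:
  assumes inf: "infinite (UNIV :: 'k::field set)"
  shows "finite X \<Longrightarrow> (f::('v, 'k) mpoly) \<noteq> 0 \<Longrightarrow> (\<And>m. m \<in> Poly_Mapping.keys f \<Longrightarrow> Poly_Mapping.keys m \<subseteq> X)
    \<Longrightarrow> \<exists>a. poly_eval f a \<noteq> 0"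
proof (induction X arbitrary: f rule: finite_induct)
  case empty
  then have "\<And>m. m \<in> Poly_Mapping.keys f \<Longrightarrow> m = 0" by auto
  then have f: "f = const (Poly_Mapping.lookup f 0)"
    by (intro poly_mapping_eqI) (auto simp: const_def lookup_single when_def in_keys_iff)
  then have "poly_eval f a = Poly_Mapping.lookup f 0" for a by (metis eval_const)
  then show ?case using f empty by auto
next
  case (insert x X)
  define g where "g t = poly_subst f (var(x := const t))" for t
  define h where "h m = Poly_Mapping.update x 0 m" for m :: "'v \<Rightarrow>\<^sub>0 nat"
  have split: "m = Poly_Mapping.single x (Poly_Mapping.lookup m x) + h m" for m
    by (rule poly_mapping_eqI) (auto simp: h_def lookup_add lookup_single lookup_update when_def)
  have mon_g: "mon (var(x := const t)) m = const (t ^ Poly_Mapping.lookup m x) * Poly_Mapping.single (h m) 1"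
    for t and m
  proof -
    have "mon (var(x := const t)) (h m) = mon var (h m)"
      unfolding mon_def h_def by (intro prod.cong) (auto simp: keys_update)
    then show ?thesis
      by (subst split[of m]) (simp add: mon_add mon_single mon_var const_simps)
  qed
  have g: "g t = (\<Sum>m\<in>Poly_Mapping.keys f. Poly_Mapping.single (h m) (Poly_Mapping.lookup f m * t ^ Poly_Mapping.lookup m x))" for t
    unfolding g_def poly_subst_ev ev_def mon_g by (simp add: const_def mult_single)
  obtain m0 where m0: "m0 \<in> Poly_Mapping.keys f" using insert by fastforce
  \<comment> \<open>These monomials agree outside \<open>x\<close>, so they differ in the exponent
    of \<open>x\<close> and cannot cancel in \<open>p\<close>.\<close>
  define M where "M = {m \<in> Poly_Mapping.keys f. h m = h m0}"
  define p where "p = (\<Sum>m\<in>M. monom (Poly_Mapping.lookup f m) (Poly_Mapping.lookup m x))"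
  have fM: "finite M" by (simp add: M_def)
  have lg: "Poly_Mapping.lookup (g t) (h m0) = poly p t" for t
    unfolding g p_def M_def poly_sum lookup_sum
    by (rule sum.mono_neutral_cong_right) (auto simp: lookup_single poly_monom when_def)
  have "coeff p (Poly_Mapping.lookup m0 x) = (\<Sum>m\<in>M. if m = m0 then Poly_Mapping.lookup f m else 0)"
    unfolding p_def coeff_sum
  proof (rule sum.cong[OF refl])
    fix m assume "m \<in> M"
    then have "m = m0" if "Poly_Mapping.lookup m x = Poly_Mapping.lookup m0 x"
      using split[of m] split[of m0] that by (simp add: M_def)
    then show "coeff (monom (Poly_Mapping.lookup f m) (Poly_Mapping.lookup m x)) (Poly_Mapping.lookup m0 x)
        = (if m = m0 then Poly_Mapping.lookup f m else 0)" by auto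
  qed
  also have "\<dots> \<noteq> 0" using m0 fM by (simp add: M_def in_keys_iff)
  finally have "p \<noteq> 0" by auto
  then have "finite {t. poly p t = 0}" by (rule poly_roots_finite)
  then obtain t where t: "poly p t \<noteq> 0" using inf by (metis (mono_tags, lifting) UNIV_I ex_new_if_finite mem_Collect_eq)
  have "g t \<noteq> 0" using lg[of t] t by auto
  moreover have "Poly_Mapping.keys m \<subseteq> X" if "m \<in> Poly_Mapping.keys (g t)" for m
  proof -
    have "m \<in> (\<Union>n\<in>Poly_Mapping.keys f. Poly_Mapping.keys (Poly_Mapping.single (h n) (Poly_Mapping.lookup f n * t ^ Poly_Mapping.lookup n x)))"
      using that unfolding g by (rule set_mp[OF keys_sum])
    then obtain n where "n \<in> Poly_Mapping.keys f" "m = h n" by (auto split: if_splits)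
    then show ?thesis using insert.prems(2)[of n] by (auto simp: h_def keys_update)
  qed
  ultimately obtain a where "poly_eval (g t) a \<noteq> 0" using insert.IH by blast
  then show ?case unfolding g_def eval_subst by blast
qed

lemma nonzero_point:
  assumes "infinite (UNIV :: 'k::field set)" "(f::('v, 'k) mpoly) \<noteq> 0"
  obtains a where "poly_eval f a \<noteq> 0"
  using nonzero_point_aux[OF assms(1), of "\<Union>(Poly_Mapping.keys ` Poly_Mapping.keys f)" f] assms(2)
  by (auto intro: that)

lemma poly_eqI_eval:
  assumes "infinite (UNIV :: 'k::field set)" "\<And>a. poly_eval f a = poly_eval g a"
  shows "(f::('v, 'k) mpoly) = g"
proof (rule ccontr)
  assume "f \<noteq> g"
  then obtain a where "poly_eval (f - g) a \<noteq> 0" using nonzero_point[OF assms(1), of "f - g"] by auto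
  then show False using assms(2)[of a] by (simp add: eval_hom)
qed

section \<open>Divisibility by linear forms\<close>

lemma dvd_power_diff: "t dvd a - b \<Longrightarrow> t dvd a ^ n - (b::'a::comm_ring_1) ^ n"
proof (induction n)
  case (Suc n)
  have "a ^ Suc n - b ^ Suc n = a * (a ^ n - b ^ n) + (a - b) * b ^ n"
    by (simp add: algebra_simps)
  with Suc show ?case by simp
qed simp

lemma dvd_prod_diff:
  "(\<And>x. x \<in> A \<Longrightarrow> t dvd f x - g x) \<Longrightarrow> t dvd prod f A - (prod g A :: 'a::comm_ring_1)"
proof (induction A rule: infinite_finite_induct)
  case (insert x A)
  have "prod f (insert x A) - prod g (insert x A) = f x * (prod f A - prod g A) + (f x - g x) * prod g A"
    using insert by (simp add: algebra_simps)
  with insert show ?case by simp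
qed simp_all

lemma dvd_subst_diff:
  assumes "\<And>x. t dvd a x - b x" shows "t dvd poly_subst f a - poly_subst f b"
  unfolding poly_subst_ev ev_def mon_def
  unfolding sum_subtractf[symmetric] right_diff_distrib[symmetric]
  by (intro dvd_sum dvd_mult dvd_prod_diff dvd_power_diff assms)

text \<open>A polynomial \<open>t\<close> that is killed by a substitution \<open>\<rho>\<close> which is the identity modulo \<open>t\<close>:
  divisibility by \<open>t\<close> becomes the vanishing of a ring homomorphism, which makes \<open>t\<close> prime.\<close>

lemma dvd_iff_retract:
  assumes "\<And>x. t dvd var x - \<rho> x" "poly_subst t \<rho> = 0"
  shows "t dvd f \<longleftrightarrow> poly_subst f \<rho> = 0"
proof
  assume "t dvd f"
  then show "poly_subst f \<rho> = 0" using assms(2) by (auto simp: dvd_def subst_hom)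
next
  assume "poly_subst f \<rho> = 0"
  then show "t dvd f"
    using dvd_subst_diff[where a = var and b = \<rho> and t = t and f = f, OF assms(1)] by (simp add: subst_id)
qed

lemma prime_elem_retract:
  fixes t :: "('v::linorder, 'k::field) mpoly"
  assumes "\<And>x. t dvd var x - \<rho> x" "poly_subst t \<rho> = 0" "t \<noteq> 0"
  shows "prime_elem t"
  using dvd_iff_retract[OF assms(1,2)] assms(3)
  by (auto simp: prime_elem_def subst_hom)

lemma var_dvd_iff: "var x dvd f \<longleftrightarrow> poly_subst f (var(x := 0)) = 0"
  by (rule dvd_iff_retract) auto

lemma var_neq_0 [simp]: "(var x :: ('v, 'k::field) mpoly) \<noteq> 0"
  unfolding var_def by (metis lookup_single_eq lookup_zero zero_neq_one)

lemma prime_elem_var: "prime_elem (var x :: ('v::linorder, 'k::field) mpoly)"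
  by (rule prime_elem_retract[of _ "var(x := 0)"]) auto

text \<open>The share of unique factorisation used throughout: one factor \<open>t\<close> at a time
  is split off from \<open>b\<close>.\<close>

lemma prime_elem_power_dvd_mult:
  fixes t :: "'a::idom"
  assumes "prime_elem t" "\<not> t dvd a"
  shows "t ^ n dvd a * b \<Longrightarrow> t ^ n dvd b"
proof (induction n arbitrary: b)
  case (Suc n)
  have "t dvd a * b" using Suc.prems by (meson dvd_trans dvd_power zero_less_Suc)
  then have "t dvd b" using assms by (auto simp: prime_elem_def)
  then obtain b' where b': "b = t * b'" ..
  have "t * t ^ n dvd t * (a * b')" using Suc.prems by (simp add: b' mult_ac)
  then have "t ^ n dvd a * b'" using assms by (simp add: prime_elem_def)
  then have "t ^ n dvd b'" by (rule Suc.IH)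
  then show ?case by (simp add: b' mult_dvd_mono)
qed simp

lemma prime_elem_dvd_powerD:
  fixes t :: "'a::comm_semiring_1"
  assumes "prime_elem t" "t dvd a ^ n" shows "t dvd a"
  using assms by (induction n) (auto simp: prime_elem_def)

lemma prod_prime_powers_dvd:
  fixes P :: "'i \<Rightarrow> 'a::idom"
  assumes "finite A" "\<And>a. a \<in> A \<Longrightarrow> prime_elem (P a)"
    and "\<And>a b. a \<in> A \<Longrightarrow> b \<in> A \<Longrightarrow> a \<noteq> b \<Longrightarrow> \<not> P a dvd P b"
    and "\<And>a. a \<in> A \<Longrightarrow> P a ^ n a dvd g"
  shows "(\<Prod>a\<in>A. P a ^ n a) dvd g"
  using assms
proof (induction A arbitrary: g rule: finite_induct)
  case (insert x A)
  obtain h where h: "g = P x ^ n x * h" using insert.prems(3) by (auto simp: dvd_def)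
  have "P a ^ n a dvd h" if "a \<in> A" for a
  proof (rule prime_elem_power_dvd_mult)
    show pa: "prime_elem (P a)" using that insert.prems(1) by simp
    have "a \<noteq> x" using that insert.hyps by auto
    then have "\<not> P a dvd P x" using that insert.prems(2)[of a x] by simp
    then show "\<not> P a dvd P x ^ n x" using prime_elem_dvd_powerD[OF pa] by blast
    show "P a ^ n a dvd P x ^ n x * h" using that insert.prems(3)[of a] by (simp add: h)
  qed
  then have "(\<Prod>a\<in>A. P a ^ n a) dvd h" using insert.IH insert.prems(1,2) by simp
  then show ?case using insert.hyps by (simp add: h mult_dvd_mono)
qed simp

section \<open>Multiplicity at a point\<close>

text \<open>Variables \<open>0\<close> and \<open>1\<close> play the roles of \<open>S\<close> and
  \<open>T\<close>, and \<open>2\<close>, \<open>3\<close>, \<open>4\<close> are the coordinates of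
  the generic direction \<open>W\<close>.\<close>

definition spread :: "(3 \<Rightarrow> 'k::comm_ring_1) \<Rightarrow> 3 \<Rightarrow> (nat, 'k) mpoly" where
  "spread p j = const (p j) * var 0 + var 1 * var (if j = 0 then 2 else if j = 1 then 3 else 4)"

text \<open>The form \<open>f\<close> has multiplicity at least \<open>m\<close> at the point with coordinate vector \<open>p\<close>: its value at
  \<open>S p + T W\<close>, for indeterminates \<open>S\<close>, \<open>T\<close>, \<open>W\<close>, is divisible by \<open>T ^ m\<close>.\<close>

definition mult_ge :: "nat \<Rightarrow> (3 \<Rightarrow> 'k::comm_ring_1) \<Rightarrow> (3, 'k) mpoly \<Rightarrow> bool" where
  "mult_ge m p f \<longleftrightarrow> var 1 ^ m dvd poly_subst f (spread p)"

lemma UNIV_3: "(UNIV :: 3 set) = {0, 1, 2}"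
proof -
  have "card {0, 1, 2 :: 3} = 3" by (simp add: card_insert_if)
  then show ?thesis by (intro card_subset_eq[symmetric]) auto
qed

lemma exhaust_3: "(a::3) = 0 \<or> a = 1 \<or> a = 2"
  using UNIV_3 by auto

lemma forall_3: "(\<forall>a::3. P a) \<longleftrightarrow> P 0 \<and> P 1 \<and> P 2"
  by (metis exhaust_3)

lemma sum_3: "sum f (UNIV :: 3 set) = f 0 + f 1 + f 2"
  unfolding UNIV_3 by (simp add: add.assoc)

lemma prod_3: "prod f (UNIV :: 3 set) = f 0 * f 1 * f 2"
  unfolding UNIV_3 by (simp add: mult.assoc)

lemma numeral_3 [simp]: "(3::3) = 0" "(4::3) = 1"
  by simp_all

lemma add_3 [simp]: "(1::3) + 1 = 2" "(1::3) + 2 = 0" "(2::3) + 1 = 0" "(2::3) + 2 = 1"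
  "(a::3) + 1 + 1 = a + 2" "a + 1 + 2 = a" "a + 2 + 1 = a" "a + 2 + 2 = a + 1"
  "a + 1 \<noteq> a" "a + 2 \<noteq> a" "a \<noteq> a + 1" "a \<noteq> a + 2" "a + 1 \<noteq> a + 2" "a + 2 \<noteq> a + 1"
proof -
  show "(1::3) + 1 = 2" "(1::3) + 2 = 0" "(2::3) + 1 = 0" "(2::3) + 2 = 1" by (simp_all)
  show "(a::3) + 1 + 1 = a + 2" "a + 1 + 2 = a" "a + 2 + 1 = a" "a + 2 + 2 = a + 1"
    by (simp_all add: add.assoc)
qed simp_all

lemma cyc_cases: "(b::3) = a \<or> b = a + 1 \<or> b = a + 2"
  using exhaust_3[of a] exhaust_3[of b] by auto

lemma sum_cyc: "sum f (UNIV :: 3 set) = f a + f (a + 1) + f (a + 2)"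
  using exhaust_3[of a] by (auto simp: sum_3 ac_simps)

lemma prod_cyc: "prod f (UNIV :: 3 set) = f a * f (a + 1) * f (a + 2)"
  using exhaust_3[of a] by (auto simp: prod_3 ac_simps)

text \<open>\<open>S\<close>, \<open>T\<close>, \<open>W\<close> are indeterminates, so the
  divisibility survives specialisation to any elements of any ring. A good choice of
  \<open>s\<close>, \<open>t\<close>, \<open>w\<close> is how multiplicity is exploited
  later.\<close>

lemma mult_ge_ev:
  assumes "mult_ge m p f" "is_hom \<phi>"
  shows "t ^ m dvd ev \<phi> (\<lambda>j. \<phi> (p j) * s + t * w j) f"
proof -
  define b where "b n = (if n = 0 then s else if n = 1 then t else if n = 2 then w 0
    else if n = 3 then w 1 else w 2)" for n :: nat
  note hom = is_hom_ev[OF assms(2), of b]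
  have "ev \<phi> b (var 1 ^ m) dvd ev \<phi> b (poly_subst f (spread p))"
    using hom_dvd[OF hom] assms(1) by (simp add: mult_ge_def)
  also have "ev \<phi> b (var 1 ^ m) = t ^ m"
    by (simp add: hom_power[OF hom] ev_var[OF assms(2)] b_def)
  also have "ev \<phi> b (poly_subst f (spread p)) = ev \<phi> (\<lambda>j. \<phi> (p j) * s + t * w j) f"
    unfolding ev_subst[OF assms(2)]
  proof (rule arg_cong[of _ _ "\<lambda>a. ev \<phi> a f"], rule ext)
    fix j :: 3
    show "ev \<phi> b (spread p j) = \<phi> (p j) * s + t * w j"
      using exhaust_3[of j]
      by (auto simp: spread_def hom_simps[OF hom] ev_var[OF assms(2)] ev_const[OF assms(2)] b_def)
  qed
  finally show ?thesis .
qed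

lemma mult_ge_subst:
  assumes "mult_ge m p f"
  shows "t ^ m dvd poly_subst f (\<lambda>j. const (p j) * s + t * w j)"
  using mult_ge_ev[OF assms is_hom_const] by (simp add: poly_subst_ev)

lemma mult_ge_0 [simp]: "mult_ge 0 p f" and mult_ge_zero [simp]: "mult_ge m p 0"
  by (simp_all add: mult_ge_def subst_hom)

lemma mult_ge_mono: "mult_ge m p f \<Longrightarrow> n \<le> m \<Longrightarrow> mult_ge n p f"
  unfolding mult_ge_def by (meson le_imp_power_dvd dvd_trans)

lemma mult_ge_add: "mult_ge m p f \<Longrightarrow> mult_ge m p g \<Longrightarrow> mult_ge m p (f + g)"
  by (simp add: mult_ge_def subst_hom)

lemma mult_ge_mult: "mult_ge m p f \<Longrightarrow> mult_ge n p g \<Longrightarrow> mult_ge (m + n) p (f * g)"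
  by (simp add: mult_ge_def subst_hom power_add mult_dvd_mono)

lemma mult_ge_cmult: "mult_ge m p g \<Longrightarrow> mult_ge m p (h * g)"
  using mult_ge_mult[of 0 p h m g] by simp

lemma mult_ge_const_iff: "c \<noteq> 0 \<Longrightarrow> mult_ge m p (const (c::'k::field) * f) \<longleftrightarrow> mult_ge m p f"
  using mult_ge_cmult[of m p f "const c"] mult_ge_cmult[of m p "const c * f" "const (inverse c)"]
  by (auto simp: mult.assoc[symmetric] const_simps[symmetric]) (auto simp: const_simps)

lemma mult_ge_sum: "(\<And>x. x \<in> A \<Longrightarrow> mult_ge m p (f x)) \<Longrightarrow> mult_ge m p (sum f A)"
  by (induction A rule: infinite_finite_induct) (auto intro: mult_ge_add)

text \<open>The factor \<open>c\<close> is absorbed into the indeterminate \<open>S\<close>, so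
  multiplicity depends on the projective point only.\<close>

lemma mult_ge_scale:
  assumes "(c::'k::field) \<noteq> 0" "q = (\<lambda>j. c * p j)"
  shows "mult_ge m q f \<longleftrightarrow> mult_ge m p f"
proof -
  have *: "mult_ge m (\<lambda>j. c * p j) f" if "mult_ge m p f" for c and p :: "3 \<Rightarrow> 'k"
  proof -
    have e: "spread (\<lambda>j. c * p j) = (\<lambda>j. const (p j) * (const c * var 0) +
        var 1 * var (if j = 0 then 2 else if j = 1 then 3 else 4))"
      by (rule ext) (simp add: spread_def const_simps mult_ac)
    show ?thesis
      unfolding mult_ge_def e by (rule mult_ge_subst[OF that])
  qed
  have "p = (\<lambda>j. inverse c * q j)" using assms by (auto simp: mult.assoc[symmetric])
  then show ?thesis using *[of p c] *[of q "inverse c"] assms by auto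
qed

lemma subst_const_fun: "poly_subst f (\<lambda>x. const (a x)) = const (poly_eval f a)"
  unfolding poly_subst_ev poly_eval_ev by (rule hom_ev[OF is_hom_id is_hom_const, symmetric])

lemma subst_spread_T0: "form n g \<Longrightarrow>
  poly_subst (poly_subst g (spread p)) (var(1 := 0)) = var 0 ^ n * const (poly_eval g p)"
  unfolding subst_subst using subst_scale[of n g "var 0 :: (nat, _) mpoly" "\<lambda>j. const (p j)"]
  by (simp add: spread_def subst_hom subst_const_fun mult.commute)

lemma mult_ge_1_iff:
  fixes g :: "(3, 'k::field) mpoly"
  assumes "form n g" shows "mult_ge 1 p g \<longleftrightarrow> poly_eval g p = 0"
  by (simp add: mult_ge_def var_dvd_iff[of "1::nat", simplified] subst_spread_T0[OF assms, simplified])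

lemma mult_ge_cancel:
  fixes g :: "(3, 'k::field) mpoly"
  assumes "form n g" "poly_eval g p \<noteq> 0" "mult_ge m p (g * f)" shows "mult_ge m p f"
  unfolding mult_ge_def
proof (rule prime_elem_power_dvd_mult[OF prime_elem_var])
  show "\<not> var 1 dvd poly_subst g (spread p)"
    using assms mult_ge_1_iff[of n g p] by (simp add: mult_ge_def)
qed (use assms in \<open>simp add: mult_ge_def subst_hom\<close>)

section \<open>Standard quadratic maps\<close>

definition det3 :: "(3 \<Rightarrow> 'a::comm_ring_1) \<Rightarrow> (3 \<Rightarrow> 'a) \<Rightarrow> (3 \<Rightarrow> 'a) \<Rightarrow> 'a" where
  "det3 u v w = u 0 * (v 1 * w 2 - v 2 * w 1) - u 1 * (v 0 * w 2 - v 2 * w 0) + u 2 * (v 0 * w 1 - v 1 * w 0)"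

lemma hom_det3: "is_hom h \<Longrightarrow> h (det3 u v w) = det3 (\<lambda>j. h (u j)) (\<lambda>j. h (v j)) (\<lambda>j. h (w j))"
  by (simp add: det3_def hom_simps)

definition delta :: "(3 \<Rightarrow> 3 \<Rightarrow> 'a::comm_ring_1) \<Rightarrow> 'a" where
  "delta p = det3 (p 0) (p 1) (p 2)"

text \<open>Indices in \<^typ>\<open>3\<close> are cyclic, so \<open>a + 1\<close> and \<open>a + 2\<close> are the two indices other than \<open>a\<close>, and
  \<open>cof p a = 0\<close> is the line through the points \<open>p (a + 1)\<close> and \<open>p (a + 2)\<close>.\<close>

definition cof :: "(3 \<Rightarrow> 3 \<Rightarrow> 'a::comm_ring_1) \<Rightarrow> 3 \<Rightarrow> (3 \<Rightarrow> 'a) \<Rightarrow> 'a" where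
  "cof p a u = det3 u (p (a + 1)) (p (a + 2))"

text \<open>The quadratic map that is undefined at the three points \<open>p a\<close> and contracts the lines through
  two of them, as a map on vectors over any ring; it is an involution of the plane.\<close>

definition quad :: "(3 \<Rightarrow> 3 \<Rightarrow> 'a::comm_ring_1) \<Rightarrow> (3 \<Rightarrow> 'a) \<Rightarrow> 3 \<Rightarrow> 'a" where
  "quad p u j = (\<Sum>a\<in>UNIV. cof p (a + 1) u * cof p (a + 2) u * p a j)"

lemma hom_delta: "is_hom h \<Longrightarrow> h (delta p) = delta (\<lambda>a j. h (p a j))"
  by (simp add: delta_def hom_det3)

lemma hom_cof: "is_hom h \<Longrightarrow> h (cof p a u) = cof (\<lambda>a j. h (p a j)) a (\<lambda>j. h (u j))"
  by (simp add: cof_def hom_det3)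

lemma hom_quad: "is_hom h \<Longrightarrow> h (quad p u j) = quad (\<lambda>a j. h (p a j)) (\<lambda>j. h (u j)) j"
  by (simp add: quad_def hom_sum hom_mult hom_cof)

lemma cof_self: "cof p a (p b) = (if a = b then delta p else 0)"
  using exhaust_3[of a] exhaust_3[of b]
  by (elim disjE; simp add: cof_def delta_def det3_def; simp add: algebra_simps)

lemma cof_add: "cof p a (\<lambda>j. u j + v j) = cof p a u + cof p a v"
  by (simp add: cof_def det3_def algebra_simps)

lemma cof_smult: "cof p a (\<lambda>j. c * u j) = c * cof p a u"
  by (simp add: cof_def det3_def algebra_simps)

lemma cof_sum: "cof p a (\<lambda>j. \<Sum>b\<in>A. u b j) = (\<Sum>b\<in>A. cof p a (u b))"
proof (induction A rule: infinite_finite_induct)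
  case (insert b A)
  then show ?case by (simp add: cof_add)
qed (simp_all add: cof_def det3_def)

text \<open>Cramer's rule: divided by \<open>delta p\<close>, the values \<open>cof p a u\<close>
  are the coordinates of \<open>u\<close> in the basis \<open>p 0\<close>, \<open>p 1\<close>,
  \<open>p 2\<close>.\<close>

lemma cof_expand: "(\<Sum>a\<in>UNIV. cof p a u * p a j) = delta p * u j"
  using exhaust_3[of j]
  by (elim disjE; simp add: sum_3 cof_def delta_def det3_def; simp add: algebra_simps)

lemma cof_comb: "cof p a (\<lambda>j. \<Sum>b\<in>UNIV. c b * p b j) = c a * delta p"
  unfolding cof_sum cof_smult cof_self by (simp add: if_distrib[of "\<lambda>x. _ * x"] cong: if_cong)

text \<open>In coordinates with respect to the points \<open>p a\<close>, and up to powers of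
  \<open>delta p\<close>, the map is \<open>(x, y, z)\<close> to
  \<open>(y z, z x, x y)\<close>.\<close>

lemma cof_quad: "cof p a (quad p u) = delta p * cof p (a + 1) u * cof p (a + 2) u"
  unfolding quad_def cof_comb by (simp add: mult_ac)

lemma quad_quad: "quad p (quad p u) j = delta p ^ 3 * (\<Prod>a\<in>UNIV. cof p a u) * u j"
proof -
  have "quad p (quad p u) j =
      (\<Sum>a\<in>UNIV. (delta p ^ 2 * (\<Prod>a\<in>UNIV. cof p a u)) * (cof p a u * p a j))"
    unfolding quad_def[of p "quad p u"] cof_quad
  proof (rule sum.cong[OF refl])
    fix a :: 3
    show "delta p * cof p (a + 1 + 1) u * cof p (a + 1 + 2) u *
        (delta p * cof p (a + 2 + 1) u * cof p (a + 2 + 2) u) * p a j =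
        (delta p ^ 2 * (\<Prod>a\<in>UNIV. cof p a u)) * (cof p a u * p a j)"
      by (simp add: prod_cyc[of _ a] power2_eq_square mult_ac)
  qed
  also have "\<dots> = delta p ^ 2 * (\<Prod>a\<in>UNIV. cof p a u) * (delta p * u j)"
    by (simp only: sum_distrib_left[symmetric] cof_expand)
  finally show ?thesis by (simp add: power2_eq_square power3_eq_cube mult_ac)
qed

text \<open>The generic vector \<open>var\<close> turns \<open>cof\<close> and \<open>quad\<close> into forms.\<close>

definition lf :: "(3 \<Rightarrow> 3 \<Rightarrow> 'k::field) \<Rightarrow> 3 \<Rightarrow> (3, 'k) mpoly" where
  "lf p a = cof (\<lambda>a j. const (p a j)) a var"

definition tq :: "(3 \<Rightarrow> 3 \<Rightarrow> 'k::field) \<Rightarrow> 3 \<Rightarrow> (3, 'k) mpoly" where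
  "tq p j = quad (\<lambda>a j. const (p a j)) var j"

lemma subst_lf: "poly_subst (lf p a) u = cof (\<lambda>a j. const (p a j)) a u"
  by (simp add: lf_def hom_cof[OF is_hom_subst])

lemma subst_tq: "poly_subst (tq p j) u = quad (\<lambda>a j. const (p a j)) u j"
  by (simp add: tq_def hom_quad[OF is_hom_subst])

lemma eval_lf [simp]: "poly_eval (lf p a) x = cof p a x"
  by (simp add: lf_def hom_cof[OF is_hom_eval])

lemma eval_tq [simp]: "poly_eval (tq p j) x = quad p x j"
  by (simp add: tq_def hom_quad[OF is_hom_eval])

lemma delta_const: "delta (\<lambda>a j. const (p a j)) = const (delta p)"
  by (simp add: hom_delta[OF is_hom_const])

lemma cof_const: "cof (\<lambda>a j. const (p a j)) a (\<lambda>j. const (x j)) = const (cof p a x)"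
  by (simp add: hom_cof[OF is_hom_const])

lemma form_lf [simp]: "form 1 (lf p a)" "form (Suc 0) (lf p a)"
proof -
  let ?v = "p (a + 1)" and ?w = "p (a + 2)"
  have "lf p a = const (?v 1 * ?w 2 - ?v 2 * ?w 1) * var 0 -
      const (?v 0 * ?w 2 - ?v 2 * ?w 0) * var 1 + const (?v 0 * ?w 1 - ?v 1 * ?w 0) * var 2"
    by (simp add: lf_def cof_def det3_def const_simps mult.commute)
  then show "form 1 (lf p a)"
    by (simp del: One_nat_def add: form_add form_diff form_cmult)
  then show "form (Suc 0) (lf p a)" by simp
qed

lemma tq_eq: "tq p j = (\<Sum>a\<in>UNIV. const (p a j) * (lf p (a + 1) * lf p (a + 2)))"
  by (simp add: tq_def quad_def lf_def mult_ac)

lemma form_tq [simp]: "form 2 (tq p j)"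
  unfolding tq_eq
  by (rule form_sum, rule form_cmult)
     (use form_mult[OF form_lf(1) form_lf(1)] in \<open>simp add: numeral_2_eq_2\<close>)

lemma form_prod_lf: "form (\<Sum>a\<in>UNIV. m a) (\<Prod>a\<in>UNIV. lf p a ^ m a)"
  using form_power[OF form_lf(1)] by (intro form_prod) auto

section \<open>Sides of a non-degenerate triangle as primes, and multiplicities at its
  vertices\<close>

context
  fixes p :: "3 \<Rightarrow> 3 \<Rightarrow> 'k::field"
  assumes delta: "delta p \<noteq> 0"
begin

lemma lf_neq_0 [simp]: "lf p a \<noteq> 0"
proof
  assume "lf p a = 0"
  then have "poly_eval (lf p a) (p a) = 0" by (simp add: eval_hom)
  then show False using delta by (simp add: cof_self)
qed

lemma prime_elem_lf: "prime_elem (lf p a)"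
proof (rule prime_elem_retract)
  \<comment> \<open>Projection from \<open>p a\<close> onto the opposite side: the retraction that
    kills \<open>lf p a\<close>.\<close>
  let ?c = "const (inverse (delta p))"
  let ?\<rho> = "\<lambda>j. var j + (- (?c * lf p a)) * const (p a j)"
  show "lf p a dvd var x - ?\<rho> x" for x by simp
  have "poly_subst (lf p a) ?\<rho> = cof (\<lambda>a j. const (p a j)) a var +
      (- (?c * lf p a)) * cof (\<lambda>a j. const (p a j)) a (\<lambda>j. const (p a j))"
    unfolding subst_lf cof_add cof_smult ..
  also have "\<dots> = lf p a - const (inverse (delta p) * delta p) * lf p a"
    by (simp add: cof_const cof_self lf_def[symmetric] const_simps)
  finally show "poly_subst (lf p a) ?\<rho> = 0" using delta by (simp add: const_simps)
qed simp

lemma lf_not_dvd: "a \<noteq> b \<Longrightarrow> \<not> lf p a dvd lf p b"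
proof
  assume "a \<noteq> b" "lf p a dvd lf p b"
  then have "poly_eval (lf p a) (p b) dvd poly_eval (lf p b) (p b)" by (metis hom_dvd is_hom_eval)
  then show False using delta \<open>a \<noteq> b\<close> by (simp add: cof_self)
qed

lemma subst_lf_tq: "poly_subst (lf p a) (tq p) = const (delta p) * lf p (a + 1) * lf p (a + 2)"
  using cof_quad[of "\<lambda>a j. const (p a j)" a var]
  by (simp add: tq_def[abs_def] lf_def delta_const hom_cof[OF is_hom_subst])

lemma subst_prod_lf_tq:
  "poly_subst (\<Prod>a\<in>UNIV. lf p a ^ m a) (tq p) =
    const (delta p ^ (\<Sum>a\<in>UNIV. m a)) * (\<Prod>a\<in>UNIV. lf p a ^ (m (a + 1) + m (a + 2)))"
  by (simp add: subst_hom subst_lf_tq prod_3 sum_3 power_mult_distrib power_add const_simps mult_ac)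

lemma subst_tq_tq:
  assumes "form e f"
  shows "poly_subst (poly_subst f (tq p)) (tq p) =
    const (delta p ^ (3 * e)) * (\<Prod>a\<in>UNIV. lf p a ^ e) * f"
proof -
  have "poly_subst (tq p j) (tq p) = (const (delta p ^ 3) * (\<Prod>a\<in>UNIV. lf p a)) * var j" for j
    using quad_quad[of "\<lambda>a j. const (p a j)" var j]
    by (simp add: tq_def[abs_def] delta_const lf_def const_simps hom_quad[OF is_hom_subst])
  then show ?thesis
    by (simp add: subst_subst subst_scale[OF assms] subst_id power_mult_distrib const_simps
        flip: power_mult prod_power_distrib)
qed

lemma subst_tq_0_iff: "form e f \<Longrightarrow> poly_subst f (tq p) = 0 \<longleftrightarrow> f = 0"
  using subst_tq_tq[of e f] delta by (auto simp: subst_hom const_simps)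

text \<open>The side \<open>lf p a = 0\<close> is contracted to \<open>p a\<close>: modulo
  \<open>lf p a\<close> only the term at \<open>p a\<close> survives. So \<open>S\<close> becomes
  the product of the other two sides and \<open>T\<close> becomes \<open>lf p a\<close>.\<close>

lemma lf_power_dvd_subst_tq:
  assumes "mult_ge k (p a) f" shows "lf p a ^ k dvd poly_subst f (tq p)"
proof -
  have e: "tq p = (\<lambda>j. const (p a j) * (lf p (a + 1) * lf p (a + 2)) +
      lf p a * (const (p (a + 1) j) * lf p (a + 2) + const (p (a + 2) j) * lf p (a + 1)))"
    by (rule ext) (simp add: tq_eq sum_cyc[of _ a] algebra_simps)
  show ?thesis unfolding e by (rule mult_ge_subst[OF assms])
qed

text \<open>A vector \<open>v\<close> is constructed that the quadratic map sends to a multiple of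
  the generic vector \<open>u = S p a + T W\<close>. At \<open>v\<close> the form
  \<open>lf p a\<close> is divisible by \<open>T\<close> while the multiplier of \<open>u\<close> is
  not, so powers of \<open>lf p a\<close> become powers of \<open>T\<close> dividing the expansion
  of \<open>f\<close>.\<close>

lemma mult_ge_if_lf_power_dvd:
  assumes f: "form e f" and dvd: "lf p a ^ k dvd poly_subst f (tq p)"
  shows "mult_ge k (p a) f"
proof -
  let ?cp = "\<lambda>a j. const (p a j) :: (nat, 'k) mpoly"
  let ?u = "spread (p a)"
  let ?w = "\<lambda>j::3. var (if j = 0 then 2 else if j = 1 then 3 else 4) :: (nat, 'k) mpoly"
  let ?D = "const (delta p) :: (nat, 'k) mpoly" and ?T = "var 1 :: (nat, 'k) mpoly"
  define A where "A = cof ?cp a ?u"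
  define B where "B = cof ?cp (a + 1) ?w"
  define C where "C = cof ?cp (a + 2) ?w"
  \<comment> \<open>The coordinates of \<open>u\<close> are \<open>A\<close>, \<open>T B\<close>,
    \<open>T C\<close> up to \<open>delta p\<close>. The involution gives \<open>T B T C\<close>,
    \<open>A T C\<close>, \<open>A T B\<close>, from which one common factor \<open>T\<close> is
    removed.\<close>
  define c where "c b = (if b = a then ?T * B * C else if b = a + 1 then A * C else A * B)" for b
  define v where "v j = (\<Sum>b\<in>UNIV. c b * ?cp b j)" for j
  have u: "?u = (\<lambda>j. var 0 * ?cp a j + ?T * ?w j)"
    by (rule ext) (simp add: spread_def mult.commute)
  have cu: "cof ?cp b ?u = (if b = a then A else if b = a + 1 then ?T * B else ?T * C)" for b
  proof -
    have "cof ?cp b ?u = var 0 * cof ?cp b (?cp a) + ?T * cof ?cp b ?w" for b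
      unfolding u cof_add cof_smult ..
    then have "cof ?cp b ?u = ?T * cof ?cp b ?w" if "b \<noteq> a" for b
      using that cof_self[of ?cp b a] by simp
    then show ?thesis using cyc_cases[of b a] by (auto simp: A_def B_def C_def)
  qed
  have cv: "cof ?cp b v = ?D * c b" for b
    unfolding v_def cof_comb by (simp add: delta_const mult.commute)
  have "quad ?cp v j = (?D ^ 3 * A * B * C) * ?u j" for j
  proof -
    have "quad ?cp v j = ?D ^ 2 * (A * B * C) * (\<Sum>b\<in>UNIV. cof ?cp b ?u * ?cp b j)"
      unfolding quad_def cv cu sum_cyc[of _ a]
      by (simp add: c_def power2_eq_square algebra_simps)
    also have "(\<Sum>b\<in>UNIV. cof ?cp b ?u * ?cp b j) = ?D * ?u j"
      using cof_expand[of ?cp ?u j] by (simp add: delta_const)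
    finally show ?thesis by (simp add: power2_eq_square power3_eq_cube mult_ac)
  qed
  then have "poly_subst (poly_subst f (tq p)) v = (?D ^ 3 * A * B * C) ^ e * poly_subst f ?u"
    by (simp add: subst_subst subst_tq subst_scale[OF f])
  moreover have "poly_subst (lf p a ^ k) v dvd poly_subst (poly_subst f (tq p)) v"
    using dvd by (metis hom_dvd is_hom_subst)
  moreover have "poly_subst (lf p a ^ k) v = (?D * (?T * B * C)) ^ k"
    by (simp add: subst_hom subst_lf cv c_def)
  ultimately have "(?D * (?T * B * C)) ^ k dvd (?D ^ 3 * A * B * C) ^ e * poly_subst f ?u"
    by simp
  moreover have "?T ^ k dvd (?D * (?T * B * C)) ^ k" by (simp add: power_mult_distrib)
  ultimately have d: "?T ^ k dvd (?D ^ 3 * A * B * C) ^ e * poly_subst f ?u"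
    using dvd_trans by blast
  have T: "prime_elem ?T" by (rule prime_elem_var)
  \<comment> \<open>\<open>T\<close> divides no factor of the multiplier: \<open>A\<close> is
    \<open>S\<close> times \<open>delta p\<close> modulo \<open>T\<close>, while \<open>B\<close>
    and \<open>C\<close> do not involve \<open>T\<close> and take the value \<open>delta p\<close>
    when \<open>W\<close> is the matching vertex.\<close>
  have nA: "\<not> ?T dvd A"
  proof -
    have "A = var 0 * const (delta p) + ?T * cof ?cp a ?w"
      unfolding A_def u cof_add cof_smult using cof_self[of ?cp a a] by (simp add: delta_const)
    then have "poly_subst A (var(1 := 0)) = var 0 * const (delta p)" by (simp add: subst_hom)
    then show ?thesis using delta by (simp add: var_dvd_iff[of "1::nat", simplified])
  qed
  have nW: "\<not> ?T dvd cof ?cp b ?w" for b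
  proof
    assume "?T dvd cof ?cp b ?w"
    then have "poly_subst (cof ?cp b ?w) (var(1 := 0)) = 0" by (simp add: var_dvd_iff[of "1::nat", simplified])
    moreover have "poly_subst (cof ?cp b ?w) (var(1 := 0)) = cof ?cp b ?w"
      unfolding hom_cof[OF is_hom_subst] subst_const subst_var
      by (rule arg_cong[of _ _ "cof ?cp b"], rule ext) auto
    ultimately have "cof ?cp b ?w = 0" by simp
    then have "poly_eval (cof ?cp b ?w) (\<lambda>n. p b (if n = 2 then 0 else if n = 3 then 1 else 2)) = 0"
      by (simp add: eval_hom)
    moreover have "poly_eval (cof ?cp b ?w) (\<lambda>n. p b (if n = 2 then 0 else if n = 3 then 1 else 2)) =
      cof p b (p b)"
      unfolding hom_cof[OF is_hom_eval] eval_const eval_var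
      by (rule arg_cong[of _ _ "cof p b"], rule ext) (use exhaust_3 in \<open>auto split: if_splits\<close>)
    ultimately show False using delta by (simp add: cof_self)
  qed
  have "\<not> ?T dvd ?D ^ 3 * A * B * C"
  proof
    assume "?T dvd ?D ^ 3 * A * B * C"
    moreover have "\<not> ?T dvd ?D ^ 3"
      using const_unit[OF delta] prime_elem_dvd_powerD[OF T, of ?D] T
      by (meson dvd_trans prime_elem_not_unit)
    ultimately show False
      using nA nW[of "a + 1"] nW[of "a + 2"] T unfolding B_def C_def
      by (simp add: prime_elem_dvd_mult_iff)
  qed
  then have "\<not> ?T dvd (?D ^ 3 * A * B * C) ^ e" using prime_elem_dvd_powerD[OF T] by blast
  from prime_elem_power_dvd_mult[OF T this d] show ?thesis by (simp add: mult_ge_def)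
qed

lemma mult_ge_iff_lf_power_dvd:
  "form e f \<Longrightarrow> mult_ge k (p a) f \<longleftrightarrow> lf p a ^ k dvd poly_subst f (tq p)"
  using lf_power_dvd_subst_tq mult_ge_if_lf_power_dvd by blast

lemma prod_lf_power_dvd:
  assumes "\<And>a. mult_ge (m a) (p a) f"
  shows "(\<Prod>a\<in>UNIV. lf p a ^ m a) dvd poly_subst f (tq p)"
  using prime_elem_lf lf_not_dvd lf_power_dvd_subst_tq[OF assms]
  by (intro prod_prime_powers_dvd) auto

lemma lf_power_dvd_prod_lf_iff:
  assumes "\<not> lf p a dvd g"
  shows "lf p a ^ k dvd (\<Prod>b\<in>UNIV. lf p b ^ m b) * g \<longleftrightarrow> k \<le> m a"
proof
  assume k: "lf p a ^ k dvd (\<Prod>b\<in>UNIV. lf p b ^ m b) * g"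
  show "k \<le> m a"
  proof (rule ccontr)
    assume "\<not> k \<le> m a"
    then have "lf p a ^ Suc (m a) dvd lf p a ^ k" by (intro le_imp_power_dvd) simp
    from this k have "lf p a ^ Suc (m a) dvd (\<Prod>b\<in>UNIV. lf p b ^ m b) * g" by (rule dvd_trans)
    then have "lf p a ^ m a * lf p a dvd lf p a ^ m a * (lf p (a + 1) ^ m (a + 1) * lf p (a + 2) ^ m (a + 2) * g)"
      unfolding prod_cyc[of _ a] power_Suc2 by (simp only: mult.assoc)
    then have "lf p a dvd lf p (a + 1) ^ m (a + 1) * lf p (a + 2) ^ m (a + 2) * g"
      by simp
    then have "lf p a dvd lf p (a + 1) \<or> lf p a dvd lf p (a + 2)"
      using assms prime_elem_dvd_multD[OF prime_elem_lf[of a]] prime_elem_dvd_powerD[OF prime_elem_lf[of a]]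
      by meson
    then show False using lf_not_dvd[of a "a + 1"] lf_not_dvd[of a "a + 2"] by simp
  qed
next
  assume "k \<le> m a"
  then have "lf p a ^ k dvd lf p a ^ m a" by (rule le_imp_power_dvd)
  also have "\<dots> dvd (\<Prod>b\<in>UNIV. lf p b ^ m b)" by (simp add: prod_cyc[of _ a] mult.assoc)
  finally show "lf p a ^ k dvd (\<Prod>b\<in>UNIV. lf p b ^ m b) * g" by simp
qed

end

text \<open>\<open>f'\<close> is the transform of \<open>f\<close> under the quadratic map, the lines being removed \<open>m\<close> times.\<close>

definition transform :: "(3 \<Rightarrow> 3 \<Rightarrow> 'k::field) \<Rightarrow> (3 \<Rightarrow> nat) \<Rightarrow> (3, 'k) mpoly \<Rightarrow> (3, 'k) mpoly \<Rightarrow> bool" where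
  "transform p m f f' \<longleftrightarrow> poly_subst f (tq p) = (\<Prod>a\<in>UNIV. lf p a ^ m a) * f'"

lemma transformI:
  assumes "delta p \<noteq> 0" "\<And>a. mult_ge (m a) (p a) f"
  obtains f' where "transform p m f f'"
  using prod_lf_power_dvd[of p m f, OF assms] unfolding transform_def by (auto simp: dvd_def)

context
  fixes p :: "3 \<Rightarrow> 3 \<Rightarrow> 'k::field" and m f f' e
  assumes delta: "delta p \<noteq> 0" and tr: "transform p m f f'" and f: "form e f"
begin

lemma transform_form:
  assumes "f \<noteq> 0"
  shows "(\<Sum>a\<in>UNIV. m a) \<le> 2 * e" "form (2 * e - (\<Sum>a\<in>UNIV. m a)) f'" "f' \<noteq> 0"
proof -
  have nz: "poly_subst f (tq p) \<noteq> 0" using subst_tq_0_iff[OF delta f] assms by simp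
  have "form (e * 2) (poly_subst f (tq p))" by (rule form_subst[OF f form_tq])
  then have *: "form (2 * e) ((\<Prod>a\<in>UNIV. lf p a ^ m a) * f')"
    using tr by (simp add: transform_def mult.commute)
  have nz': "(\<Prod>a\<in>UNIV. lf p a ^ m a) * f' \<noteq> 0" using nz tr by (simp add: transform_def)
  show "(\<Sum>a\<in>UNIV. m a) \<le> 2 * e" "form (2 * e - (\<Sum>a\<in>UNIV. m a)) f'"
    using form_quotient[OF * nz' form_prod_lf] by auto
  show "f' \<noteq> 0" using nz' by auto
qed

lemma transform_form': "form (2 * e - (\<Sum>a\<in>UNIV. m a)) f'"
proof (cases "f = 0")
  case True
  then have "f' = 0" using tr delta by (auto simp: transform_def subst_hom)
  then show ?thesis by simp
qed (rule transform_form)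

lemma transform_back:
  "const (delta p ^ (\<Sum>a\<in>UNIV. m a)) * (\<Prod>a\<in>UNIV. lf p a ^ (m (a + 1) + m (a + 2))) * poly_subst f' (tq p)
    = const (delta p ^ (3 * e)) * (\<Prod>a\<in>UNIV. lf p a ^ e) * f"
proof -
  have "poly_subst (poly_subst f (tq p)) (tq p) =
      poly_subst (\<Prod>a\<in>UNIV. lf p a ^ m a) (tq p) * poly_subst f' (tq p)"
    using tr by (simp add: transform_def subst_hom(4))
  then show ?thesis unfolding subst_tq_tq[OF delta f] subst_prod_lf_tq[OF delta] by simp
qed

text \<open>Bezout's inequality for a side of the triangle.\<close>

lemma transform_line:
  assumes "\<not> lf p a dvd f" shows "m (a + 1) + m (a + 2) \<le> e"
proof -
  \<comment> \<open>Exponents of \<open>lf p a\<close> are compared in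
    \<open>transform_back\<close>; on the right it is exactly \<open>e\<close>, because the side
    does not divide \<open>f\<close>.\<close>
  have "lf p a ^ (m (a + 1) + m (a + 2)) dvd (\<Prod>a\<in>UNIV. lf p a ^ (m (a + 1) + m (a + 2)))"
    by (simp add: prod_cyc[of _ a])
  then have "lf p a ^ (m (a + 1) + m (a + 2)) dvd
      const (delta p ^ (\<Sum>a\<in>UNIV. m a)) * (\<Prod>a\<in>UNIV. lf p a ^ (m (a + 1) + m (a + 2))) * poly_subst f' (tq p)"
    by (intro dvd_mult2 dvd_mult)
  also have "\<dots> = (\<Prod>a\<in>UNIV. lf p a ^ e) * (const (delta p ^ (3 * e)) * f)"
    unfolding transform_back by (simp only: mult_ac)
  finally have d1: "lf p a ^ (m (a + 1) + m (a + 2)) dvd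
      (\<Prod>a\<in>UNIV. lf p a ^ e) * (const (delta p ^ (3 * e)) * f)" .
  have d2: "\<not> lf p a dvd const (delta p ^ (3 * e)) * f"
  proof
    assume "lf p a dvd const (delta p ^ (3 * e)) * f"
    then have "lf p a dvd const (delta p ^ (3 * e))"
      using assms prime_elem_dvd_multD[OF prime_elem_lf[OF delta]] by blast
    then have "lf p a dvd 1" using const_unit[of "delta p ^ (3 * e)"] delta dvd_trans by auto
    then show False using prime_elem_lf[OF delta, of a] by (simp add: prime_elem_def)
  qed
  show ?thesis using d1 unfolding lf_power_dvd_prod_lf_iff[OF delta d2] .
qed

text \<open>Cancellation in \<open>transform_back\<close>. The remaining exponents are the
  multiplicities of the transform at the vertices; the assumption keeps the truncated subtraction
  exact, and the constant collects the powers of \<open>delta p\<close>.\<close>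

lemma transform_inverse:
  assumes "\<And>a. m (a + 1) + m (a + 2) \<le> e"
  shows "transform p (\<lambda>a. e - m (a + 1) - m (a + 2)) f'
    (const (delta p ^ (3 * e) / delta p ^ (\<Sum>a\<in>UNIV. m a)) * f)"
proof -
  define M where "M = (\<Sum>a\<in>UNIV. m a)"
  define c where "c = delta p ^ (3 * e) / delta p ^ M"
  define P where "P = (\<Prod>a\<in>UNIV. lf p a ^ (m (a + 1) + m (a + 2)))"
  define P' where "P' = (\<Prod>a\<in>UNIV. lf p a ^ (e - m (a + 1) - m (a + 2)))"
  define d where "d = (const (delta p ^ M) :: (3, 'k) mpoly)"
  have "lf p a ^ e = lf p a ^ (m (a + 1) + m (a + 2)) * lf p a ^ (e - m (a + 1) - m (a + 2))" for a
    unfolding power_add[symmetric] using assms[of a] by simp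
  then have 1: "(\<Prod>a\<in>UNIV. lf p a ^ e) = P * P'" unfolding P_def P'_def by (simp add: prod.distrib)
  have "delta p ^ (3 * e) = delta p ^ M * c" using delta by (simp add: c_def)
  then have 2: "const (delta p ^ (3 * e)) = d * const c" unfolding d_def by (simp only: const_simps(4))
  have "d * P * poly_subst f' (tq p) = d * const c * (P * P') * f"
    using transform_back unfolding 1 2 P_def[symmetric] M_def[symmetric] d_def[symmetric] .
  then have eq: "d * P * poly_subst f' (tq p) = d * P * (P' * (const c * f))" by (simp only: mult_ac)
  have "d * P \<noteq> 0" using delta by (simp add: d_def P_def)
  with eq have "poly_subst f' (tq p) = P' * (const c * f)" by (metis mult_left_cancel)
  then show ?thesis unfolding transform_def P'_def c_def M_def .
qed

lemma transform_mult_ge: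
  assumes "\<And>a. cof p a q \<noteq> 0" "mult_ge n (quad p q) f" shows "mult_ge n q f'"
proof -
  \<comment> \<open>The map sends \<open>S q + T W\<close> to \<open>S^2 quad p q\<close> plus a
    multiple of \<open>T\<close>, so the multiplicity at \<open>quad p q\<close> is used with
    \<open>S^2\<close> in place of \<open>S\<close>. The removed sides do not vanish at
    \<open>q\<close> and cancel.\<close>
  let ?W = "\<lambda>j. poly_subst (tq p j) (spread q) :: (nat, 'k) mpoly"
  have "\<exists>w. ?W j = const (quad p q j) * var 0 ^ 2 + var 1 * w" for j
  proof -
    have "poly_subst (?W j - const (quad p q j) * var 0 ^ 2) (var(1 := 0)) = 0"
      by (simp add: subst_hom subst_spread_T0[OF form_tq, simplified] mult.commute)
    then have "var 1 dvd ?W j - const (quad p q j) * var 0 ^ 2" unfolding var_dvd_iff .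
    then show ?thesis by (auto simp: dvd_def algebra_simps)
  qed
  then obtain w where w: "\<And>j. ?W j = const (quad p q j) * var 0 ^ 2 + var 1 * w j" by metis
  have "mult_ge n q (poly_subst f (tq p))"
    unfolding mult_ge_def subst_subst w by (rule mult_ge_subst[OF assms(2)])
  then have *: "mult_ge n q ((\<Prod>a\<in>UNIV. lf p a ^ m a) * f')" using tr by (simp add: transform_def)
  have "poly_eval (\<Prod>a\<in>UNIV. lf p a ^ m a) q \<noteq> 0" using assms(1) by (simp add: eval_hom)
  then show ?thesis by (rule mult_ge_cancel[OF form_prod_lf[of m p] _ *])
qed

end

text \<open>\<open>transform_mult_ge\<close> is applied to both transforms, the second time at
  \<open>quad p q\<close>, which is off the triangle as well and is mapped back to a multiple of
  \<open>q\<close>.\<close>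

lemma transform_mult_ge_iff:
  assumes "delta p \<noteq> 0" "transform p m f f'" "form e f" "form e' f'"
    and "transform p m' f' (const c * f)" "c \<noteq> 0" "\<And>a. cof p a q \<noteq> 0"
  shows "mult_ge n (quad p q) f' \<longleftrightarrow> mult_ge n q f"
proof
  assume "mult_ge n (quad p q) f'"
  then have "mult_ge n q (const c * f)"
    using transform_mult_ge[OF assms(1,5,4,7)] by blast
  then show "mult_ge n q f" using assms(6) by (simp add: mult_ge_const_iff)
next
  assume q: "mult_ge n q f"
  have qq: "quad p (quad p q) = (\<lambda>j. (delta p ^ 3 * (\<Prod>a\<in>UNIV. cof p a q)) * q j)"
    by (rule ext) (rule quad_quad)
  have "delta p ^ 3 * (\<Prod>a\<in>UNIV. cof p a q) \<noteq> 0" using assms by simp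
  then have "mult_ge n (quad p (quad p q)) f" using q mult_ge_scale[OF _ qq] by blast
  moreover have "cof p a (quad p q) \<noteq> 0" for a using assms by (simp add: cof_quad)
  ultimately show "mult_ge n (quad p q) f'"
    using transform_mult_ge[OF assms(1-3)] by blast
qed

text \<open>Primality is available for the sides but not for \<open>f\<close>, so the powers are
  extracted from the cofactor of \<open>f\<close>.\<close>

lemma dvd_prod_lf_cancel:
  assumes "delta p \<noteq> 0" "f \<noteq> 0" "\<And>a. \<not> lf p a dvd f"
    and dvd: "f dvd (\<Prod>a\<in>UNIV. lf p a ^ m a) * g"
  shows "f dvd g"
proof -
  let ?P = "\<Prod>a\<in>UNIV. lf p a ^ m a"
  obtain b where b: "?P * g = f * b" using dvd by (auto simp: dvd_def)
  have lb: "lf p a ^ m a dvd b" for a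
  proof (rule prime_elem_power_dvd_mult[OF prime_elem_lf[OF assms(1)] assms(3)])
    have "lf p a ^ m a dvd ?P" by (simp add: prod_cyc[of _ a] mult.assoc)
    then have "lf p a ^ m a dvd ?P * g" by (rule dvd_mult2)
    then show "lf p a ^ m a dvd f * b" unfolding b .
  qed
  have "?P dvd b"
    by (rule prod_prime_powers_dvd[OF finite prime_elem_lf[OF assms(1)] lf_not_dvd[OF assms(1)] lb])
  then obtain b' where "b = ?P * b'" by (auto simp: dvd_def)
  with b have eq: "?P * g = ?P * (f * b')" by (simp only: mult_ac)
  have nz: "?P \<noteq> 0" using assms(1) by simp
  have "g = f * b'" by (rule iffD1[OF mult_left_cancel[OF nz] eq])
  then show ?thesis by simp
qed

text \<open>Compare orders of vanishing at \<open>0\<close> in \<open>homog f\<close>.\<close>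

lemma mult_ge_le_degree:
  assumes "mult_ge m p f" "form e f" "f \<noteq> 0" shows "m \<le> e"
proof -
  have "monom 1 1 ^ m dvd homog f"
    using mult_ge_ev[OF assms(1) is_hom_pconst, of "monom 1 1" 0 "\<lambda>j. [:var j:]"]
    by (simp add: homog_def mult_monom monom_0[symmetric])
  then have "monom 1 m dvd monom f e" using assms(2) by (simp add: monom_power form_iff_homog)
  then show ?thesis using assms(3) by (auto simp: monom_1_dvd_iff' not_le[symmetric])
qed

lemma mult_ge_lf_iff:
  assumes "delta p \<noteq> 0"
  shows "mult_ge n q (lf p a) \<longleftrightarrow> n \<le> (if cof p a q = 0 then 1 else 0)"
proof -
  have "n \<le> 1" if "mult_ge n q (lf p a)"
    using mult_ge_le_degree[OF that form_lf(1) lf_neq_0[OF assms]] .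
  moreover have "mult_ge 1 q (lf p a) \<longleftrightarrow> cof p a q = 0"
    using mult_ge_1_iff[OF form_lf(1), of q p a] by simp
  ultimately show ?thesis
    by (cases n) (auto simp: le_Suc_eq dest: mult_ge_mono[where n = "Suc 0"])
qed

section \<open>The numerical reflection\<close>

text \<open>Intersection numbers of classes \<open>(e; m)\<close> on the blow-up of \<open>r\<close> points.\<close>

definition bil :: "nat \<Rightarrow> int \<Rightarrow> (nat \<Rightarrow> int) \<Rightarrow> int \<Rightarrow> (nat \<Rightarrow> int) \<Rightarrow> int" where
  "bil r e m g n = e * g - (\<Sum>l<r. m l * n l)"

text \<open>The intersection number with the class of degree 1 and multiplicity 1 at the three
  points of \<tau>, whose self-intersection is -2. Adding this multiple of that class is the
  reflection in it, an isometry, and describes the quadratic map on classes.\<close>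

definition reflect_defect :: "(3 \<Rightarrow> nat) \<Rightarrow> int \<Rightarrow> (nat \<Rightarrow> int) \<Rightarrow> int" where
  "reflect_defect \<tau> e m = e - (\<Sum>a\<in>UNIV. m (\<tau> a))"

definition reflect_mult :: "(3 \<Rightarrow> nat) \<Rightarrow> int \<Rightarrow> (nat \<Rightarrow> int) \<Rightarrow> nat \<Rightarrow> int" where
  "reflect_mult \<tau> e m l = m l + (if l \<in> range \<tau> then reflect_defect \<tau> e m else 0)"

definition reflect_deg :: "(3 \<Rightarrow> nat) \<Rightarrow> int \<Rightarrow> (nat \<Rightarrow> int) \<Rightarrow> int" where
  "reflect_deg \<tau> e m = e + reflect_defect \<tau> e m"

context
  fixes \<tau> :: "3 \<Rightarrow> nat" and r :: nat
  assumes inj: "inj \<tau>" and ran: "range \<tau> \<subseteq> {..<r}"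
begin

lemma sum_range_tau:
  fixes x :: "nat \<Rightarrow> int"
  shows "(\<Sum>l<r. if l \<in> range \<tau> then x l else 0) = (\<Sum>a\<in>UNIV. x (\<tau> a))"
proof -
  have "(\<Sum>l<r. if l \<in> range \<tau> then x l else 0) = sum x (range \<tau>)"
    using ran by (simp add: sum.If_cases Int_absorb1 Collect_mem_eq)
  then show ?thesis using inj by (simp add: sum.reindex)
qed

lemma bil_reflect: "bil r (reflect_deg \<tau> e m) (reflect_mult \<tau> e m) (reflect_deg \<tau> g n) (reflect_mult \<tau> g n) = bil r e m g n"
proof -
  let ?k = "reflect_defect \<tau> e m" and ?h = "reflect_defect \<tau> g n"
  have "(\<Sum>l<r. reflect_mult \<tau> e m l * reflect_mult \<tau> g n l) =
      (\<Sum>l<r. m l * n l + (if l \<in> range \<tau> then m l * ?h + ?k * n l + ?k * ?h else 0))"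
    by (intro sum.cong) (auto simp: reflect_mult_def algebra_simps)
  also have "\<dots> = (\<Sum>l<r. m l * n l) + (\<Sum>a\<in>UNIV. m (\<tau> a) * ?h + ?k * n (\<tau> a) + ?k * ?h)"
    by (simp only: sum.distrib[of _ _ "{..<r}"] sum_range_tau)
  also have "(\<Sum>a\<in>UNIV. m (\<tau> a) * ?h + ?k * n (\<tau> a) + ?k * ?h) =
      (e - ?k) * ?h + ?k * (g - ?h) + 3 * (?k * ?h)"
    by (simp add: sum.distrib sum_distrib_left[symmetric] sum_distrib_right[symmetric] reflect_defect_def)
  finally show ?thesis by (simp add: bil_def reflect_deg_def algebra_simps)
qed

lemma reflect_defect_reflect: "reflect_defect \<tau> (reflect_deg \<tau> e m) (reflect_mult \<tau> e m) = - reflect_defect \<tau> e m"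
  unfolding reflect_defect_def[of _ "reflect_deg \<tau> e m"] reflect_deg_def reflect_mult_def
  by (simp add: sum.distrib reflect_defect_def)

lemma reflect_reflect: "reflect_deg \<tau> (reflect_deg \<tau> e m) (reflect_mult \<tau> e m) = e" "reflect_mult \<tau> (reflect_deg \<tau> e m) (reflect_mult \<tau> e m) l = m l"
proof -
  show "reflect_deg \<tau> (reflect_deg \<tau> e m) (reflect_mult \<tau> e m) = e" unfolding reflect_deg_def[of _ "reflect_deg \<tau> e m"] reflect_defect_reflect by (simp add: reflect_deg_def)
  show "reflect_mult \<tau> (reflect_deg \<tau> e m) (reflect_mult \<tau> e m) l = m l" unfolding reflect_mult_def[of _ "reflect_deg \<tau> e m"] reflect_defect_reflect by (simp add: reflect_mult_def)
qed

lemma reflect_canonical: "reflect_deg \<tau> 3 (\<lambda>_. 1) = 3" "reflect_mult \<tau> 3 (\<lambda>_. 1) = (\<lambda>_. 1)"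
  by (auto simp: reflect_deg_def reflect_mult_def reflect_defect_def)

lemma reflect_mult_tau: "reflect_mult \<tau> e m (\<tau> a) = e - m (\<tau> (a + 1)) - m (\<tau> (a + 2))"
  by (simp add: reflect_mult_def reflect_defect_def sum_cyc[of _ a])

end

text \<open>The homaloidal equations as intersection numbers with the class itself and with the
  anticanonical class \<open>(3; 1, ..., 1)\<close>, which makes their invariance under the
  reflection evident.\<close>

definition htype :: "nat \<Rightarrow> nat \<Rightarrow> (nat \<Rightarrow> nat) \<Rightarrow> bool" where
  "htype r d \<nu> \<longleftrightarrow> bil r (int d) (\<lambda>l. int (\<nu> l)) (int d) (\<lambda>l. int (\<nu> l)) = 1 \<and>
     bil r (int d) (\<lambda>l. int (\<nu> l)) 3 (\<lambda>_. 1) = 3"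

text \<open>Numerical \<open>(-1)\<close>-classes that are orthogonal to the class \<open>(d; \<nu>)\<close>.\<close>

definition exc_class :: "nat \<Rightarrow> nat \<Rightarrow> (nat \<Rightarrow> nat) \<Rightarrow> int \<Rightarrow> (nat \<Rightarrow> int) \<Rightarrow> bool" where
  "exc_class r d \<nu> e m \<longleftrightarrow> bil r e m e m = -1 \<and> bil r e m 3 (\<lambda>_. 1) = 1 \<and>
     bil r e m (int d) (\<lambda>l. int (\<nu> l)) = 0"

lemma exc_class_degree_0:
  assumes "exc_class r d \<nu> 0 m"
  obtains k where "k < r" "m k = -1" "\<And>l. l < r \<Longrightarrow> l \<noteq> k \<Longrightarrow> m l = 0"
proof -
  have sq: "(\<Sum>l<r. m l * m l) = 1" and s: "(\<Sum>l<r. m l) = -1"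
    using assms by (auto simp: exc_class_def bil_def)
  obtain k where k: "k < r" "m k < 0"
  proof (rule ccontr)
    assume "\<not> thesis"
    then have "(\<Sum>l<r. m l) \<ge> 0" using that by (intro sum_nonneg) force
    with s show False by simp
  qed
  have split: "(\<Sum>l<r. m l * m l) = m k * m k + (\<Sum>l\<in>{..<r} - {k}. m l * m l)"
    using k by (simp add: sum.remove)
  have rest: "(\<Sum>l\<in>{..<r} - {k}. m l * m l) \<ge> 0" by (intro sum_nonneg) simp
  have "m k * m k \<ge> 1" using k by (simp add: mult_neg_neg int_one_le_iff_zero_less)
  then have "m k * m k = 1" and 0: "(\<Sum>l\<in>{..<r} - {k}. m l * m l) = 0"
    using sq split rest by linarith+
  then have "m k = -1" using k by (auto simp: zmult_eq_1_iff)
  moreover have "m l = 0" if "l < r" "l \<noteq> k" for l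
    using 0 that by (subst (asm) sum_nonneg_eq_0_iff) auto
  ultimately show ?thesis using that k by blast
qed

text \<open>With \<open>a >= b >= c\<close> the three largest multiplicities, the equations are
  combined into the sum of \<open>n l * (n l - c)\<close>, to which only the first two points
  contribute positively. If \<open>a + b + c <= D\<close>, this gives
  \<open>c * (D - 3 * c) + 3 * c <= 1\<close>, impossible for \<open>c >= 1\<close>; for
  \<open>c = 0\<close> the linear equation alone fails.\<close>

lemma noether_inequality:
  assumes h: "htype r d \<nu>" and d: "2 \<le> d" and r: "3 \<le> r"
  shows "\<exists>\<tau> :: 3 \<Rightarrow> nat. inj \<tau> \<and> range \<tau> \<subseteq> {..<r} \<and> d < (\<Sum>a\<in>UNIV. \<nu> (\<tau> a))"
proof -
  have ex: "\<exists>k\<in>A. \<forall>l\<in>A. \<nu> l \<le> \<nu> k" if "finite A" "A \<noteq> {}" for A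
  proof -
    have "Max (\<nu> ` A) \<in> \<nu> ` A" using that by simp
    then obtain k where "k \<in> A" "Max (\<nu> ` A) = \<nu> k" by auto
    then show ?thesis using that(1) by (intro bexI[of _ k]) (auto simp flip: \<open>Max (\<nu> ` A) = \<nu> k\<close>)
  qed
  obtain i where i: "i < r" "\<And>l. l < r \<Longrightarrow> \<nu> l \<le> \<nu> i"
    using ex[of "{..<r}"] r by (auto simp: lessThan_empty_iff)
  have "card ({..<r} - {i}) > 0" using r i by simp
  then have "{..<r} - {i} \<noteq> {}" by (metis card.empty less_irrefl)
  then obtain j where j: "j < r" "j \<noteq> i" "\<And>l. l < r \<Longrightarrow> l \<noteq> i \<Longrightarrow> \<nu> l \<le> \<nu> j"
    using ex[of "{..<r} - {i}"] by auto
  have "card ({..<r} - {i, j}) > 0" using r i j by (simp add: card_Diff_subset)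
  then have "{..<r} - {i, j} \<noteq> {}" by (metis card.empty less_irrefl)
  then obtain k where k: "k < r" "k \<noteq> i" "k \<noteq> j" "\<And>l. l < r \<Longrightarrow> l \<noteq> i \<Longrightarrow> l \<noteq> j \<Longrightarrow> \<nu> l \<le> \<nu> k"
    using ex[of "{..<r} - {i, j}"] by auto
  define D where "D = int d"
  define n where "n l = int (\<nu> l)" for l
  define a b c where "a = n i" and "b = n j" and "c = n k"
  have sq: "(\<Sum>l<r. n l * n l) = D * D - 1" and s: "(\<Sum>l<r. n l) = 3 * D - 3"
    using h by (auto simp: htype_def bil_def D_def n_def)
  have split: "(\<Sum>l<r. x l) = x i + x j + x k + (\<Sum>l\<in>{..<r} - {i, j, k}. x l)" for x :: "nat \<Rightarrow> int"
  proof -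
    have "{..<r} = {i, j, k} \<union> ({..<r} - {i, j, k})" using i j k by auto
    then have "(\<Sum>l<r. x l) = sum x {i, j, k} + sum x ({..<r} - {i, j, k})"
      by (metis finite_lessThan sum.subset_diff Un_upper1 add.commute)
    then show ?thesis using j k by simp
  qed
  have ord: "c \<le> b" "b \<le> a" "0 \<le> c"
    using i(2)[of j] j(3)[of k] j k by (auto simp: a_def b_def c_def n_def)
  have le: "n l \<le> c \<and> 0 \<le> n l" if "l \<in> {..<r} - {i, j, k}" for l
    using k(4)[of l] that by (auto simp: c_def n_def)
  have "(\<Sum>l<r. n l * (n l - c)) \<le> a * (a - c) + b * (b - c)"
  proof -
    have "(\<Sum>l\<in>{..<r} - {i, j, k}. n l * (n l - c)) \<le> 0"
      using le by (intro sum_nonpos) (auto simp: mult_nonneg_nonpos)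
    then show ?thesis by (subst split) (simp add: a_def b_def c_def)
  qed
  moreover have "(\<Sum>l<r. n l * (n l - c)) = D * D - 1 - c * (3 * D - 3)"
    unfolding sq[symmetric] s[symmetric] by (simp add: sum_subtractf sum_distrib_left algebra_simps)
  ultimately have main: "D * D - 1 - c * (3 * D - 3) \<le> a * (a - c) + b * (b - c)" by simp
  have D: "D \<ge> 2" using d by (simp add: D_def)
  have "D < a + b + c"
  proof (rule ccontr)
    assume "\<not> D < a + b + c"
    then have abc: "a + b + c \<le> D" by simp
    show False
    proof (cases "c = 0")
      case True
      have "n l = 0" if "l \<in> {..<r} - {i, j, k}" for l using le[OF that] True by simp
      then have "(\<Sum>l<r. n l) = a + b" using True by (subst split) (simp add: a_def b_def c_def)
      then show False using s abc D True by simp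
    next
      case False
      then have c: "c \<ge> 1" using ord by simp
      have "a * (a - c) + b * (b - c) \<le> (a + b) * (a - c)"
        using ord mult_left_mono[of "b - c" "a - c" b] by (simp add: algebra_simps)
      also have "\<dots> \<le> (D - c) * (a - c)" using ord abc by (intro mult_right_mono) auto
      also have "\<dots> \<le> (D - c) * (D - 3 * c)" using ord abc by (intro mult_left_mono) auto
      finally have "D * D - 1 - c * (3 * D - 3) \<le> (D - c) * (D - 3 * c)" using main by simp
      then have "c * (D - 3 * c) + 3 * c \<le> 1" by (simp add: algebra_simps)
      moreover have "c * (D - 3 * c) \<ge> 0" using ord abc c by (intro mult_nonneg_nonneg) auto
      ultimately show False using c by linarith
    qed
  qed
  then have "d < \<nu> i + \<nu> j + \<nu> k" by (simp add: D_def a_def b_def c_def n_def)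
  then show ?thesis
    using i j k
    by (intro exI[of _ "\<lambda>x. if x = 0 then i else if x = 1 then j else k"])
       (auto simp: inj_def forall_3 sum_3)
qed

section \<open>Nets with assigned multiplicities\<close>

text \<open>The data that a quadratic map transports. Multiplicities are exact because a higher
  multiplicity of all members at a vertex would turn the opposite side into a common factor of the
  transformed net.\<close>

definition net :: "nat \<Rightarrow> nat \<Rightarrow> (nat \<Rightarrow> nat) \<Rightarrow> (nat \<Rightarrow> 3 \<Rightarrow> 'k::field) \<Rightarrow> (3 \<Rightarrow> (3, 'k) mpoly) \<Rightarrow> bool" where
  "net r d \<nu> P F \<longleftrightarrow> (\<forall>i. form d (F i)) \<and> lin_indep F \<and> no_common_factor F \<and>
     (\<forall>l<r. (\<forall>i. mult_ge (\<nu> l) (P l) (F i)) \<and> (\<exists>i. \<not> mult_ge (Suc (\<nu> l)) (P l) (F i)))"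

definition complete_net :: "nat \<Rightarrow> nat \<Rightarrow> (nat \<Rightarrow> nat) \<Rightarrow> (nat \<Rightarrow> 3 \<Rightarrow> 'k::field) \<Rightarrow> (3 \<Rightarrow> (3, 'k) mpoly) \<Rightarrow> bool" where
  "complete_net r d \<nu> P F \<longleftrightarrow>
     (\<forall>g. form d g \<and> (\<forall>l<r. mult_ge (\<nu> l) (P l) g) \<longrightarrow> g \<in> linear_system F)"

text \<open>Primality is tested on forms only: to return from a pull-back,
  \<open>subst_tq_tq\<close> needs a degree.\<close>

definition prime_form :: "nat \<Rightarrow> (3, 'k::field) mpoly \<Rightarrow> bool" where
  "prime_form e f \<longleftrightarrow> form e f \<and> f \<noteq> 0 \<and> e \<noteq> 0 \<and>
     (\<forall>m n a b. form m a \<longrightarrow> form n b \<longrightarrow> f dvd a * b \<longrightarrow> f dvd a \<or> f dvd b)"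

text \<open>The curve \<open>f = 0\<close> has class \<open>(e; m)\<close>, and \<open>F\<close> maps it to the point \<open>Q\<close>.\<close>

definition contracted :: "nat \<Rightarrow> (nat \<Rightarrow> 3 \<Rightarrow> 'k::field) \<Rightarrow> (3 \<Rightarrow> (3, 'k) mpoly) \<Rightarrow> int \<Rightarrow> (nat \<Rightarrow> int) \<Rightarrow> bool" where
  "contracted r P F e m \<longleftrightarrow> e \<ge> 0 \<and> (\<exists>f Q. prime_form (nat e) f \<and>
     (\<forall>l<r. \<forall>n. mult_ge n (P l) f \<longleftrightarrow> int n \<le> m l) \<and> (\<exists>i. Q i \<noteq> 0) \<and>
     (\<forall>i j. f dvd const (Q j) * F i - const (Q i) * F j))"

text \<open>The exceptional curve over the point \<open>k\<close>; the sign comes from writing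
  classes as a multiple of the line minus multiples of exceptional curves.\<close>

definition point_class :: "nat \<Rightarrow> int \<Rightarrow> (nat \<Rightarrow> int) \<Rightarrow> bool" where
  "point_class r e m \<longleftrightarrow> e = 0 \<and> (\<exists>k<r. m k = -1 \<and> (\<forall>l<r. l \<noteq> k \<longrightarrow> m l = 0))"

definition good_net :: "nat \<Rightarrow> nat \<Rightarrow> (nat \<Rightarrow> nat) \<Rightarrow> (nat \<Rightarrow> 3 \<Rightarrow> 'k::field) \<Rightarrow> (3 \<Rightarrow> (3, 'k) mpoly) \<Rightarrow> bool" where
  "good_net r d \<nu> P F \<longleftrightarrow> complete_net r d \<nu> P F \<and>
     (\<forall>e m. exc_class r d \<nu> e m \<longrightarrow> point_class r e m \<or> contracted r P F e m)"

lemma exc_class_0_point: "exc_class r d \<nu> 0 m \<Longrightarrow> point_class r 0 m"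
  by (erule exc_class_degree_0) (auto simp: point_class_def)

subsection \<open>Linear systems\<close>

interpretation mpoly_vs: vector_space "\<lambda>(c::'k::field) (f::('v, 'k) mpoly). const c * f"
  by standard (simp_all add: const_simps algebra_simps)

lemma linear_system_subspace: "mpoly_vs.subspace (linear_system F)"
proof (rule mpoly_vs.subspaceI)
  show "0 \<in> linear_system F"
    unfolding linear_system_def by (auto intro!: exI[of _ "\<lambda>_. 0"] simp: const_simps)
next
  fix f g assume "f \<in> linear_system F" "g \<in> linear_system F"
  then obtain c d where "f = (\<Sum>i\<in>UNIV. const (c i) * F i)" "g = (\<Sum>i\<in>UNIV. const (d i) * F i)"
    by (auto simp: linear_system_def)
  then have "f + g = (\<Sum>i\<in>UNIV. const (c i + d i) * F i)"
    by (simp only: const_simps(3) sum.distrib ring_distribs)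
  then show "f + g \<in> linear_system F" by (auto simp: linear_system_def)
next
  fix a f assume "f \<in> linear_system F"
  then obtain c where "f = (\<Sum>i\<in>UNIV. const (c i) * F i)" by (auto simp: linear_system_def)
  then have "const a * f = (\<Sum>i\<in>UNIV. const (a * c i) * F i)"
    by (simp only: const_simps(4) sum_distrib_left mult.assoc)
  then show "const a * f \<in> linear_system F" by (auto simp: linear_system_def)
qed

lemma linear_system_memI: "F i \<in> linear_system F"
proof -
  have "(\<Sum>j\<in>UNIV. const (if j = i then 1 else 0) * F j) = (\<Sum>j\<in>UNIV. if j = i then F j else 0)"
    by (rule sum.cong) (auto simp: const_simps)
  then have "F i = (\<Sum>j\<in>UNIV. const (if j = i then 1 else 0) * F j)" by simp
  then show ?thesis unfolding linear_system_def by (intro CollectI exI[of _ "\<lambda>j. if j = i then 1 else 0"]) simp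
qed

lemma span_range: "mpoly_vs.span (range F) = linear_system F"
proof (rule mpoly_vs.span_unique)
  show "range F \<subseteq> linear_system F" using linear_system_memI by auto
  show "mpoly_vs.subspace (linear_system F)" by (rule linear_system_subspace)
  fix S assume S: "range F \<subseteq> S" "mpoly_vs.subspace S"
  show "linear_system F \<subseteq> S"
    unfolding linear_system_def using S by (auto intro!: mpoly_vs.subspace_sum mpoly_vs.subspace_scale)
qed

lemma lin_indep_inj:
  assumes F: "lin_indep F" shows "inj F"
proof (rule injI, rule ccontr)
  fix i j assume e: "F i = F j" and ij: "i \<noteq> j"
  define c where "c k = (if k = i then 1 else if k = j then - 1 else (0::'a))" for k
  have "(\<Sum>k\<in>UNIV. const (c k) * F k) = (\<Sum>k\<in>UNIV. (if k = i then F k else 0) - (if k = j then F k else 0))"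
    using ij by (intro sum.cong) (auto simp: c_def const_simps)
  then have "(\<Sum>k\<in>UNIV. const (c k) * F k) = 0" using e by (simp add: sum_subtractf)
  then have "c i = 0" using F unfolding lin_indep_def by blast
  then show False by (simp add: c_def)
qed

lemma lin_indep_nonzero:
  assumes F: "lin_indep F" shows "F i \<noteq> 0"
proof
  assume "F i = 0"
  define c where "c k = (if k = i then 1 else (0::'a))" for k
  have "(\<Sum>k\<in>UNIV. const (c k) * F k) = 0"
    using \<open>F i = 0\<close> by (intro sum.neutral) (auto simp: c_def const_simps)
  then have "c i = 0" using F unfolding lin_indep_def by blast
  then show False by (simp add: c_def)
qed

lemma lin_indep_independent:
  assumes F: "lin_indep F" shows "mpoly_vs.independent (range F)"
proof
  assume "mpoly_vs.dependent (range F)"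
  then obtain u v where uv: "v \<in> range F" "u v \<noteq> 0" "(\<Sum>f\<in>range F. const (u f) * f) = 0"
    by (subst (asm) mpoly_vs.dependent_finite) auto
  have "(\<Sum>i\<in>UNIV. const (u (F i)) * F i) = 0"
    using uv(3) lin_indep_inj[OF F] by (simp add: sum.reindex)
  then have "\<forall>i. u (F i) = 0" using F unfolding lin_indep_def by (elim allE[of _ "\<lambda>i. u (F i)"]) simp
  then show False using uv(1,2) by auto
qed

text \<open>A dimension count: three independent elements of a space spanned by three elements span
  it.\<close>

lemma linear_system_exchange:
  assumes G: "lin_indep G" and sub: "\<And>i. G i \<in> linear_system F"
  shows "linear_system F \<subseteq> linear_system G"
proof -
  have sub': "range G \<subseteq> mpoly_vs.span (range F)" using sub unfolding span_range by auto
  have "range F \<subseteq> mpoly_vs.span (range G)"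
  proof
    fix x assume x: "x \<in> range F"
    show "x \<in> mpoly_vs.span (range G)"
    proof (rule ccontr)
      assume nx: "x \<notin> mpoly_vs.span (range G)"
      have 1: "mpoly_vs.independent (insert x (range G))"
        using nx lin_indep_independent[OF G] by (rule mpoly_vs.independent_insertI)
      have 2: "insert x (range G) \<subseteq> mpoly_vs.span (range F)"
        using sub' mpoly_vs.span_base[OF x] by simp
      have "card (insert x (range G)) \<le> card (range F)"
        using mpoly_vs.independent_span_bound[OF finite_imageI[OF finite] 1 2] by simp
      moreover have "x \<notin> range G" using nx mpoly_vs.span_base by blast
      moreover have "card (range G) = CARD(3)" using lin_indep_inj[OF G] by (simp add: card_image)
      moreover have "card (range F) \<le> CARD(3)" by (rule card_image_le) simp
      ultimately show False by simp
    qed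
  qed
  then have "mpoly_vs.span (range F) \<subseteq> mpoly_vs.span (range G)"
    by (rule mpoly_vs.span_minimal) (rule mpoly_vs.subspace_span)
  then show ?thesis unfolding span_range .
qed

subsection \<open>Nets of lines\<close>

lemma form_1_linear:
  fixes g :: "(3, 'k::field) mpoly"
  assumes "form 1 g" shows "g \<in> linear_system var"
proof -
  have "const (Poly_Mapping.lookup g m) * mon var m \<in> linear_system var" if "m \<in> Poly_Mapping.keys g" for m
  proof -
    have "mon_degree m = 1" using assms that by (simp add: form_def)
    then obtain x where x: "x \<in> Poly_Mapping.keys m" "Poly_Mapping.lookup m x = 1"
      "\<And>y. y \<in> Poly_Mapping.keys m \<Longrightarrow> x \<noteq> y \<Longrightarrow> Poly_Mapping.lookup m y = 0"
      unfolding mon_degree_def using sum_eq_1_iff[OF finite_keys] by (metis (no_types, lifting))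
    have "m = Poly_Mapping.single x 1"
    proof (rule poly_mapping_eqI)
      fix y show "Poly_Mapping.lookup m y = Poly_Mapping.lookup (Poly_Mapping.single x 1) y"
        using x by (cases "y = x"; cases "y \<in> Poly_Mapping.keys m") (auto simp: lookup_single when_def in_keys_iff)
    qed
    then have "mon var m = (var x :: (3, 'k) mpoly)" by (simp add: mon_single)
    then show ?thesis
      using mpoly_vs.subspace_scale[OF linear_system_subspace linear_system_memI[of var x]] by simp
  qed
  then have "(\<Sum>m\<in>Poly_Mapping.keys g. const (Poly_Mapping.lookup g m) * mon var m) \<in> linear_system var"
    by (rule mpoly_vs.subspace_sum[OF linear_system_subspace])
  moreover have "(\<Sum>m\<in>Poly_Mapping.keys g. const (Poly_Mapping.lookup g m) * mon var m) = g"
    using subst_id[of g] by (simp add: poly_subst_ev ev_def)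
  ultimately show ?thesis by simp
qed

text \<open>Self-intersection 1 forces all multiplicities to vanish, so the net consists of all
  lines; a class orthogonal to a line has degree 0.\<close>

lemma good_net_1:
  assumes h: "htype r 1 \<nu>" and F: "net r 1 \<nu> P F"
  shows "good_net r 1 \<nu> P F"
  unfolding good_net_def
proof (intro conjI allI impI disjI1)
  have "linear_system var \<subseteq> linear_system F"
    using F by (intro linear_system_exchange form_1_linear) (auto simp: net_def)
  then show "complete_net r 1 \<nu> P F"
    using form_1_linear by (auto simp: complete_net_def)
next
  fix e m assume c: "exc_class r 1 \<nu> e m"
  have "(\<Sum>l<r. int (\<nu> l) * int (\<nu> l)) = 0" using h by (simp add: htype_def bil_def)
  then have "\<nu> l = 0" if "l < r" for l
    using that by (subst (asm) sum_nonneg_eq_0_iff) auto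
  then have "e = 0" using c by (simp add: exc_class_def bil_def)
  then show "point_class r e m" using c exc_class_0_point by simp
qed

lemma dvd_form: "h dvd f \<Longrightarrow> form n f \<Longrightarrow> f \<noteq> 0 \<Longrightarrow> \<exists>k. form k (h :: (3, 'k::field) mpoly)"
  by (metis dvd_def form_factor)

lemma dvd_const_mult_iff:
  fixes g :: "('v, 'k::field) mpoly"
  assumes "c \<noteq> 0" shows "f dvd const c * g \<longleftrightarrow> f dvd g"
proof
  have "const (inverse c) * const c = (1 :: ('v, 'k) mpoly)"
    unfolding const_simps(4)[symmetric] using assms by (simp add: const_simps(2))
  then have g: "const (inverse c) * (const c * g) = g" by (simp add: mult.assoc[symmetric])
  assume "f dvd const c * g"
  then have "f dvd const (inverse c) * (const c * g)" by (rule dvd_mult)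
  then show "f dvd g" unfolding g .
qed simp

lemma prime_formD:
  "prime_form e f \<Longrightarrow> form m a \<Longrightarrow> form n b \<Longrightarrow> f dvd a * b \<Longrightarrow> f dvd a \<or> f dvd b"
  unfolding prime_form_def by blast

subsection \<open>Transforming a net by a quadratic map\<close>

text \<open>The truncation by \<open>nat\<close> is harmless once a net over a general triangle
  exists, see \<open>int_refl_d\<close> and \<open>int_refl_nu\<close>.\<close>

definition refl_d :: "(3 \<Rightarrow> nat) \<Rightarrow> nat \<Rightarrow> (nat \<Rightarrow> nat) \<Rightarrow> nat" where
  "refl_d \<tau> d \<nu> = nat (reflect_deg \<tau> (int d) (\<lambda>l. int (\<nu> l)))"

definition refl_nu :: "(3 \<Rightarrow> nat) \<Rightarrow> nat \<Rightarrow> (nat \<Rightarrow> nat) \<Rightarrow> nat \<Rightarrow> nat" where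
  "refl_nu \<tau> d \<nu> l = nat (reflect_mult \<tau> (int d) (\<lambda>l. int (\<nu> l)) l)"

text \<open>The involution has the same three points as base points, and \<open>p a\<close> is also
  the point to which the opposite side is contracted; so the vertices stay and the other points
  move.\<close>

definition refl_pt :: "(3 \<Rightarrow> nat) \<Rightarrow> (nat \<Rightarrow> 3 \<Rightarrow> 'k::field) \<Rightarrow> nat \<Rightarrow> 3 \<Rightarrow> 'k" where
  "refl_pt \<tau> P l = (if l \<in> range \<tau> then P l else quad (\<lambda>a. P (\<tau> a)) (P l))"

text \<open>The triangle with vertices \<open>P (\<tau> a)\<close> is non-degenerate and contains no other point \<open>P l\<close>.\<close>

definition general_triangle :: "nat \<Rightarrow> (3 \<Rightarrow> nat) \<Rightarrow> (nat \<Rightarrow> 3 \<Rightarrow> 'k::field) \<Rightarrow> bool" where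
  "general_triangle r \<tau> P \<longleftrightarrow> delta (\<lambda>a. P (\<tau> a)) \<noteq> 0 \<and>
     (\<forall>l<r. l \<notin> range \<tau> \<longrightarrow> (\<forall>a. cof (\<lambda>a. P (\<tau> a)) a (P l) \<noteq> 0))"

text \<open>A side is no common factor, so some member of the net does not contain it, and Bezout
  applies to that member.\<close>

lemma net_pairs:
  assumes "net r d \<nu> P F" "range \<tau> \<subseteq> {..<r}" "general_triangle r \<tau> P"
  shows "\<nu> (\<tau> (a + 1)) + \<nu> (\<tau> (a + 2)) \<le> d"
proof -
  let ?p = "\<lambda>a. P (\<tau> a)"
  have delta: "delta ?p \<noteq> 0" using assms by (simp add: general_triangle_def)
  have "\<not> lf ?p a dvd 1" using prime_elem_lf[OF delta] by (simp add: prime_elem_def)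
  then obtain i where i: "\<not> lf ?p a dvd F i" using assms unfolding net_def no_common_factor_def by blast
  have "mult_ge (\<nu> (\<tau> b)) (?p b) (F i)" for b using assms by (auto simp: net_def)
  then obtain g where "transform ?p (\<lambda>b. \<nu> (\<tau> b)) (F i) g" using transformI[OF delta, of "\<lambda>b. \<nu> (\<tau> b)"] by blast
  then show ?thesis using transform_line[OF delta _ _ i] assms(1) by (auto simp: net_def)
qed

context
  fixes r d \<nu> and P :: "nat \<Rightarrow> 3 \<Rightarrow> 'k::field" and \<tau> F p
  assumes p: "p = (\<lambda>a. P (\<tau> a))" and inj: "inj \<tau>" and ran: "range \<tau> \<subseteq> {..<r}"
    and tri: "general_triangle r \<tau> P" and F: "net r d \<nu> P F"
begin

lemma tri_delta: "delta p \<noteq> 0" and tri_cof: "l < r \<Longrightarrow> l \<notin> range \<tau> \<Longrightarrow> cof p a (P l) \<noteq> 0"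
  using tri by (auto simp: general_triangle_def p)

lemma tau_less: "\<tau> a < r"
  using ran by auto

lemma refl_pt_tau: "refl_pt \<tau> P (\<tau> a) = p a"
  by (simp add: refl_pt_def p)

lemma refl_pt_other: "l \<notin> range \<tau> \<Longrightarrow> refl_pt \<tau> P l = quad p (P l)"
  by (simp add: refl_pt_def p)

lemma step_pairs: "\<nu> (\<tau> (a + 1)) + \<nu> (\<tau> (a + 2)) \<le> d"
  by (rule net_pairs[OF F ran tri])

lemma refl_nu_tau: "refl_nu \<tau> d \<nu> (\<tau> a) = d - \<nu> (\<tau> (a + 1)) - \<nu> (\<tau> (a + 2))"
  using step_pairs[of a] by (simp add: refl_nu_def reflect_mult_tau[OF inj ran])

lemma refl_nu_other: "l \<notin> range \<tau> \<Longrightarrow> refl_nu \<tau> d \<nu> l = \<nu> l"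
  by (simp add: refl_nu_def reflect_mult_def)

lemma int_refl_nu: "int (refl_nu \<tau> d \<nu> l) = reflect_mult \<tau> (int d) (\<lambda>l. int (\<nu> l)) l"
proof (cases "l \<in> range \<tau>")
  case True
  then obtain a where "l = \<tau> a" by auto
  then show ?thesis using step_pairs[of a] by (simp add: refl_nu_tau reflect_mult_tau[OF inj ran] of_nat_diff)
qed (simp add: refl_nu_other reflect_mult_def)

lemma int_refl_d: "int (refl_d \<tau> d \<nu>) = reflect_deg \<tau> (int d) (\<lambda>l. int (\<nu> l))"
  using step_pairs[of 0] step_pairs[of 1] step_pairs[of 2]
  by (simp add: refl_d_def reflect_deg_def reflect_defect_def sum_3)

lemma refl_d_eq: "refl_d \<tau> d \<nu> = 2 * d - (\<Sum>a\<in>UNIV. \<nu> (\<tau> a))"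
  using int_refl_d step_pairs[of 0] step_pairs[of 1] step_pairs[of 2] by (simp add: reflect_deg_def reflect_defect_def sum_3)

lemma bil_reflect_canonical: "bil r (reflect_deg \<tau> e m) (reflect_mult \<tau> e m) 3 (\<lambda>_. 1) = bil r e m 3 (\<lambda>_. 1)"
  using bil_reflect[OF inj ran, where g = 3 and n = "\<lambda>_. 1" and e = e and m = m]
  by (simp add: reflect_canonical[OF inj ran])

lemma htype_refl: "htype r d \<nu> \<Longrightarrow> htype r (refl_d \<tau> d \<nu>) (refl_nu \<tau> d \<nu>)"
  unfolding htype_def int_refl_d int_refl_nu bil_reflect[OF inj ran]
  by (simp add: bil_reflect_canonical)

lemma exc_class_refl:
  "exc_class r d \<nu> e m \<Longrightarrow> exc_class r (refl_d \<tau> d \<nu>) (refl_nu \<tau> d \<nu>) (reflect_deg \<tau> e m) (reflect_mult \<tau> e m)"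
  unfolding exc_class_def int_refl_d int_refl_nu bil_reflect[OF inj ran]
  by (simp add: bil_reflect_canonical)

abbreviation tnu where "tnu \<equiv> \<lambda>a. \<nu> (\<tau> a)"
abbreviation tnu' where "tnu' \<equiv> \<lambda>a. refl_nu \<tau> d \<nu> (\<tau> a)"
abbreviation cst where "cst \<equiv> delta p ^ (3 * d) / delta p ^ (\<Sum>a\<in>UNIV. tnu a)"

lemma cst: "cst \<noteq> 0" using tri_delta by simp

lemma transform_refl:
  assumes "form d g" "transform p tnu g g'"
  shows "form (refl_d \<tau> d \<nu>) g'" "transform p tnu' g' (const cst * g)"
  using transform_form'[OF tri_delta assms(2,1)] transform_inverse[OF tri_delta assms(2,1) step_pairs]
  by (simp_all add: refl_d_eq refl_nu_tau)

lemma transform_refl_mult: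
  assumes "form d g" "transform p tnu g g'" "l < r" "l \<notin> range \<tau>"
  shows "mult_ge n (refl_pt \<tau> P l) g' \<longleftrightarrow> mult_ge n (P l) g"
  unfolding refl_pt_other[OF assms(4)]
  by (rule transform_mult_ge_iff[OF tri_delta assms(2,1) transform_refl[OF assms(1,2)] cst tri_cof[OF assms(3,4)]])

text \<open>Transforming \<open>g'\<close> returns \<open>g\<close> up to a constant, so the
  multiplicity at a vertex is read off from the sides removed on the way back.\<close>

lemma transform_refl_mult_tau:
  assumes "form d g" "transform p tnu g g'"
  shows "mult_ge n (refl_pt \<tau> P (\<tau> a)) g' \<longleftrightarrow> lf p a ^ n dvd (\<Prod>a\<in>UNIV. lf p a ^ tnu' a) * (const cst * g)"
  using mult_ge_iff_lf_power_dvd[OF tri_delta transform_refl(1)[OF assms]] transform_refl(2)[OF assms]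
  by (simp add: refl_pt_tau transform_def)

lemma F_facts: "form d (F i)" "lin_indep F" "no_common_factor F"
  "l < r \<Longrightarrow> mult_ge (\<nu> l) (P l) (F i)" "l < r \<Longrightarrow> \<exists>i. \<not> mult_ge (Suc (\<nu> l)) (P l) (F i)"
  using F by (auto simp: net_def)

lemma ex_transform:
  assumes "\<And>l. l < r \<Longrightarrow> mult_ge (\<nu> l) (P l) g"
  obtains g' where "transform p tnu g g'"
proof -
  have "mult_ge (tnu a) (p a) g" for a using assms[OF tau_less] by (simp add: p)
  then show ?thesis using transformI[OF tri_delta, of tnu] that by blast
qed

lemma lf_not_common: "\<exists>i. \<not> lf p a dvd F i"
  using prime_elem_lf[OF tri_delta, of a] F_facts(3) unfolding prime_elem_def no_common_factor_def by blast

section \<open>The transformed net and the return from it\<close>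

context
  fixes F'
  assumes F': "\<And>i. transform p tnu (F i) (F' i)"
begin

lemma form_F': "form (refl_d \<tau> d \<nu>) (F' i)"
  and back_F': "transform p tnu' (F' i) (const cst * F i)"
  using transform_refl[OF F_facts(1) F'] by auto

lemma F'_nonzero: "F' i \<noteq> 0"
  using transform_form(3)[OF tri_delta F' F_facts(1) lin_indep_nonzero[OF F_facts(2)]] .

lemma lin_indep_F': "lin_indep F'"
  unfolding lin_indep_def
proof (intro allI impI)
  fix c i
  assume c: "(\<Sum>i\<in>UNIV. const (c i) * F' i) = 0"
  have "poly_subst (\<Sum>i\<in>UNIV. const (c i) * F i) (tq p) =
      (\<Prod>a\<in>UNIV. lf p a ^ tnu a) * (\<Sum>i\<in>UNIV. const (c i) * F' i)"
    unfolding subst_hom(8) subst_hom(4) F'[unfolded transform_def] subst_const sum_distrib_left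
    by (simp only: mult_ac)
  then have "(\<Sum>i\<in>UNIV. const (c i) * F i) = 0"
    using c subst_tq_0_iff[OF tri_delta, of d] by (simp add: form_sum form_cmult F_facts(1))
  then show "c i = 0" using F_facts(2) by (simp add: lin_indep_def)
qed

text \<open>A common side would raise the multiplicity of every member of the original net at the
  opposite vertex, against exactness.\<close>

lemma lf_not_common_F': "\<exists>i. \<not> lf p a dvd F' i"
proof (rule ccontr)
  assume "\<nexists>i. \<not> lf p a dvd F' i"
  then have "lf p a ^ tnu a * lf p a dvd (\<Prod>a\<in>UNIV. lf p a ^ tnu a) * F' i" for i
    by (intro mult_dvd_mono) (auto simp: prod_cyc[of _ a] mult.assoc)
  then have "mult_ge (Suc (\<nu> (\<tau> a))) (P (\<tau> a)) (F i)" for i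
    using mult_ge_if_lf_power_dvd[OF tri_delta F_facts(1), of a "Suc (tnu a)" i] F'[of i]
    by (simp add: transform_def p power_Suc2 del: power_Suc)
  then show False using F_facts(5)[OF tau_less] by blast
qed

text \<open>The pull-back of a common factor \<open>h\<close>, stripped of sides, divides every
  \<open>F i\<close> and is a unit. Hence only sides remain after pulling back twice;
  \<open>h\<close> divides such a product but contains no side, so it is a unit.\<close>

lemma no_common_factor_F': "no_common_factor F'"
  unfolding no_common_factor_def
proof (intro allI impI, rule ccontr)
  fix h assume h: "\<forall>i. h dvd F' i" and nu: "\<not> h dvd 1"
  obtain k where k: "form k h" using dvd_form[of h "F' 0"] h form_F' F'_nonzero by blast
  have h0: "h \<noteq> 0" using h F'_nonzero[of 0] by auto
  define P where "P g = (\<forall>a. \<not> lf p a dvd g)" for g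
  have strip: "\<exists>\<alpha> g'. g = (\<Prod>a\<in>UNIV. lf p a ^ \<alpha> a) * g' \<and> P g'" if "form n g" "g \<noteq> 0" for n g
    using that
  proof (induction n arbitrary: g rule: less_induct)
    case (less n)
    show ?case
    proof (cases "P g")
      case True
      then show ?thesis by (intro exI[of _ "\<lambda>_. 0"] exI[of _ g]) simp
    next
      case False
      then obtain a g1 where g1: "g = lf p a * g1" by (auto simp: P_def dvd_def)
      have n: "1 \<le> n" "form (n - 1) g1" using form_quotient[of n "lf p a" g1 1] less.prems g1 by auto
      then obtain \<alpha> g' where g': "g1 = (\<Prod>a\<in>UNIV. lf p a ^ \<alpha> a) * g'" "P g'"
        using less.IH[of "n - 1" g1] less.prems g1 by auto
      have "g = (\<Prod>b\<in>UNIV. lf p b ^ (\<alpha>(a := Suc (\<alpha> a))) b) * g'"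
        unfolding g1 g'(1) by (simp add: prod_cyc[of _ a] mult_ac)
      then show ?thesis using g'(2) by blast
    qed
  qed
  have fh: "form (k * 2) (poly_subst h (tq p))" by (rule form_subst[OF k form_tq])
  have nz: "poly_subst h (tq p) \<noteq> 0" using subst_tq_0_iff[OF tri_delta k] h0 by simp
  obtain \<alpha> h' where h': "poly_subst h (tq p) = (\<Prod>a\<in>UNIV. lf p a ^ \<alpha> a) * h'" "P h'"
    using strip[OF fh nz] by blast
  have "h' \<noteq> 0" using nz h' by auto
  have nh': "\<not> lf p a dvd h'" for a using h'(2) by (simp add: P_def)
  have "h' dvd F i" for i
  proof -
    have "h' dvd poly_subst h (tq p)" by (simp add: h')
    also have "\<dots> dvd poly_subst (F' i) (tq p)" using h hom_dvd[OF is_hom_subst] by blast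
    also have "\<dots> = (\<Prod>a\<in>UNIV. lf p a ^ tnu' a) * (const cst * F i)"
      using back_F' by (simp add: transform_def)
    finally have "h' dvd const cst * F i"
      by (rule dvd_prod_lf_cancel[OF tri_delta \<open>h' \<noteq> 0\<close> nh'])
    then show ?thesis using dvd_const_mult_iff[OF cst] by blast
  qed
  then have "h' dvd 1" using F_facts(3) by (simp add: no_common_factor_def)
  then obtain u where u: "1 = h' * u" by (auto simp: dvd_def)
  define M where "M = (\<Sum>a\<in>UNIV. \<alpha> a)"
  have nl: "\<not> lf p a dvd h" for a
    using lf_not_common_F'[of a] h dvd_trans by blast
  let ?Q = "poly_subst (\<Prod>a\<in>UNIV. lf p a ^ \<alpha> a) (tq p)"
  have "poly_subst (poly_subst h (tq p)) (tq p) * poly_subst u (tq p) = ?Q * poly_subst (h' * u) (tq p)"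
    unfolding h'(1) subst_hom(4) by (simp only: mult_ac)
  also have "\<dots> = ?Q" unfolding u[symmetric] subst_hom(2) by simp
  finally have Q: "poly_subst (poly_subst h (tq p)) (tq p) * poly_subst u (tq p) = ?Q" .
  have "h dvd poly_subst (poly_subst h (tq p)) (tq p) * poly_subst u (tq p)"
    unfolding subst_tq_tq[OF tri_delta k] by (intro dvd_mult2 dvd_mult dvd_refl)
  then have "h dvd ?Q" unfolding Q .
  then have "h dvd (\<Prod>a\<in>UNIV. lf p a ^ (\<alpha> (a + 1) + \<alpha> (a + 2))) * const (delta p ^ M)"
    unfolding subst_prod_lf_tq[OF tri_delta] M_def by (simp only: mult.commute)
  then have "h dvd const (delta p ^ M)"
    by (rule dvd_prod_lf_cancel[OF tri_delta h0 nl])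
  also have "\<dots> dvd 1" using tri_delta by (intro const_unit) simp
  finally show False using nu by simp
qed

lemma net_F': "net r (refl_d \<tau> d \<nu>) (refl_nu \<tau> d \<nu>) (refl_pt \<tau> P) F'"
  unfolding net_def
proof (intro conjI allI impI)
  fix l i assume l: "l < r"
  show "mult_ge (refl_nu \<tau> d \<nu> l) (refl_pt \<tau> P l) (F' i)"
  proof (cases "l \<in> range \<tau>")
    case True
    then obtain a where a: "l = \<tau> a" by auto
    have "lf p a ^ tnu' a dvd (\<Prod>a\<in>UNIV. lf p a ^ tnu' a)" by (simp add: prod_cyc[of _ a] mult.assoc)
    then show ?thesis unfolding a transform_refl_mult_tau[OF F_facts(1) F'] by (rule dvd_mult2)
  next
    case False
    then show ?thesis
      using transform_refl_mult[OF F_facts(1) F' l False] F_facts(4)[OF l] by (simp add: refl_nu_other)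
  qed
next
  fix l assume l: "l < r"
  show "\<exists>i. \<not> mult_ge (Suc (refl_nu \<tau> d \<nu> l)) (refl_pt \<tau> P l) (F' i)"
  proof (cases "l \<in> range \<tau>")
    case True
    then obtain a where a: "l = \<tau> a" by auto
    obtain i where "\<not> lf p a dvd F i" using lf_not_common by blast
    then have n: "\<not> lf p a dvd const cst * F i" using dvd_const_mult_iff[OF cst] by blast
    have "\<not> mult_ge (Suc (refl_nu \<tau> d \<nu> l)) (refl_pt \<tau> P l) (F' i)"
      unfolding a transform_refl_mult_tau[OF F_facts(1) F'] lf_power_dvd_prod_lf_iff[OF tri_delta n] by simp
    then show ?thesis by blast
  next
    case False
    then show ?thesis
      using transform_refl_mult[OF F_facts(1) F' l False] F_facts(5)[OF l] by (simp add: refl_nu_other)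
  qed
qed (simp_all add: form_F' lin_indep_F' no_common_factor_F')

lemma complete_net_pullback:
  assumes "complete_net r (refl_d \<tau> d \<nu>) (refl_nu \<tau> d \<nu>) (refl_pt \<tau> P) F'"
  shows "complete_net r d \<nu> P F"
  unfolding complete_net_def
proof (intro allI impI, elim conjE)
  fix g assume g: "form d g" and m: "\<forall>l<r. mult_ge (\<nu> l) (P l) g"
  obtain g' where g': "transform p tnu g g'" using ex_transform m by blast
  have "mult_ge (refl_nu \<tau> d \<nu> l) (refl_pt \<tau> P l) g'" if l: "l < r" for l
  proof (cases "l \<in> range \<tau>")
    case True
    then obtain a where a: "l = \<tau> a" by auto
    have "lf p a ^ tnu' a dvd (\<Prod>a\<in>UNIV. lf p a ^ tnu' a)" by (simp add: prod_cyc[of _ a] mult.assoc)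
    then show ?thesis unfolding a transform_refl_mult_tau[OF g g'] by (rule dvd_mult2)
  next
    case False
    then show ?thesis
      using transform_refl_mult[OF g g' l False] m l by (simp add: refl_nu_other)
  qed
  then have "g' \<in> linear_system F'"
    using assms transform_refl(1)[OF g g'] by (simp add: complete_net_def)
  then obtain c where c: "g' = (\<Sum>i\<in>UNIV. const (c i) * F' i)" by (auto simp: linear_system_def)
  have "poly_subst (\<Sum>i\<in>UNIV. const (c i) * F i) (tq p) = (\<Prod>a\<in>UNIV. lf p a ^ tnu a) * g'"
    unfolding subst_hom(8) subst_hom(4) F'[unfolded transform_def] subst_const sum_distrib_left c
    by (simp only: mult_ac)
  \<comment> \<open>Substitution of \<open>tq p\<close> is injective on forms, so the linear
    combination found for \<open>g'\<close> also represents \<open>g\<close>.\<close>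
  then have "poly_subst (g - (\<Sum>i\<in>UNIV. const (c i) * F i)) (tq p) = 0"
    using g' by (simp add: subst_hom(6) transform_def)
  then have "g - (\<Sum>i\<in>UNIV. const (c i) * F i) = 0"
    using subst_tq_0_iff[OF tri_delta, of d] by (simp add: form_diff form_sum form_cmult F_facts(1) g)
  then show "g \<in> linear_system F" by (auto simp: linear_system_def)
qed

lemma subst_combination:
  "poly_subst (const (Q j) * F' i - const (Q i) * F' j) (tq p) =
    (\<Prod>a\<in>UNIV. lf p a ^ tnu' a) * (const cst * (const (Q j) * F i - const (Q i) * F j))"
  using back_F' by (simp add: subst_hom(4,6) transform_def algebra_simps)

lemma prime_form_lf: "prime_form 1 (lf p a)"
  using prime_elem_lf[OF tri_delta, of a] tri_delta
  by (auto simp: prime_form_def prime_elem_dvd_mult_iff)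

lemma cof_zero_iff:
  assumes "l < r" shows "cof p a (P l) = 0 \<longleftrightarrow> l \<in> range \<tau> \<and> l \<noteq> \<tau> a"
proof (cases "l \<in> range \<tau>")
  case True
  then obtain b where b: "l = \<tau> b" by auto
  then have "P l = p b" by (simp add: p)
  then show ?thesis using b tri_delta injD[OF inj, of b a] by (auto simp: cof_self)
next
  case False
  then show ?thesis using tri_cof[OF assms False] by simp
qed

text \<open>The transformed net has no base point at \<open>p a\<close>, hence a value
  \<open>Q\<close> there. The quadratic map contracts the opposite side to \<open>p a\<close>, so
  the original net contracts this side to \<open>Q\<close>.\<close>

lemma contracted_line:
  assumes nu0: "refl_nu \<tau> d \<nu> (\<tau> a) = 0"
    and m: "\<And>l. l < r \<Longrightarrow> m l = (if l \<in> range \<tau> \<and> l \<noteq> \<tau> a then 1 else 0)"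
  shows "contracted r P F 1 m"
proof -
  define Q where "Q i = poly_eval (F' i) (p a)" for i
  let ?d = "refl_d \<tau> d \<nu>" and ?L = "lf p (a + 1) * lf p (a + 2)"
  have "\<exists>i. Q i \<noteq> 0"
  proof -
    have "\<exists>i. \<not> mult_ge (Suc (refl_nu \<tau> d \<nu> (\<tau> a))) (refl_pt \<tau> P (\<tau> a)) (F' i)"
      using net_F' tau_less unfolding net_def by blast
    then show ?thesis using mult_ge_1_iff[OF form_F'] by (simp add: nu0 refl_pt_tau Q_def)
  qed
  moreover have "lf p a dvd const (Q j) * F i - const (Q i) * F j" for i j
  proof -
    have mod: "lf p a dvd poly_subst (F' i) (tq p) - ?L ^ ?d * const (Q i)" for i
    proof -
      have "lf p a dvd tq p j - ?L * const (p a j)" for j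
        by (simp add: tq_eq sum_cyc[of _ a])
      then have "lf p a dvd poly_subst (F' i) (tq p) - poly_subst (F' i) (\<lambda>j. ?L * const (p a j))"
        by (rule dvd_subst_diff)
      then show ?thesis unfolding subst_scale[OF form_F'] subst_const_fun Q_def .
    qed
    have "poly_subst (const (Q j) * F' i - const (Q i) * F' j) (tq p) =
        const (Q j) * (poly_subst (F' i) (tq p) - ?L ^ ?d * const (Q i)) -
        const (Q i) * (poly_subst (F' j) (tq p) - ?L ^ ?d * const (Q j))"
      unfolding subst_hom(4,6) subst_const by (simp add: algebra_simps)
    also have "lf p a dvd \<dots>" by (intro dvd_diff dvd_mult mod)
    finally have dvd: "lf p a ^ 1 dvd (\<Prod>a\<in>UNIV. lf p a ^ tnu' a) * (const cst * (const (Q j) * F i - const (Q i) * F j))"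
      unfolding subst_combination by simp
    have "lf p a dvd const cst * (const (Q j) * F i - const (Q i) * F j)"
    proof (rule ccontr)
      assume n: "\<not> lf p a dvd const cst * (const (Q j) * F i - const (Q i) * F j)"
      show False using dvd unfolding lf_power_dvd_prod_lf_iff[OF tri_delta n] by (simp add: nu0)
    qed
    then show ?thesis using dvd_const_mult_iff[OF cst] by blast
  qed
  moreover have "\<forall>l<r. \<forall>n. mult_ge n (P l) (lf p a) \<longleftrightarrow> int n \<le> m l"
    using m by (auto simp: mult_ge_lf_iff[OF tri_delta] cof_zero_iff)
  ultimately show ?thesis unfolding contracted_def
    by (intro conjI exI[of _ "lf p a"] exI[of _ Q]) (use prime_form_lf[of a] in auto)
qed

lemma contracted_pullback:
  assumes c: "exc_class r d \<nu> e m"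
    and c': "contracted r (refl_pt \<tau> P) F' (reflect_deg \<tau> e m) (reflect_mult \<tau> e m)"
  shows "point_class r e m \<or> contracted r P F e m"
proof -
  define e' where "e' = nat (reflect_deg \<tau> e m)"
  have e': "int e' = reflect_deg \<tau> e m" using c' by (simp add: e'_def contracted_def)
  obtain f' Q where f': "prime_form e' f'" and Q: "\<exists>i. Q i \<noteq> 0"
    and con: "\<And>i j. f' dvd const (Q j) * F' i - const (Q i) * F' j"
    and mul: "\<And>l n. l < r \<Longrightarrow> mult_ge n (refl_pt \<tau> P l) f' \<longleftrightarrow> int n \<le> reflect_mult \<tau> e m l"
    using c' unfolding contracted_def e'_def by auto
  have ff': "form e' f'" and f'0: "f' \<noteq> 0" using f' by (auto simp: prime_form_def)
  show ?thesis
  proof (cases "\<exists>a. lf p a dvd f'")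
    \<comment> \<open>The prime form \<open>f'\<close> is then the side itself up to a unit. Its
      class has degree 1 and passes through two vertices, so the reflection has degree
      \<open>1 + (1 - 2) = 0\<close>.\<close>
    case True
    then obtain a b where b: "f' = lf p a * b" by (auto simp: dvd_def)
    have fb: "1 \<le> e'" "form (e' - 1) b" using form_quotient[of e' "lf p a" b 1] ff' f'0 b by auto
    have "\<not> f' dvd b"
    proof
      assume "f' dvd b"
      then obtain u where u: "b = f' * u" by (auto simp: dvd_def)
      have "b * (lf p a * u) = (lf p a * b) * u" by (simp only: mult_ac)
      then have eq: "b * 1 = b * (lf p a * u)" unfolding b[symmetric] u[symmetric] by simp
      have "b \<noteq> 0" using b f'0 by auto
      from iffD1[OF mult_left_cancel[OF this] eq] have "1 = lf p a * u" .
      then have "lf p a dvd 1" by (rule dvdI)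
      then show False using prime_elem_lf[OF tri_delta] by (simp add: prime_elem_def)
    qed
    then have d1: "f' dvd lf p a"
      using f' form_lf(1)[of p a] fb(2) b unfolding prime_form_def by (metis dvd_refl)
    have d2: "lf p a dvd f'" using b by simp
    have eq: "mult_ge n q f' \<longleftrightarrow> mult_ge n q (lf p a)" for n q
      using d1 d2 by (metis dvd_def mult.commute mult_ge_cmult)
    have rm: "reflect_mult \<tau> e m l = (if l \<in> range \<tau> \<and> l \<noteq> \<tau> a then 1 else 0)" if l: "l < r" for l
    proof -
      have *: "int n \<le> reflect_mult \<tau> e m l \<longleftrightarrow> n \<le> (if cof p a (refl_pt \<tau> P l) = 0 then 1 else 0)" for n
        using mul[OF l, of n] unfolding eq mult_ge_lf_iff[OF tri_delta] ..
      have "cof p a (refl_pt \<tau> P l) = 0 \<longleftrightarrow> cof p a (P l) = 0"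
      proof (cases "l \<in> range \<tau>")
        case True
        then show ?thesis by (simp add: refl_pt_def)
      next
        case False
        then show ?thesis using tri_delta l by (simp add: refl_pt_other cof_quad cof_zero_iff)
      qed
      then show ?thesis using *[of 0] *[of 1] *[of 2] cof_zero_iff[OF l] by (auto split: if_splits)
    qed
    have "e' = 1"
    proof -
      obtain u where u: "lf p a = f' * u" using d1 by (auto simp: dvd_def)
      have "f' * u \<noteq> 0" using lf_neq_0[OF tri_delta, of a] unfolding u .
      from form_quotient(1)[OF _ this ff', of 1] have "e' \<le> 1" using form_lf(1)[of p a] unfolding u .
      then show ?thesis using fb by simp
    qed
    then have "e = reflect_deg \<tau> 1 (reflect_mult \<tau> e m)" using e' reflect_reflect(1)[OF inj ran, of e m] by simp
    also have "\<dots> = 0" using injD[OF inj] tau_less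
      by (simp add: reflect_deg_def reflect_defect_def rm sum_cyc[of _ a] inj_eq[OF inj])
    finally show ?thesis using c exc_class_0_point by blast
  next
    case False
    then have nf': "\<not> lf p a dvd f'" for a by blast
    define N where "N a = nat (reflect_mult \<tau> e m (\<tau> a))" for a
    have N: "mult_ge n (p a) f' \<longleftrightarrow> n \<le> N a" and N0: "reflect_mult \<tau> e m (\<tau> a) = int (N a)" for n a
    proof -
      have "0 \<le> reflect_mult \<tau> e m (\<tau> a)" using mul[OF tau_less, of 0 a] by simp
      then show "reflect_mult \<tau> e m (\<tau> a) = int (N a)" by (simp add: N_def)
      then show "mult_ge n (p a) f' \<longleftrightarrow> n \<le> N a" using mul[OF tau_less, of n a] by (simp add: refl_pt_tau)
    qed
    obtain f where f: "transform p N f' f" using transformI[OF tri_delta, of N f'] N by blast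
    have le: "N (a + 1) + N (a + 2) \<le> e'" for a by (rule transform_line[OF tri_delta f ff' nf'])
    define M where "M a = e' - N (a + 1) - N (a + 2)" for a
    define k where "k = delta p ^ (3 * e') / delta p ^ (\<Sum>a\<in>UNIV. N a)"
    have k: "k \<noteq> 0" using tri_delta by (simp add: k_def)
    have bk: "transform p M f (const k * f')"
      unfolding M_def k_def by (rule transform_inverse[OF tri_delta f ff' le])
    define n where "n = 2 * e' - (\<Sum>a\<in>UNIV. N a)"
    have fn: "form n f" and f0: "f \<noteq> 0" using transform_form(2,3)[OF tri_delta f ff' f'0] by (auto simp: n_def)
    have e: "e = int n"
    proof -
      have "e = reflect_deg \<tau> (int e') (reflect_mult \<tau> e m)" using reflect_reflect(1)[OF inj ran, of e m] e' by simp
      then show ?thesis using le[of 0] le[of 1] le[of 2] by (simp add: reflect_deg_def reflect_defect_def N0 n_def sum_3)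
    qed
    have mM: "m (\<tau> a) = int (M a)" for a
    proof -
      have "m (\<tau> a) = reflect_mult \<tau> (int e') (reflect_mult \<tau> e m) (\<tau> a)" using reflect_reflect(2)[OF inj ran, of e m] e' by simp
      then show ?thesis unfolding reflect_mult_tau[OF inj ran, of "int e'"] N0 using le[of a] by (simp add: M_def)
    qed
    have nf: "\<not> lf p a dvd f" for a
    proof
      assume "lf p a dvd f"
      then have "lf p a ^ N a * lf p a dvd (\<Prod>a\<in>UNIV. lf p a ^ N a) * f"
        by (intro mult_dvd_mono) (auto simp: prod_cyc[of _ a] mult.assoc)
      then have "mult_ge (Suc (N a)) (p a) f'"
        using mult_ge_if_lf_power_dvd[OF tri_delta ff', of a "Suc (N a)"] f
        by (simp add: transform_def power_Suc2 del: power_Suc)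
      then show False by (simp add: N)
    qed
    have mult_f: "mult_ge j (P l) f \<longleftrightarrow> int j \<le> m l" if l: "l < r" for l j
    proof (cases "l \<in> range \<tau>")
      case True
      then obtain a where a: "l = \<tau> a" by auto
      have nk: "\<not> lf p a dvd const k * f'" using nf' dvd_const_mult_iff[OF k] by blast
      have "mult_ge j (p a) f \<longleftrightarrow> j \<le> M a"
        using mult_ge_iff_lf_power_dvd[OF tri_delta fn, of j a] lf_power_dvd_prod_lf_iff[OF tri_delta nk, of j M] bk
        by (simp add: transform_def)
      moreover have "P l = p a" by (simp add: a p)
      ultimately show ?thesis by (simp add: a mM)
    next
      case False
      have "mult_ge j (quad p (P l)) f' \<longleftrightarrow> mult_ge j (P l) f"
      proof -
        have "mult_ge j (quad p (P l)) (const k * f') \<longleftrightarrow> mult_ge j (P l) f"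
        proof (rule transform_mult_ge_iff[OF tri_delta bk fn _ _ k tri_cof[OF l False]])
          show "form e' (const k * f')" using ff' by (rule form_cmult)
          show "transform p N (const k * f') (const k * f)"
            using f by (simp add: transform_def subst_hom(4) mult_ac)
        qed
        then show ?thesis using k by (simp add: mult_ge_const_iff)
      qed
      then show ?thesis using mul[OF l, of j] False by (simp add: refl_pt_other reflect_mult_def)
    qed
    have contr: "f dvd const (Q j) * F i - const (Q i) * F j" for i j
    proof -
      have "f dvd poly_subst f' (tq p)" using f by (simp add: transform_def)
      also have "\<dots> dvd poly_subst (const (Q j) * F' i - const (Q i) * F' j) (tq p)"
        using hom_dvd[OF is_hom_subst con[of j i]] .
      finally have "f dvd const cst * (const (Q j) * F i - const (Q i) * F j)"
        unfolding subst_combination by (rule dvd_prod_lf_cancel[OF tri_delta f0 nf])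
      then show ?thesis using dvd_const_mult_iff[OF cst] by blast
    qed
    \<comment> \<open>Divisibility by \<open>f\<close> is pulled back to divisibility by
      \<open>f'\<close>, where primality is known, and returned by a second pull-back; the sides
      that appear cancel because they do not divide \<open>f\<close>.\<close>
    have prime: "f dvd u \<or> f dvd v" if u: "form i u" and v: "form j v" and uv: "f dvd u * v" for i j u v
    proof -
      have back': "poly_subst f (tq p) = (\<Prod>a\<in>UNIV. lf p a ^ M a) * (const k * f')"
        using bk by (simp add: transform_def)
      have "const k * f' dvd poly_subst f (tq p)" unfolding back' by simp
      also have "poly_subst f (tq p) dvd poly_subst u (tq p) * poly_subst v (tq p)"
        using hom_dvd[OF is_hom_subst uv, of "tq p"] by (simp only: subst_hom(4))
      finally have "f' dvd poly_subst u (tq p) * poly_subst v (tq p)" by (rule dvd_mult_right)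
      then have alt: "f' dvd poly_subst u (tq p) \<or> f' dvd poly_subst v (tq p)"
        by (rule prime_formD[OF f' form_subst[OF u form_tq] form_subst[OF v form_tq]])
      have lift: "f dvd w" if w: "form i w" and dvd: "f' dvd poly_subst w (tq p)" for i w
      proof -
        have "f dvd poly_subst f' (tq p)" using f by (simp add: transform_def)
        also have "\<dots> dvd poly_subst (poly_subst w (tq p)) (tq p)"
          by (rule hom_dvd[OF is_hom_subst dvd])
        also have "\<dots> = (\<Prod>a\<in>UNIV. lf p a ^ i) * (const (delta p ^ (3 * i)) * w)"
          unfolding subst_tq_tq[OF tri_delta w] by (simp only: mult_ac)
        finally have "f dvd const (delta p ^ (3 * i)) * w"
          by (rule dvd_prod_lf_cancel[OF tri_delta f0 nf])
        then show ?thesis using dvd_const_mult_iff[of "delta p ^ (3 * i)" f w] tri_delta by simp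
      qed
      show ?thesis using alt lift[OF u] lift[OF v] by blast
    qed
    have "contracted r P F e m" if "n \<noteq> 0"
      unfolding contracted_def
    proof (intro conjI exI[of _ f] exI[of _ Q])
      show "prime_form (nat e) f" using fn f0 prime that by (auto simp: prime_form_def e)
    qed (use mult_f Q contr e in auto)
    moreover have "point_class r e m" if "n = 0" using that c e exc_class_0_point by simp
    ultimately show ?thesis by blast
  qed
qed

lemma good_net_pullback:
  assumes "good_net r (refl_d \<tau> d \<nu>) (refl_nu \<tau> d \<nu>) (refl_pt \<tau> P) F'"
  shows "good_net r d \<nu> P F"
  unfolding good_net_def
proof (intro conjI allI impI)
  show "complete_net r d \<nu> P F"
    using assms complete_net_pullback by (simp add: good_net_def)
next
  fix e m assume c: "exc_class r d \<nu> e m"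
  have c': "exc_class r (refl_d \<tau> d \<nu>) (refl_nu \<tau> d \<nu>) (reflect_deg \<tau> e m) (reflect_mult \<tau> e m)"
    by (rule exc_class_refl[OF c])
  then consider "point_class r (reflect_deg \<tau> e m) (reflect_mult \<tau> e m)"
    | "contracted r (refl_pt \<tau> P) F' (reflect_deg \<tau> e m) (reflect_mult \<tau> e m)"
    using assms unfolding good_net_def by blast
  then show "point_class r e m \<or> contracted r P F e m"
  proof cases
    case 1
    then obtain k where k: "k < r" "reflect_mult \<tau> e m k = -1" and e0: "reflect_deg \<tau> e m = 0"
      and 0: "\<And>l. l < r \<Longrightarrow> l \<noteq> k \<Longrightarrow> reflect_mult \<tau> e m l = 0"
      by (auto simp: point_class_def)
    have e: "e = reflect_deg \<tau> 0 (reflect_mult \<tau> e m)" using reflect_reflect(1)[OF inj ran, of e m] e0 by simp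
    have m: "m l = reflect_mult \<tau> 0 (reflect_mult \<tau> e m) l" for l using reflect_reflect(2)[OF inj ran, of e m] e0 by simp
    show ?thesis
    proof (cases "k \<in> range \<tau>")
      case False
      then have "reflect_mult \<tau> e m (\<tau> a) = 0" for a using 0[OF tau_less] by (metis rangeI)
      then have "reflect_defect \<tau> 0 (reflect_mult \<tau> e m) = 0" by (simp add: reflect_defect_def)
      then have "e = 0" using e by (simp add: reflect_deg_def)
      then show ?thesis using c exc_class_0_point by blast
    next
      case True
      then obtain a where a: "k = \<tau> a" by auto
      have rt: "reflect_mult \<tau> e m (\<tau> b) = (if b = a then -1 else 0)" for b
        using 0[OF tau_less, of b] k a inj_eq[OF inj, of b a] by auto
      have rd: "reflect_defect \<tau> 0 (reflect_mult \<tau> e m) = 1" by (simp add: reflect_defect_def rt)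
      have "e = 1" using e rd by (simp add: reflect_deg_def)
      \<comment> \<open>Orthogonality now says that the vertex has multiplicity 0 in the transformed
        net, as \<open>contracted_line\<close> requires.\<close>
      have "(\<Sum>l<r. reflect_mult \<tau> e m l * int (refl_nu \<tau> d \<nu> l)) = 0"
        using c' e0 by (simp add: exc_class_def bil_def)
      moreover have "(\<Sum>l<r. reflect_mult \<tau> e m l * int (refl_nu \<tau> d \<nu> l)) = - int (refl_nu \<tau> d \<nu> k)"
        using k 0 by (simp add: sum.remove[of "{..<r}" k])
      ultimately have "refl_nu \<tau> d \<nu> (\<tau> a) = 0" using a by simp
      moreover have "m l = (if l \<in> range \<tau> \<and> l \<noteq> \<tau> a then 1 else 0)" if "l < r" for l
        unfolding m[of l] reflect_mult_def[of _ 0] rd using 0[OF that] k a by auto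
      ultimately have "contracted r P F 1 m" by (rule contracted_line)
      then show ?thesis using \<open>e = 1\<close> by simp
    qed
  next
    case 2
    then show ?thesis by (rule contracted_pullback[OF c])
  qed
qed

end

end

section \<open>Point configurations in general position\<close>

definition cfg :: "(nat \<Rightarrow> 3 \<Rightarrow> 'k) \<Rightarrow> nat \<times> 3 \<Rightarrow> 'k" where
  "cfg P = (\<lambda>(l, j). P l j)"

text \<open>Coordinate vectors and arbitrary polynomials, instead of projective points and
  multihomogeneous ones, make the notion compatible with the substitution of
  \<open>refl_pt\<close>.\<close>

definition generic :: "((nat \<Rightarrow> 3 \<Rightarrow> 'k::field) \<Rightarrow> bool) \<Rightarrow> bool" where
  "generic Q \<longleftrightarrow> (\<exists>g. g \<noteq> 0 \<and> (\<forall>P. poly_eval g (cfg P) \<noteq> 0 \<longrightarrow> Q P))"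

lemma generic_mono: "generic Q \<Longrightarrow> (\<And>P. Q P \<Longrightarrow> Q' P) \<Longrightarrow> generic Q'"
  unfolding generic_def by blast

lemma generic_conj:
  assumes "generic Q" "generic Q'" shows "generic (\<lambda>P. Q P \<and> Q' P)"
proof -
  obtain g g' where "g \<noteq> 0" "g' \<noteq> 0" "\<And>P. poly_eval g (cfg P) \<noteq> 0 \<Longrightarrow> Q P"
    "\<And>P. poly_eval g' (cfg P) \<noteq> 0 \<Longrightarrow> Q' P"
    using assms by (auto simp: generic_def)
  then show ?thesis unfolding generic_def by (intro exI[of _ "g * g'"]) (auto simp: eval_hom)
qed

lemma generic_UNIV: "(\<And>P. Q P) \<Longrightarrow> generic Q"
  unfolding generic_def by (intro exI[of _ 1]) simp

lemma generic_obtain: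
  assumes "infinite (UNIV :: 'k::field set)" "generic (Q :: (nat \<Rightarrow> 3 \<Rightarrow> 'k) \<Rightarrow> bool)"
  obtains P where "Q P"
proof -
  obtain g :: "(nat \<times> 3, 'k) mpoly" where g: "g \<noteq> 0" "\<And>P. poly_eval g (cfg P) \<noteq> 0 \<Longrightarrow> Q P"
    using assms(2) by (auto simp: generic_def)
  obtain a where "poly_eval g a \<noteq> 0" using nonzero_point[OF assms(1) g(1)] .
  moreover have "a = cfg (\<lambda>l j. a (l, j))" by (auto simp: cfg_def)
  ultimately have "poly_eval g (cfg (\<lambda>l j. a (l, j))) \<noteq> 0" by simp
  then show ?thesis using g(2) that by blast
qed

definition vr :: "nat \<Rightarrow> 3 \<Rightarrow> (nat \<times> 3, 'k::field) mpoly" where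
  "vr l j = var (l, j)"

lemma eval_vr [simp]: "poly_eval (vr l j) (cfg P) = P l j"
  by (simp add: vr_def cfg_def)

lemma generic_general_triangle:
  assumes inj: "inj \<tau>"
  shows "generic (general_triangle r \<tau> :: (nat \<Rightarrow> 3 \<Rightarrow> 'k::field) \<Rightarrow> bool)"
proof -
  define L where "L = {l. l < r \<and> l \<notin> range \<tau>}"
  have fin: "finite L" by (simp add: L_def)
  define N :: "(nat \<times> 3, 'k) mpoly" where
    "N = delta (\<lambda>a. vr (\<tau> a)) * (\<Prod>l\<in>L. \<Prod>a\<in>UNIV. cof (\<lambda>a. vr (\<tau> a)) a (vr l))"
  have N: "poly_eval N (cfg P) = delta (\<lambda>a. P (\<tau> a)) * (\<Prod>l\<in>L. \<Prod>a\<in>UNIV. cof (\<lambda>a. P (\<tau> a)) a (P l))" for P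
    by (simp add: N_def hom_mult[OF is_hom_eval] hom_prod[OF is_hom_eval] hom_delta[OF is_hom_eval]
        hom_cof[OF is_hom_eval])
  \<comment> \<open>Unit vectors at the vertices and \<open>(1, 1, 1)\<close>, which is on no side,
    everywhere else.\<close>
  define P0 :: "nat \<Rightarrow> 3 \<Rightarrow> 'k" where
    "P0 l j = (if l \<in> range \<tau> then if l = \<tau> j then 1 else 0 else 1)" for l j
  have P0: "P0 (\<tau> a) = (\<lambda>j. if j = a then 1 else 0)" for a
    using inj_eq[OF inj] by (auto simp: P0_def)
  have d0: "delta (\<lambda>a. P0 (\<tau> a)) = 1" by (simp add: P0 delta_def det3_def)
  have c0: "cof (\<lambda>a. P0 (\<tau> a)) a (P0 l) = 1" if "l \<in> L" for a l
  proof -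
    have "P0 l = (\<lambda>_. 1)" using that by (auto simp: P0_def L_def)
    then show ?thesis using exhaust_3[of a] by (elim disjE) (simp_all add: P0 cof_def det3_def)
  qed
  have "poly_eval N (cfg P0) = 1" unfolding N d0 using c0 by simp
  then have "N \<noteq> 0" by (metis hom_zero is_hom_eval zero_neq_one)
  moreover have "general_triangle r \<tau> P" if "poly_eval N (cfg P) \<noteq> 0" for P
    using that fin unfolding N general_triangle_def by (auto simp: L_def)
  ultimately show ?thesis unfolding generic_def by blast
qed

lemma quad_scale: "quad p (\<lambda>j. s * u j) j = s ^ 2 * quad p u j"
  unfolding quad_def cof_smult by (simp add: sum_distrib_left power2_eq_square mult_ac)

lemma eval_cong:
  "(\<And>m x. m \<in> Poly_Mapping.keys f \<Longrightarrow> x \<in> Poly_Mapping.keys m \<Longrightarrow> a x = b x) \<Longrightarrow> poly_eval f a = poly_eval f b"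
  unfolding poly_eval_def by (intro sum.cong prod.cong arg_cong2[of _ _ _ _ "(*)"]) auto

text \<open>Up to rescaling of the points, \<open>refl_pt \<tau>\<close> is an involution on general configurations; square
  roots in \<open>k\<close> provide the rescaling that makes it dominant on coordinate vectors.\<close>

lemma generic_refl_pt:
  fixes Q :: "(nat \<Rightarrow> 3 \<Rightarrow> 'k::alg_closed_field) \<Rightarrow> bool"
  assumes inj: "inj \<tau>" and Q: "generic Q"
  shows "generic (\<lambda>P. Q (refl_pt \<tau> P))"
proof -
  obtain g :: "(nat \<times> 3, 'k) mpoly" where g: "g \<noteq> 0" "\<And>P. poly_eval g (cfg P) \<noteq> 0 \<Longrightarrow> Q P"
    using Q by (auto simp: generic_def)
  define \<Phi> :: "nat \<times> 3 \<Rightarrow> (nat \<times> 3, 'k) mpoly" where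
    "\<Phi> = (\<lambda>(l, j). if l \<in> range \<tau> then vr l j else quad (\<lambda>a. vr (\<tau> a)) (vr l) j)"
  have \<Phi>: "poly_eval (poly_subst g \<Phi>) (cfg P) = poly_eval g (cfg (refl_pt \<tau> P))" for P
    unfolding eval_subst
    by (rule arg_cong[of _ _ "poly_eval g"])
       (auto simp: \<Phi>_def cfg_def[of "refl_pt \<tau> P"] refl_pt_def hom_quad[OF is_hom_eval])
  \<comment> \<open>The indices of the points occurring in \<open>g\<close>; \<open>r\<close> bounds
    them, so that \<open>general_triangle r\<close> controls every point that matters.\<close>
  define X where "X = fst ` \<Union>(Poly_Mapping.keys ` Poly_Mapping.keys g)"
  have "finite X" unfolding X_def by (intro finite_imageI finite_UN_I finite_keys)
  then obtain r where r: "\<And>l. l \<in> X \<Longrightarrow> l < r"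
    using finite_nat_set_iff_bounded[of X] by auto
  have "generic (\<lambda>P. poly_eval g (cfg P) \<noteq> 0 \<and> general_triangle r \<tau> P)"
    by (rule generic_conj) (use g generic_general_triangle[OF inj] in \<open>auto simp: generic_def\<close>)
  then obtain P1 where P1: "poly_eval g (cfg P1) \<noteq> 0" "general_triangle r \<tau> P1"
    using generic_obtain[OF alg_closed_infinite] by blast
  define p where "p = (\<lambda>a. P1 (\<tau> a))"
  \<comment> \<open>Applying the map twice multiplies \<open>P1 l\<close> by \<open>K l\<close>, and
    scaling the argument by \<open>s\<close> scales the value by \<open>s^2\<close>. With
    \<open>s\<close> a square root of \<open>1 / K l\<close>, the configuration \<open>P2\<close> is
    mapped to \<open>P1\<close> at all indices below \<open>r\<close>.\<close>
  define K where "K l = delta p ^ 3 * (\<Prod>a\<in>UNIV. cof p a (P1 l))" for l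
  have "\<exists>s. K l \<noteq> 0 \<longrightarrow> s ^ 2 * K l = 1" for l
  proof -
    obtain s where "s ^ 2 = inverse (K l)" using nth_root_exists[of 2 "inverse (K l)"] by auto
    then show ?thesis by (intro exI[of _ s]) auto
  qed
  then obtain s where s: "\<And>l. K l \<noteq> 0 \<Longrightarrow> s l ^ 2 * K l = 1" by metis
  define P2 where "P2 l = (if l \<in> range \<tau> then P1 l else (\<lambda>j. s l * quad p (P1 l) j))" for l
  have p2: "(\<lambda>a. P2 (\<tau> a)) = p" by (auto simp: P2_def p_def)
  have "refl_pt \<tau> P2 l j = P1 l j" if "l < r" for l j
  proof (cases "l \<in> range \<tau>")
    case False
    have "K l \<noteq> 0" using P1(2) that False by (auto simp: general_triangle_def p_def K_def)
    have "refl_pt \<tau> P2 l j = quad p (\<lambda>j. s l * quad p (P1 l) j) j"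
      unfolding refl_pt_def p2 using False by (simp add: P2_def)
    also have "\<dots> = s l ^ 2 * K l * P1 l j"
      unfolding quad_scale quad_quad K_def by (simp add: mult_ac)
    finally show ?thesis using s[OF \<open>K l \<noteq> 0\<close>] by simp
  qed (simp add: refl_pt_def P2_def)
  then have "poly_eval g (cfg (refl_pt \<tau> P2)) = poly_eval g (cfg P1)"
    using r by (intro eval_cong) (force simp: cfg_def X_def)
  then have "poly_subst g \<Phi> \<noteq> 0"
    using P1(1) \<Phi>[of P2] by (metis hom_zero is_hom_eval)
  then show ?thesis
    unfolding generic_def using g(2) \<Phi> by metis
qed

text \<open>The degree drops because the three multiplicities sum to more than \<open>d\<close>.
  Degree 0 contradicts self-intersection 1, and in degree 1 every configuration will do.\<close>

lemma generic_good_net: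
  assumes "htype r d \<nu>" "3 \<le> r"
  shows "generic (\<lambda>P :: nat \<Rightarrow> 3 \<Rightarrow> 'k::alg_closed_field. \<forall>F. net r d \<nu> P F \<longrightarrow> good_net r d \<nu> P F)"
  using assms(1)
proof (induction d arbitrary: \<nu> rule: less_induct)
  case (less d)
  note h = less.prems
  consider "d = 0" | "d = 1" | "2 \<le> d" by linarith
  then show ?case
  proof cases
    case 1
    have "(\<Sum>l<r. int (\<nu> l) * int (\<nu> l)) \<ge> 0" by (intro sum_nonneg) simp
    then show ?thesis using h 1 by (simp add: htype_def bil_def)
  next
    case 2
    then show ?thesis using good_net_1 h by (intro generic_UNIV) auto
  next
    case 3
    have "\<exists>\<tau> :: 3 \<Rightarrow> nat. inj \<tau> \<and> range \<tau> \<subseteq> {..<r} \<and> d < (\<Sum>a\<in>UNIV. \<nu> (\<tau> a))"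
      by (rule noether_inequality[OF h 3 assms(2)])
    then obtain \<tau> :: "3 \<Rightarrow> nat" where \<tau>: "inj \<tau>" "range \<tau> \<subseteq> {..<r}" "d < (\<Sum>a\<in>UNIV. \<nu> (\<tau> a))"
      by auto
    show ?thesis
    \<comment> \<open>A net over a general triangle ensures that the reflected numbers are not
      truncated; if there is none, the claim is vacuous on general triangles.\<close>
    proof (cases "\<exists>(P :: nat \<Rightarrow> 3 \<Rightarrow> 'k) F. general_triangle r \<tau> P \<and> net r d \<nu> P F")
      case False
      show ?thesis
        by (rule generic_mono[OF generic_general_triangle[OF \<tau>(1), of r]]) (use False in blast)
    next
      case True
      then obtain P0 :: "nat \<Rightarrow> 3 \<Rightarrow> 'k" and F0 where P0: "general_triangle r \<tau> P0" and F0: "net r d \<nu> P0 F0"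
        by auto
      have h': "htype r (refl_d \<tau> d \<nu>) (refl_nu \<tau> d \<nu>)"
        by (rule htype_refl[OF refl \<tau>(1,2) P0 F0 h])
      have "refl_d \<tau> d \<nu> < d"
      proof -
        have "(\<Sum>a\<in>UNIV. int (\<nu> (\<tau> a))) > int d" using \<tau>(3) by (metis of_nat_less_iff of_nat_sum)
        then show ?thesis using 3 by (simp add: refl_d_def reflect_deg_def reflect_defect_def)
      qed
      from less.IH[OF this h']
      have "generic (\<lambda>P :: nat \<Rightarrow> 3 \<Rightarrow> 'k. general_triangle r \<tau> P \<and>
        (\<forall>F. net r (refl_d \<tau> d \<nu>) (refl_nu \<tau> d \<nu>) (refl_pt \<tau> P) F \<longrightarrow>
           good_net r (refl_d \<tau> d \<nu>) (refl_nu \<tau> d \<nu>) (refl_pt \<tau> P) F))"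
        by (intro generic_conj generic_general_triangle generic_refl_pt \<tau>(1))
      then show ?thesis
      proof (rule generic_mono, intro allI impI)
        fix P :: "nat \<Rightarrow> 3 \<Rightarrow> 'k" and F
        assume P: "general_triangle r \<tau> P \<and>
          (\<forall>F. net r (refl_d \<tau> d \<nu>) (refl_nu \<tau> d \<nu>) (refl_pt \<tau> P) F \<longrightarrow>
             good_net r (refl_d \<tau> d \<nu>) (refl_nu \<tau> d \<nu>) (refl_pt \<tau> P) F)"
          and F: "net r d \<nu> P F"
        then have tri: "general_triangle r \<tau> P" by blast
        note ctx = refl[of "\<lambda>a. P (\<tau> a)"] \<tau>(1,2) tri F
        have "\<exists>g. transform (\<lambda>a. P (\<tau> a)) (\<lambda>a. \<nu> (\<tau> a)) (F i) g" for i
          using ex_transform[OF ctx, of "F i"] F unfolding net_def by metis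
        then obtain F' where F': "\<And>i. transform (\<lambda>a. P (\<tau> a)) (\<lambda>a. \<nu> (\<tau> a)) (F i) (F' i)" by metis
        have "good_net r (refl_d \<tau> d \<nu>) (refl_nu \<tau> d \<nu>) (refl_pt \<tau> P) F'"
          using P net_F'[OF ctx F'] by simp
        then show "good_net r d \<nu> P F" by (rule good_net_pullback[OF ctx F'])
      qed
    qed
  qed
qed

section \<open>Multiplicities in local coordinates\<close>

definition local_coord :: "3 \<Rightarrow> 3 \<Rightarrow> (2, 'k::field) mpoly" where
  "local_coord i j = (if j = i then 0 else if j = i + 1 then var 0 else var 1)"

lemma homog_local_coord: "homog (local_coord i j) = monom 1 1 * [:local_coord i j:]"
  by (simp add: local_coord_def homog_hom smult_monom mult.commute[of "monom _ _"])

lemma local_eq_conv: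
  "local_eq P f = poly_subst f (\<lambda>j. const (coords P j) + local_coord (chart_index P) j)"
  by (simp add: local_eq_def local_coord_def)

lemma coords_chart_index: "coords P (chart_index P) \<noteq> 0"
  unfolding chart_index_def using coords_nonzero by (rule someI_ex)

lemma local_eq_degree_ge:
  assumes "mult_ge n (coords P) f" "m \<in> Poly_Mapping.keys (local_eq P f)"
  shows "n \<le> mon_degree m"
proof -
  let ?w = "\<lambda>j. [:local_coord (chart_index P) j:]"
  have "homog (local_eq P f) = ev (\<lambda>c. [:const c:]) (\<lambda>j. [:const (coords P j):] * 1 + monom 1 1 * ?w j) f"
    unfolding local_eq_conv poly_subst_ev hom_ev[OF is_hom_const is_hom_homog]
    by (simp add: homog_hom homog_local_coord)
  then have "monom 1 1 ^ n dvd homog (local_eq P f)"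
    using mult_ge_ev[OF assms(1) is_hom_pconst, of "monom 1 1" 1 ?w] by simp
  then have "coeff (homog (local_eq P f)) k = 0" if "k < n" for k
    using that by (simp add: monom_power monom_1_dvd_iff')
  then have "Poly_Mapping.lookup (coeff (homog (local_eq P f)) (mon_degree m)) m = 0" if "mon_degree m < n"
    using that by simp
  then show ?thesis
    using assms(2) by (auto simp: lookup_coeff_homog in_keys_iff not_less[symmetric])
qed

text \<open>Rewrite \<open>S p + T W = A p + T W'\<close> with \<open>W'\<close> in the span of the two local coordinate directions,
  and compare the expansions in \<open>T\<close> after clearing denominators by a power of \<open>A\<close>.\<close>

lemma mult_ge_local_eq:
  fixes f :: "(3, 'k::field) mpoly"
  assumes inf: "infinite (UNIV :: 'k set)" and f: "form d f"
    and g: "\<And>m. m \<in> Poly_Mapping.keys (local_eq P f) \<Longrightarrow> n \<le> mon_degree m"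
  shows "mult_ge n (coords P) f"
proof -
  define p where "p = coords P"
  define i where "i = chart_index P"
  have pi: "p i \<noteq> 0" unfolding p_def i_def by (rule coords_chart_index)
  define w :: "3 \<Rightarrow> (nat, 'k) mpoly" where "w j = var (if j = 0 then 2 else if j = 1 then 3 else 4)" for j
  \<comment> \<open>\<open>W = (w i / p i) p + W'\<close> with \<open>W' i = 0\<close> gives
    \<open>S p + T W = A p + T W'\<close>.\<close>
  define A :: "(nat, 'k) mpoly" where "A = var 0 + var 1 * (const (1 / p i) * w i)"
  define w' where "w' j = w j - const (p j / p i) * w i" for j
  define loc where "loc b = (\<lambda>x::2. if x = 0 then b (i + 1) else b (i + 2))" for b :: "3 \<Rightarrow> (nat, 'k) mpoly"
  define G where "G k = coeff (homog (local_eq P f)) k" for k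
  define D where "D = degree (homog (local_eq P f))"
  \<comment> \<open>Larger than \<open>d\<close> and \<open>D\<close>, so that both sides of the
    identity below vanish wherever \<open>A\<close> does; elsewhere \<open>A\<close> can be divided
    out.\<close>
  define N where "N = Suc (max d D)"
  have G: "form k (G k)" for k unfolding G_def by (rule form_coeff_homog)
  have G0: "G k = 0" if "k < n" for k
  proof (rule poly_mapping_eqI)
    fix m show "Poly_Mapping.lookup (G k) m = Poly_Mapping.lookup 0 m"
      using g[of m] that by (cases "m \<in> Poly_Mapping.keys (local_eq P f)")
        (auto simp: G_def lookup_coeff_homog in_keys_iff)
  qed
  have sum: "local_eq P f = (\<Sum>k\<le>D. G k)"
    using poly_altdef[of "homog (local_eq P f)" 1] by (simp add: G_def D_def)
  have "A ^ (N - d) * poly_subst f (spread p) = (\<Sum>k\<le>D. A ^ (N - k) * var 1 ^ k * poly_subst (G k) (loc w'))"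
    (is "?L = ?R")
  proof (rule poly_eqI_eval[OF inf])
    fix a
    define \<alpha> t where "\<alpha> = poly_eval A a" and "t = a 1"
    define x' where "x' j = poly_eval (w' j) a" for j
    define y where "y = (\<lambda>x::2. if x = 0 then x' (i + 1) else x' (i + 2))"
    have x'i: "x' i = 0" using pi by (simp add: x'_def w'_def eval_hom)
    have x: "poly_eval (spread p j) a = \<alpha> * p j + t * x' j" for j
    proof -
      have "poly_eval (spread p j) a = p j * a 0 + t * poly_eval (w j) a"
        by (simp add: spread_def w_def eval_hom t_def)
      moreover have "\<alpha> = a 0 + t * (1 / p i * poly_eval (w i) a)"
        by (simp add: \<alpha>_def A_def eval_hom t_def)
      moreover have "x' j = poly_eval (w j) a - p j / p i * poly_eval (w i) a"
        by (simp add: x'_def w'_def eval_hom)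
      ultimately show ?thesis using pi by (simp only:) (simp add: field_simps)
    qed
    have y: "poly_eval (poly_subst (G k) (loc w')) a = poly_eval (G k) y" for k
      unfolding eval_subst by (rule arg_cong[of _ _ "poly_eval (G k)"]) (auto simp: loc_def y_def x'_def)
    have L: "poly_eval ?L a = \<alpha> ^ (N - d) * poly_eval f (\<lambda>j. \<alpha> * p j + t * x' j)"
      by (simp add: eval_hom(4,7) \<alpha>_def[symmetric] eval_subst x)
    have R: "poly_eval ?R a = (\<Sum>k\<le>D. \<alpha> ^ (N - k) * t ^ k * poly_eval (G k) y)"
      by (simp add: eval_hom(4,7,8) \<alpha>_def[symmetric] y t_def)
    show "poly_eval ?L a = poly_eval ?R a"
    proof (cases "\<alpha> = 0")
      case True
      have "\<alpha> ^ (N - k) = 0" if "k \<le> D" for k using True that by (simp add: N_def)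
      then have "poly_eval ?R a = 0" unfolding R by (intro sum.neutral) auto
      moreover have "\<alpha> ^ (N - d) = 0" using True by (simp add: N_def)
      ultimately show ?thesis unfolding L by simp
    next
      case False
      have loc_eval: "poly_eval (local_coord i j) (\<lambda>x. t / \<alpha> * y x) = t / \<alpha> * x' j" for j
        using cyc_cases[of j i] x'i by (auto simp: local_coord_def y_def eval_hom)
      have "poly_eval f (\<lambda>j. \<alpha> * p j + t * x' j) = poly_eval f (\<lambda>j. \<alpha> * (p j + t / \<alpha> * x' j))"
        using False by (simp add: algebra_simps)
      also have "\<dots> = \<alpha> ^ d * poly_eval f (\<lambda>j. p j + t / \<alpha> * x' j)" by (rule eval_scale[OF f])
      also have "poly_eval f (\<lambda>j. p j + t / \<alpha> * x' j) = poly_eval (local_eq P f) (\<lambda>x. t / \<alpha> * y x)"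
        unfolding local_eq_conv eval_subst p_def[symmetric] i_def[symmetric] eval_hom(3) eval_const loc_eval ..
      also have "\<dots> = (\<Sum>k\<le>D. (t / \<alpha>) ^ k * poly_eval (G k) y)"
        unfolding sum eval_hom(8) eval_scale[OF G] ..
      finally have "poly_eval ?L a = (\<Sum>k\<le>D. \<alpha> ^ (N - d) * \<alpha> ^ d * ((t / \<alpha>) ^ k * poly_eval (G k) y))"
        unfolding L by (simp add: sum_distrib_left mult.assoc)
      also have "\<dots> = (\<Sum>k\<le>D. \<alpha> ^ (N - k) * t ^ k * poly_eval (G k) y)"
      proof (rule sum.cong[OF refl])
        fix k assume "k \<in> {..D}"
        then have "N = N - d + d" "N = N - k + k" by (auto simp: N_def)
        then have "\<alpha> ^ (N - d) * \<alpha> ^ d = \<alpha> ^ (N - k) * \<alpha> ^ k" by (metis power_add)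
        then show "\<alpha> ^ (N - d) * \<alpha> ^ d * ((t / \<alpha>) ^ k * poly_eval (G k) y) = \<alpha> ^ (N - k) * t ^ k * poly_eval (G k) y"
          using False by (simp add: power_divide)
      qed
      finally show ?thesis unfolding R .
    qed
  qed
  also have "var 1 ^ n dvd ?R"
  proof (rule dvd_sum)
    fix k assume "k \<in> {..D}"
    show "var 1 ^ n dvd A ^ (N - k) * var 1 ^ k * poly_subst (G k) (loc w')"
    proof (cases "k < n")
      case True
      then show ?thesis by (simp add: G0 subst_hom(1))
    next
      case False
      then have "var 1 ^ n dvd (var 1 :: (nat, 'k) mpoly) ^ k" by (intro le_imp_power_dvd) simp
      then show ?thesis by (intro dvd_mult2 dvd_mult)
    qed
  qed
  finally have dvd: "var 1 ^ n dvd A ^ (N - d) * poly_subst f (spread p)" .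
  have "poly_subst A (var(1 := 0)) = var 0" by (simp add: A_def subst_hom)
  then have "\<not> var 1 dvd A" by (simp add: var_dvd_iff[of "1::nat", simplified])
  then have "\<not> var 1 dvd A ^ (N - d)" using prime_elem_dvd_powerD[OF prime_elem_var] by blast
  from prime_elem_power_dvd_mult[OF prime_elem_var this dvd]
  show ?thesis by (simp add: mult_ge_def p_def)
qed

lemma mult_ge_linear_system:
  "(\<And>i. mult_ge n p (F i)) \<Longrightarrow> g \<in> linear_system F \<Longrightarrow> mult_ge n p g"
  by (auto simp: linear_system_def intro!: mult_ge_sum mult_ge_cmult)

lemma mult_origin_ge_iff:
  "g \<noteq> 0 \<Longrightarrow> n \<le> mult_origin g \<longleftrightarrow> (\<forall>m\<in>Poly_Mapping.keys g. n \<le> mon_degree m)"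
  unfolding mult_origin_def by (subst Min_ge_iff) auto

lemma system_mult_imp_mult:
  fixes F :: "3 \<Rightarrow> (3, 'k::field) mpoly"
  assumes inf: "infinite (UNIV :: 'k set)" and F: "\<And>i. form d (F i)" "lin_indep F"
    and n: "system_mult (local_eq P ` linear_system F) = n"
  shows "mult_ge n (coords P) (F i)" "\<exists>i. \<not> mult_ge (Suc n) (coords P) (F i)"
proof -
  let ?V = "local_eq P ` linear_system F - {0}"
  \<comment> \<open>A zero local equation would meet every lower bound and give a multiplicity
    beyond the degree. This matters because \<open>system_mult\<close> discards zero.\<close>
  have nz: "local_eq P (F i) \<noteq> 0" for i
  proof
    assume "local_eq P (F i) = 0"
    then have "mult_ge (Suc d) (coords P) (F i)" by (intro mult_ge_local_eq[OF inf F(1)]) simp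
    from mult_ge_le_degree[OF this F(1) lin_indep_nonzero[OF F(2)]] show False by simp
  qed
  have V: "local_eq P (F i) \<in> ?V" for i using nz linear_system_memI by auto
  have inf_eq: "Inf (mult_origin ` ?V) = n" using n by (simp add: system_mult_def)
  have "n \<le> mult_origin (local_eq P (F i))"
    unfolding inf_eq[symmetric] using V by (intro wellorder_Inf_le1) blast
  then show "mult_ge n (coords P) (F i)"
    using nz by (intro mult_ge_local_eq[OF inf F(1)]) (simp add: mult_origin_ge_iff)
  have "Inf (mult_origin ` ?V) \<in> mult_origin ` ?V"
    using V by (intro Inf_nat_def1) blast
  then obtain g where g: "g \<in> linear_system F" "local_eq P g \<noteq> 0" "mult_origin (local_eq P g) = n"
    unfolding inf_eq by auto
  show "\<exists>i. \<not> mult_ge (Suc n) (coords P) (F i)"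
  proof (rule ccontr)
    assume "\<nexists>i. \<not> mult_ge (Suc n) (coords P) (F i)"
    then have "mult_ge (Suc n) (coords P) g" using mult_ge_linear_system[OF _ g(1)] by blast
    then have "Suc n \<le> mult_origin (local_eq P g)"
      using local_eq_degree_ge g(2) by (subst mult_origin_ge_iff) blast+
    then show False using g(3) by simp
  qed
qed

lemma net_if_cremona_on_points:
  fixes F :: "3 \<Rightarrow> (3, 'k::field) mpoly"
  assumes inf: "infinite (UNIV :: 'k set)" and F: "cremona_on_points d \<nu> ps F"
  shows "net (length ps) d (\<lambda>l. \<nu> ! l) (\<lambda>l. coords (ps ! l)) F"
proof -
  have c: "\<And>i. form d (F i)" "lin_indep F" "no_common_factor F"
    and v: "map (virtual_mult F) (map (\<lambda>P. (P, [])) ps) = \<nu>"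
    using F by (auto simp: cremona_on_points_def cremona_def base_points_with_mults_def)
  have "system_mult (local_eq (ps ! l) ` linear_system F) = \<nu> ! l" if "l < length ps" for l
    using that by (simp add: v[symmetric] virtual_mult_def)
  from system_mult_imp_mult[OF inf c(1,2) this] show ?thesis using c by (auto simp: net_def)
qed

section \<open>Zariski open sets of point configurations\<close>

lemma keys_subst_subset:
  assumes "0 \<in> M" "\<And>m n. m \<in> M \<Longrightarrow> n \<in> M \<Longrightarrow> m + n \<in> M" "\<And>x. Poly_Mapping.keys (a x) \<subseteq> M"
  shows "Poly_Mapping.keys (poly_subst f a) \<subseteq> M"
proof -
  let ?K = "\<lambda>g. Poly_Mapping.keys g \<subseteq> M"
  have one: "?K 1" using assms(1) by simp
  have mult: "?K (g * h)" if "?K g" "?K h" for g h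
    using keys_mult[of g h] that assms(2) by fastforce
  have pow: "?K (g ^ n)" if "?K g" for g n
    by (induction n) (simp_all only: power_0 power_Suc one mult that)
  have prod: "?K (prod h A)" if "\<And>x. x \<in> A \<Longrightarrow> ?K (h x)" for h :: "'b \<Rightarrow> _" and A
    using that
  proof (induction A rule: infinite_finite_induct)
    case (insert x A)
    then show ?case unfolding prod.insert[OF insert.hyps(1,2)] by (intro mult) auto
  qed (use one in simp_all)
  have const: "?K (const c)" for c using assms(1) by (auto simp: const_def)
  have "?K (const (Poly_Mapping.lookup f m) * (\<Prod>x\<in>Poly_Mapping.keys m. a x ^ Poly_Mapping.lookup m x))" for m
    by (intro mult const prod pow assms(3))
  then show ?thesis unfolding poly_subst_def using keys_sum by fastforce
qed

text \<open>The multidegree, kept as a monomial with one variable per point: scaling the points by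
  \<open>c\<close> multiplies the monomial \<open>m\<close> by
  \<open>mon c (mdeg m)\<close>.\<close>

definition mdeg :: "(nat \<times> 3 \<Rightarrow>\<^sub>0 nat) \<Rightarrow> (nat \<Rightarrow>\<^sub>0 nat)" where
  "mdeg m = (\<Sum>x\<in>Poly_Mapping.keys m. Poly_Mapping.single (fst x) (Poly_Mapping.lookup m x))"

lemma lookup_mdeg: "Poly_Mapping.lookup (mdeg m) i = (\<Sum>j\<in>UNIV. Poly_Mapping.lookup m (i, j))"
proof -
  have "Poly_Mapping.lookup (mdeg m) i = (\<Sum>x\<in>Poly_Mapping.keys m. if fst x = i then Poly_Mapping.lookup m x else 0)"
    unfolding mdeg_def lookup_sum by (intro sum.cong) (auto simp: lookup_single when_def)
  also have "\<dots> = sum (Poly_Mapping.lookup m) {x \<in> Poly_Mapping.keys m. fst x = i}"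
    by (simp add: sum.If_cases Int_def)
  also have "\<dots> = sum (Poly_Mapping.lookup m) (Pair i ` UNIV)"
    by (rule sum.mono_neutral_left) (auto simp: in_keys_iff)
  finally show ?thesis by (simp add: sum.reindex inj_on_def)
qed

lemma mon_scale_points: "mon (\<lambda>x. c (fst x) * v x) m = mon c (mdeg m) * mon v m"
proof -
  have "mon c (mdeg m) = (\<Prod>x\<in>Poly_Mapping.keys m. c (fst x) ^ Poly_Mapping.lookup m x)"
    unfolding mdeg_def mon_sum mon_single ..
  then show ?thesis by (simp add: mon_def power_mult_distrib prod.distrib)
qed

lemma prod_var_neq_0: "(\<Prod>i<(r::nat). var (f i)) \<noteq> (0 :: ('v::linorder, 'k::field) mpoly)"
  by simp

lemma coords_abs:
  fixes v :: "3 \<Rightarrow> 'k::field"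
  assumes "v i \<noteq> 0" obtains c where "c \<noteq> 0" "coords (abs_proj2 v) = (\<lambda>j. c * v j)"
proof -
  have "proj_rel v v" using assms unfolding proj_rel_def by (auto intro!: exI[of _ "1::'k"])
  then have "proj_rel v (rep_proj2 (abs_proj2 v))"
    using Quotient3_rep_abs[OF Quotient3_proj2] part_equivp_symp[OF part_equivp_proj_rel] by blast
  then show ?thesis using that by (auto simp: proj_rel_def coords_def)
qed

text \<open>One multihomogeneous component \<open>G\<close> defines the open set. Where
  \<open>G\<close> is nonzero, the original polynomial is nonzero as a polynomial in independent
  scalings of the points, hence nonzero after some rescaling, to which \<open>Q\<close> is
  insensitive.\<close>

lemma zariski_open_if_generic:
  fixes Q :: "(nat \<Rightarrow> 3 \<Rightarrow> 'k::field) \<Rightarrow> bool"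
  assumes inf: "infinite (UNIV :: 'k set)" and Q: "generic Q"
    and inv: "\<And>P P' c. (\<And>l. l < r \<Longrightarrow> c l \<noteq> 0 \<and> P l = (\<lambda>j. c l * P' l j)) \<Longrightarrow> Q P \<Longrightarrow> Q P'"
  shows "\<exists>U. zariski_open r U \<and> U \<noteq> {} \<and> (\<forall>ps\<in>U. length ps = r \<and> Q (\<lambda>l. coords (ps ! l)))"
proof -
  obtain g :: "(nat \<times> 3, 'k) mpoly" where g: "g \<noteq> 0" "\<And>P. poly_eval g (cfg P) \<noteq> 0 \<Longrightarrow> Q P"
    using Q by (auto simp: generic_def)
  obtain a where a: "poly_eval g a \<noteq> 0" using nonzero_point[OF inf g(1)] .
  \<comment> \<open>Points of index at least \<open>r\<close> are frozen at coordinates where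
    \<open>g\<close> does not vanish.\<close>
  define h where "h = poly_subst g (\<lambda>x. if fst x < r then var x else const (a x))"
  have eval_h: "poly_eval h b = poly_eval g (\<lambda>x. if fst x < r then b x else a x)" for b
    unfolding h_def eval_subst by (rule arg_cong[of _ _ "poly_eval g"]) auto
  have "poly_eval h a \<noteq> 0" using a by (simp add: eval_h)
  then have "h \<noteq> 0" by (metis hom_zero is_hom_eval)
  then obtain m0 where m0: "m0 \<in> Poly_Mapping.keys h" by (metis all_not_in_conv keys_eq_empty)
  have vars: "fst x < r" if "m \<in> Poly_Mapping.keys h" "x \<in> Poly_Mapping.keys m" for m x
  proof -
    let ?M = "{m :: nat \<times> 3 \<Rightarrow>\<^sub>0 nat. \<forall>x\<in>Poly_Mapping.keys m. fst x < r}"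
    have "Poly_Mapping.keys h \<subseteq> ?M"
      unfolding h_def
    proof (rule keys_subst_subset)
      fix m n assume "m \<in> ?M" "n \<in> ?M"
      then show "m + n \<in> ?M" using keys_add[of m n] by auto
    qed (auto simp: var_def const_def)
    then show ?thesis using that by auto
  qed
  define G where "G = (\<Sum>m | m \<in> Poly_Mapping.keys h \<and> mdeg m = mdeg m0.
    Poly_Mapping.single m (Poly_Mapping.lookup h m))"
  have lG: "Poly_Mapping.lookup G m = (if mdeg m = mdeg m0 then Poly_Mapping.lookup h m else 0)" for m
  proof -
    have "Poly_Mapping.lookup G m = (\<Sum>n | n \<in> Poly_Mapping.keys h \<and> mdeg n = mdeg m0.
        if n = m then Poly_Mapping.lookup h n else 0)"
      unfolding G_def lookup_sum by (intro sum.cong) (auto simp: lookup_single when_def)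
    then show ?thesis by (simp add: in_keys_iff)
  qed
  then have kG: "Poly_Mapping.keys G = {m \<in> Poly_Mapping.keys h. mdeg m = mdeg m0}"
    by (auto simp: in_keys_iff split: if_splits)
  have "multiform r G"
    unfolding multiform_def
  proof (intro exI[of _ "Poly_Mapping.lookup (mdeg m0)"] conjI ballI allI impI)
    fix i assume "r \<le> i"
    then have "(i, j) \<notin> Poly_Mapping.keys m0" for j using vars[OF m0, of "(i, j)"] by auto
    then show "Poly_Mapping.lookup (mdeg m0) i = 0" by (simp add: lookup_mdeg in_keys_iff)
  qed (simp add: kG flip: lookup_mdeg)
  have "G \<noteq> 0" using m0 kG by (metis (mono_tags, lifting) empty_iff keys_zero mem_Collect_eq)
  have eval_G: "poly_eval G (\<lambda>x. c (fst x) * v x) = mon c (mdeg m0) * poly_eval G v" for c v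
  proof -
    have "poly_eval G (\<lambda>x. c (fst x) * v x) = (\<Sum>m\<in>Poly_Mapping.keys G. mon c (mdeg m0) * (Poly_Mapping.lookup G m * mon v m))"
      unfolding poly_eval_ev ev_def mon_scale_points by (intro sum.cong) (auto simp: kG)
    then show ?thesis by (simp add: poly_eval_ev ev_def sum_distrib_left)
  qed
  define U where "U = {ps :: 'k proj2 list. length ps = r \<and>
    (\<exists>g\<in>{G}. poly_eval g (\<lambda>(i, j). coords (ps ! i) j) \<noteq> 0)}"
  have "zariski_open r U"
    unfolding zariski_open_def U_def using \<open>multiform r G\<close> by (intro exI[of _ "{G}"]) simp
  moreover have "U \<noteq> {}"
  proof -
    \<comment> \<open>The extra factor keeps the coordinate vectors nonzero, so that they define
      points.\<close>
    have "G * (\<Prod>i<r. var (i, 0)) \<noteq> 0" using \<open>G \<noteq> 0\<close> prod_var_neq_0[of "\<lambda>i. (i, 0)"] by simp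
    then obtain v where "poly_eval (G * (\<Prod>i<r. var (i, 0))) v \<noteq> 0" using nonzero_point[OF inf] by blast
    then have v: "poly_eval G v \<noteq> 0" "\<And>i. i < r \<Longrightarrow> v (i, 0) \<noteq> 0" by (auto simp: eval_hom)
    define ps where "ps = map (\<lambda>i. abs_proj2 (\<lambda>j. v (i, j))) [0..<r]"
    have "\<exists>c. c \<noteq> 0 \<and> (i < r \<longrightarrow> coords (ps ! i) = (\<lambda>j. c * v (i, j)))" for i
    proof (cases "i < r")
      case True
      obtain c where "c \<noteq> 0" "coords (abs_proj2 (\<lambda>j. v (i, j))) = (\<lambda>j. c * v (i, j))"
        using coords_abs[of "\<lambda>j. v (i, j)" 0] v(2)[OF True] by blast
      then show ?thesis using True by (auto simp: ps_def)
    qed (auto intro!: exI[of _ 1])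
    then obtain c where c: "\<And>i. c i \<noteq> 0" "\<And>i. i < r \<Longrightarrow> coords (ps ! i) = (\<lambda>j. c i * v (i, j))" by metis
    have "poly_eval G (\<lambda>(i, j). coords (ps ! i) j) = poly_eval G (\<lambda>x. c (fst x) * v x)"
      using vars c(2) by (intro eval_cong) (auto simp: kG)
    also have "\<dots> \<noteq> 0" unfolding eval_G using v(1) c(1) by (simp add: mon_def)
    finally have "ps \<in> U" by (simp add: U_def ps_def)
    then show ?thesis by blast
  qed
  moreover have "length ps = r \<and> Q (\<lambda>l. coords (ps ! l))" if ps: "ps \<in> U" for ps
  proof
    show "length ps = r" using ps by (simp add: U_def)
    define v where "v = (\<lambda>(i, j). coords (ps ! i) j)"
    have vG: "poly_eval G v \<noteq> 0" using ps by (simp add: U_def v_def)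
    \<comment> \<open>\<open>h\<close> as a polynomial in the scaling factors; its coefficient at
      the multidegree of \<open>G\<close> is the value of \<open>G\<close>.\<close>
    define \<Gamma> :: "(nat, 'k) mpoly" where "\<Gamma> = poly_subst h (\<lambda>x. var (fst x) * const (v x))"
    have eval_\<Gamma>: "poly_eval \<Gamma> c = poly_eval h (\<lambda>x. c (fst x) * v x)" for c
      unfolding \<Gamma>_def eval_subst by (simp add: eval_hom(4))
    have "Poly_Mapping.lookup \<Gamma> (mdeg m0) = poly_eval G v"
    proof -
      have "\<Gamma> = (\<Sum>m\<in>Poly_Mapping.keys h. Poly_Mapping.single (mdeg m) (Poly_Mapping.lookup h m * mon v m))"
        unfolding \<Gamma>_def poly_subst_ev ev_def mon_scale_points[of var "\<lambda>x. const (v x)"] mon_var hom_mon[OF is_hom_const, symmetric]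
        by (simp add: const_def mult_single)
      then have "Poly_Mapping.lookup \<Gamma> (mdeg m0) =
          (\<Sum>m\<in>Poly_Mapping.keys h. if mdeg m = mdeg m0 then Poly_Mapping.lookup h m * mon v m else 0)"
        by (simp add: lookup_sum lookup_single when_def)
      also have "\<dots> = (\<Sum>m\<in>Poly_Mapping.keys G. Poly_Mapping.lookup G m * mon v m)"
        unfolding kG by (subst sum.inter_filter) (auto simp: lG intro!: sum.cong)
      finally show ?thesis by (simp add: poly_eval_ev ev_def)
    qed
    then have "\<Gamma> \<noteq> 0" using vG by auto
    then have "\<Gamma> * (\<Prod>i<r. var i) \<noteq> 0" using prod_var_neq_0[of "\<lambda>i. i"] by simp
    then obtain c where "poly_eval (\<Gamma> * (\<Prod>i<r. var i)) c \<noteq> 0" using nonzero_point[OF inf] by blast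
    then have c: "poly_eval h (\<lambda>x. c (fst x) * v x) \<noteq> 0" "\<And>i. i < r \<Longrightarrow> c i \<noteq> 0"
      by (auto simp: eval_hom eval_\<Gamma>)
    define P1 where "P1 l j = (if l < r then c l * coords (ps ! l) j else a (l, j))" for l j
    have "poly_eval g (cfg P1) = poly_eval h (\<lambda>x. c (fst x) * v x)"
      unfolding eval_h by (rule arg_cong[of _ _ "poly_eval g"]) (auto simp: cfg_def P1_def v_def)
    then have "Q P1" using c(1) g(2) by simp
    then show "Q (\<lambda>l. coords (ps ! l))"
      by (rule inv[of c, rotated]) (use c(2) in \<open>auto simp: P1_def\<close>)
  qed
  ultimately show ?thesis by blast
qed

section \<open>Rescaling of points, and the numbering of the first three\<close>

lemma good_net_cong:
  assumes "\<And>l. l < r \<Longrightarrow> c l \<noteq> 0 \<and> P l = (\<lambda>j. c l * P' l j)"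
  shows "net r d \<nu> P F \<longleftrightarrow> net r d \<nu> P' F" "good_net r d \<nu> P F \<longleftrightarrow> good_net r d \<nu> P' F"
proof -
  have *: "mult_ge n (P l) f \<longleftrightarrow> mult_ge n (P' l) f" if "l < r" for n l f
    using assms[OF that] mult_ge_scale by blast
  have A: "(\<forall>l<r. mult_ge (\<nu> l) (P l) g) \<longleftrightarrow> (\<forall>l<r. mult_ge (\<nu> l) (P' l) g)" for g
    using * by auto
  have B: "(\<forall>l<r. \<forall>n. mult_ge n (P l) g \<longleftrightarrow> int n \<le> m l) \<longleftrightarrow> (\<forall>l<r. \<forall>n. mult_ge n (P' l) g \<longleftrightarrow> int n \<le> m l)"
    for g and m :: "nat \<Rightarrow> int"
    using * by auto
  show "net r d \<nu> P F \<longleftrightarrow> net r d \<nu> P' F" using * by (auto simp: net_def)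
  show "good_net r d \<nu> P F \<longleftrightarrow> good_net r d \<nu> P' F"
    unfolding good_net_def complete_net_def contracted_def A B ..
qed

definition tri :: "3 \<Rightarrow> nat" where
  "tri a = (if a = 0 then 0 else if a = 1 then 1 else 2)"

lemma tri_inj: "tri a = tri b \<longleftrightarrow> a = b"
  using exhaust_3[of a] exhaust_3[of b] by (auto simp: tri_def)

lemma tri_less: "tri a < 3"
  by (simp add: tri_def)

lemma ex_tri: "l < 3 \<Longrightarrow> \<exists>a. l = tri a"
  by (cases "l = 0"; cases "l = 1")
     (auto simp: tri_def intro: exI[of _ 0] exI[of _ 1] exI[of _ 2])

lemma delta_scale: "delta (\<lambda>a j. c a * p a j) = c 0 * c 1 * c 2 * delta p"
  by (simp add: delta_def det3_def algebra_simps)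

section \<open>Contracted curves\<close>

lemma prime_form_not_unit: "prime_form n f \<Longrightarrow> \<not> f dvd 1"
  using form_unit_iff[of n f] by (auto simp: prime_form_def)

text \<open>Factors of a form are forms, so primality tested on forms is enough.\<close>

lemma prime_form_irreducible:
  assumes f: "prime_form n f" shows "irreducible f"
proof (rule irreducibleI)
  show "f \<noteq> 0" "\<not> f dvd 1" using f prime_form_not_unit by (auto simp: prime_form_def)
  fix a b assume ab: "f = a * b"
  have nz: "a * b \<noteq> 0" and fab: "form n (a * b)" using f ab by (auto simp: prime_form_def)
  obtain k where k: "form k a" "form (n - k) b" using form_factor[OF fab nz] .
  have unit: "v dvd 1" if "f dvd u" "f = u * v" for u v
  proof -
    obtain w where w: "u = f * w" using \<open>f dvd u\<close> by (auto simp: dvd_def)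
    have "u * (w * v) = (u * v) * w" by (simp only: mult_ac)
    then have eq: "u * 1 = u * (w * v)" unfolding that(2)[symmetric] w[symmetric] by simp
    have "u \<noteq> 0" using that(2) f by (auto simp: prime_form_def)
    from iffD1[OF mult_left_cancel[OF this] eq] show ?thesis by (metis dvd_triv_right)
  qed
  have "f dvd a \<or> f dvd b" using prime_formD[OF f k] ab by simp
  then show "a dvd 1 \<or> b dvd 1" using unit[of a b] unit[of b a] ab by (auto simp: mult.commute)
qed

lemma prime_form_dvd_power:
  assumes f: "prime_form n f" and g: "form m g" and dvd: "f dvd g ^ k"
  shows "f dvd g"
  using dvd
proof (induction k)
  case 0
  then show ?case using prime_form_not_unit[OF f] by simp
next
  case (Suc k)
  then show ?case using prime_formD[OF f g form_power[OF g]] by auto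
qed

lemma prime_form_dvd_degree:
  assumes f: "prime_form n f" and g: "form m g" "g \<noteq> 0" and dvd: "f dvd g"
  shows "n \<le> m"
proof -
  obtain u where "g = f * u" using dvd by (auto simp: dvd_def)
  then show ?thesis using form_quotient(1)[of m f u n] f g by (auto simp: prime_form_def)
qed

text \<open>If \<open>G (F x) = h x\<close> and \<open>F\<close> were constant with value \<open>Q\<close> along \<open>f = 0\<close> while \<open>G Q \<noteq> 0\<close>, the
  identity map of the curve would be constant too; this is carried out modulo \<open>f\<close>.\<close>

lemma contracted_base_point:
  fixes F :: "3 \<Rightarrow> (3, 'k::field) mpoly"
  assumes f: "prime_form n f" "2 \<le> n" and F: "\<And>i. form d (F i)" "no_common_factor F"
    and Q: "Q k \<noteq> 0" "\<And>i j. f dvd const (Q j) * F i - const (Q i) * F j"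
    and G: "represents_inverse F G"
  shows "poly_eval (G i) Q = 0"
proof (rule ccontr)
  define c where "c i = poly_eval (G i) Q" for i
  fix j assume "poly_eval (G j) Q \<noteq> 0"
  then have cj: "c j \<noteq> 0" by (simp add: c_def)
  obtain e h where e: "\<And>i. form e (G i)" and h: "h \<noteq> 0" "\<And>i. poly_subst (G i) F = h * var i"
    using G unfolding represents_inverse_def by blast
  \<comment> \<open>Modulo \<open>f\<close> the vectors \<open>Q k F\<close> and
    \<open>F k Q\<close> agree; \<open>G i\<close> is applied to both.\<close>
  have mod: "f dvd const (Q k ^ e) * (h * var i) - F k ^ e * const (c i)" for i
  proof -
    have "f dvd poly_subst (G i) (\<lambda>x. const (Q k) * F x) - poly_subst (G i) (\<lambda>x. F k * const (Q x))"
      by (rule dvd_subst_diff) (use Q(2)[of k] in \<open>simp add: mult.commute[of "F k"]\<close>)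
    then show ?thesis
      by (simp add: subst_scale[OF e] subst_const_fun h(2) c_def const_simps(7))
  qed
  have "form (e * d) (h * var 0)" using form_subst[where a = F, OF e[of 0] F(1)] unfolding h(2) .
  then obtain m where fh: "form m h" using form_factor[of "e * d" h "var 0"] h(1) by auto
  \<comment> \<open>Eliminating \<open>F k ^ e\<close> makes \<open>f\<close> divide
    \<open>h * L i\<close>: away from the zeros of \<open>h\<close>, the curve would lie on the
    lines \<open>L i = 0\<close>.\<close>
  define L where "L i = const (c j) * var i - const (c i) * var j" for i :: 3
  have L: "form 1 (L i)" for i unfolding L_def by (intro form_diff form_cmult form_var)
  have "f dvd h * L i" for i
  proof -
    have "const (Q k ^ e) * (h * L i) = const (c j) * (const (Q k ^ e) * (h * var i) - F k ^ e * const (c i))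
        - const (c i) * (const (Q k ^ e) * (h * var j) - F k ^ e * const (c j))"
      by (simp add: L_def algebra_simps)
    also have "f dvd \<dots>" by (intro dvd_diff dvd_mult mod)
    finally show ?thesis using dvd_const_mult_iff[of "Q k ^ e" f "h * L i"] Q(1) by simp
  qed
  then have alt: "f dvd h \<or> f dvd L i" for i using prime_formD[OF f(1) fh L] by blast
  show False
  proof (cases "f dvd h")
    \<comment> \<open>Then \<open>F k\<close> vanishes along the curve, and as \<open>Q k\<close> is
      nonzero so does every \<open>F i\<close>.\<close>
    case True
    then have "f dvd const (Q k ^ e) * (h * var j)" by simp
    then have "f dvd const (Q k ^ e) * (h * var j) - (const (Q k ^ e) * (h * var j) - F k ^ e * const (c j))"
      by (intro dvd_diff mod)
    then have "f dvd const (c j) * F k ^ e" by (simp add: mult.commute)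
    then have "f dvd F k ^ e" using dvd_const_mult_iff[OF cj] by blast
    then have Fk: "f dvd F k" by (rule prime_form_dvd_power[OF f(1) F(1)])
    have "f dvd F i" for i
    proof -
      have "f dvd (const (Q k) * F i - const (Q i) * F k) + const (Q i) * F k"
        using Q(2)[of k i] Fk by (intro dvd_add dvd_mult)
      then have "f dvd const (Q k) * F i" by simp
      then show ?thesis using dvd_const_mult_iff[OF Q(1)] by blast
    qed
    then show False using F(2) prime_form_not_unit[OF f(1)] by (auto simp: no_common_factor_def)
  next
    case False
    then have fL: "f dvd L (j + 1)" using alt by blast
    have "poly_eval (L (j + 1)) (\<lambda>i. if i = j + 1 then 1 else 0) = c j"
      by (simp add: L_def eval_hom)
    then have "L (j + 1) \<noteq> 0" using cj by (auto simp: eval_hom)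
    from prime_form_dvd_degree[OF f(1) L this fL] show False using f(2) by simp
  qed
qed

lemma principal_curveI:
  fixes F :: "3 \<Rightarrow> (3, 'k::field) mpoly"
  assumes f: "prime_form n f" "2 \<le> n" and F: "\<And>i. form d (F i)" "no_common_factor F"
    and Q: "Q k \<noteq> 0" "\<And>i j. f dvd const (Q j) * F i - const (Q i) * F j"
  shows "principal_curve F n f"
  unfolding principal_curve_def
proof (intro conjI exI[of _ "abs_proj2 Q"] allI impI)
  show "form n f" using f by (simp add: prime_form_def)
  show "irreducible f" using prime_form_irreducible f by blast
  obtain c where c: "c \<noteq> 0" "coords (abs_proj2 Q) = (\<lambda>j. c * Q j)"
    using coords_abs Q(1) by blast
  show "base_point_of_inverse F (abs_proj2 Q)"
    unfolding base_point_of_inverse_def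
  proof (intro allI impI)
    fix G i assume G: "represents_inverse F G"
    then obtain e where "form e (G i)" by (auto simp: represents_inverse_def)
    then have "poly_eval (G i) (\<lambda>j. c * Q j) = c ^ e * poly_eval (G i) Q" by (rule eval_scale)
    then show "vanishes_at (G i) (abs_proj2 Q)"
      using contracted_base_point[OF f F Q G] by (simp add: vanishes_at_def c)
  qed
next
  fix P assume P: "vanishes_at f P \<and> (\<exists>i. \<not> vanishes_at (F i) P)"
  define y where "y i = poly_eval (F i) (coords P)" for i
  obtain i where i: "y i \<noteq> 0" using P by (auto simp: vanishes_at_def y_def)
  have rel: "Q j * y i = Q i * y j" for i j
  proof -
    obtain u where u: "const (Q j) * F i - const (Q i) * F j = f * u" using Q(2) by (auto simp: dvd_def)
    have "poly_eval (const (Q j) * F i - const (Q i) * F j) (coords P) = 0"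
      unfolding u using P by (simp add: eval_hom vanishes_at_def)
    then show ?thesis by (simp add: eval_hom y_def)
  qed
  have yk: "y k \<noteq> 0" using rel[of k i] i Q(1) by auto
  have "Q = (\<lambda>i. Q k / y k * y i)"
  proof
    fix i show "Q i = Q k / y k * y i" using rel[of k i] yk by (simp add: field_simps)
  qed
  moreover have "Q k / y k \<noteq> 0" using Q(1) yk by simp
  ultimately have "proj_rel y Q" unfolding proj_rel_def using i by blast
  then have "abs_proj2 y = abs_proj2 Q" by (rule Quotient3_rel_abs[OF Quotient3_proj2])
  then show "abs_proj2 (\<lambda>i. poly_eval (F i) (coords P)) = abs_proj2 Q" by (simp add: y_def[abs_def])
qed

section \<open>The base ideal\<close>

lemma module_mult: "module ((*) :: 'a::comm_ring_1 \<Rightarrow> 'a \<Rightarrow> 'a)"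
  by standard (simp_all add: algebra_simps)

lemma ideal_gen_eqI:
  fixes F G :: "3 \<Rightarrow> (3, 'k::field) mpoly"
  assumes "\<And>i. F i \<in> linear_system G" "\<And>i. G i \<in> linear_system F"
  shows "ideal_gen (range F) = ideal_gen (range G)"
proof -
  have "H i \<in> module.span (*) (range K)" if H: "H i \<in> linear_system K" for H K :: "3 \<Rightarrow> (3, 'k) mpoly" and i
  proof -
    obtain c where "H i = (\<Sum>j\<in>UNIV. const (c j) * K j)" using H by (auto simp: linear_system_def)
    then show ?thesis
      by (simp only:) (rule module.span_sum[OF module_mult], rule module.span_scale[OF module_mult],
          rule module.span_base[OF module_mult], rule rangeI)
  qed
  then show ?thesis
    unfolding ideal_gen_def module.span_eq[OF module_mult] using assms by auto
qed

lemma range_3: "range (F :: 3 \<Rightarrow> _) = {F 0, F 1, F 2}"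
  unfolding UNIV_3 by simp

text \<open>The Cremona class is twice the sub-homaloidal class minus a line, so the class of the curves
  \<open>f a\<close>, obtained from the latter by subtracting a line and adding the exceptional curve at the
  point \<open>tri a\<close>, is a \<open>(-1)\<close>-class orthogonal to it.\<close>

lemma good_net_decomposition:
  fixes F :: "3 \<Rightarrow> (3, 'k::field) mpoly"
  assumes s: "3 \<le> s" and r: "3 \<le> r" and t: "s = 2 * t + 1" and L: "\<And>a. L (tri a) = t"
    and sum1: "(\<Sum>l<r. int (L l)) = 3 * (int s - 1)" and sum2: "(\<Sum>l<r. int (L l) * int (L l)) = int s * (int s - 1)"
    and delta: "delta (\<lambda>a. P (tri a)) \<noteq> 0"
    and F: "net r (2 * s - 1) (\<lambda>l. 2 * L l) P F"
    and good: "good_net r (2 * s - 1) (\<lambda>l. 2 * L l) P F"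
  shows "\<exists>(f :: 3 \<Rightarrow> (3, 'k) mpoly) (l :: 3 \<Rightarrow> (3, 'k) mpoly). (\<forall>i. principal_curve F (s - 1) (f i)) \<and>
      (\<forall>i j. i \<noteq> j \<longrightarrow> \<not> same_curve (f i) (f j)) \<and> (\<forall>i. form 1 (l i)) \<and> lin_indep l \<and>
      base_ideal F = ideal_gen {l 2 * f 0 * f 1, l 1 * f 0 * f 2, l 0 * f 1 * f 2}"
proof -
  define p where "p a = P (tri a)" for a
  have d: "delta p \<noteq> 0" using delta by (simp add: p_def[abs_def])
  have tri_r: "tri a < r" for a using tri_less[of a] r by simp
  define m where "m a l = int (L l) - (if l = tri a then 1 else 0)" for a l
  have msum: "(\<Sum>l<r. m a l * x l) = (\<Sum>l<r. int (L l) * x l) - x (tri a)" for a x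
  proof -
    have "(\<Sum>l<r. m a l * x l) = (\<Sum>l<r. int (L l) * x l - (if l = tri a then x l else 0))"
      by (intro sum.cong) (auto simp: m_def algebra_simps)
    then show ?thesis using tri_r by (simp add: sum_subtractf)
  qed
  have exc: "exc_class r (2 * s - 1) (\<lambda>l. 2 * L l) (int (s - 1)) (m a)" for a
  proof -
    have S: "int s = 2 * int t + 1" using t by simp
    have mL: "(\<Sum>l<r. int (L l) * m a l) = int s * (int s - 1) - int t"
      using msum[of a "\<lambda>l. int (L l)"] sum2 L by (simp add: mult.commute)
    have mm: "(\<Sum>l<r. m a l * m a l) = int s * (int s - 1) - int t - (int t - 1)"
      unfolding msum mL by (simp add: m_def L)
    have m1: "(\<Sum>l<r. m a l) = 3 * (int s - 1) - 1"
      using msum[of a "\<lambda>_. 1"] sum1 by simp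
    have m\<nu>: "(\<Sum>l<r. m a l * int (2 * L l)) = 2 * (int s * (int s - 1) - int t)"
      unfolding mL[symmetric] sum_distrib_left by (simp add: mult_ac)
    have "int (s - 1) = 2 * int t" "int (2 * s - 1) = 4 * int t + 1" using t by auto
    then show ?thesis
      unfolding exc_class_def bil_def mm m\<nu> mult_1_right m1 S by (simp add: algebra_simps)
  qed
  have "contracted r P F (int (s - 1)) (m a)" for a
  proof -
    have "\<not> point_class r (int (s - 1)) (m a)" using s by (simp add: point_class_def)
    then show ?thesis using good exc[of a] unfolding good_net_def by blast
  qed
  then have "\<exists>f Q. prime_form (s - 1) f \<and> (\<forall>l<r. \<forall>n. mult_ge n (P l) f \<longleftrightarrow> int n \<le> m a l) \<and>
      (\<exists>i. Q i \<noteq> 0) \<and> (\<forall>i j. f dvd const (Q j) * F i - const (Q i) * F j)" for a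
    by (simp add: contracted_def)
  then obtain f Q where f: "\<And>a. prime_form (s - 1) (f a)"
    and fm: "\<And>a l n. l < r \<Longrightarrow> mult_ge n (P l) (f a) \<longleftrightarrow> int n \<le> m a l"
    and Q: "\<And>a. \<exists>i. Q a i \<noteq> 0" "\<And>a i j. f a dvd const (Q a j) * F i - const (Q a i) * F j"
    by metis
  have ff: "form (s - 1) (f a)" "f a \<noteq> 0" for a using f by (auto simp: prime_form_def)
  have principal: "principal_curve F (s - 1) (f a)" for a
  proof -
    obtain k where k: "Q a k \<noteq> 0" using Q(1) by blast
    have "2 \<le> s - 1" "\<And>i. form (2 * s - 1) (F i)" "no_common_factor F"
      using s F by (auto simp: net_def)
    from principal_curveI[OF f this, of "Q a" k a] k Q(2) show ?thesis by blast
  qed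
  \<comment> \<open>At the point \<open>tri a\<close> the multiplicities of \<open>f b\<close> and
    \<open>f a\<close> are \<open>t\<close> and \<open>t - 1\<close>.\<close>
  have not_assoc: "\<not> (c \<noteq> 0 \<and> f b = const c * f a)" if "a \<noteq> b" for a b c
  proof
    assume c: "c \<noteq> 0 \<and> f b = const c * f a"
    have "mult_ge t (P (tri a)) (f b) \<longleftrightarrow> mult_ge t (P (tri a)) (f a)" using c by (simp add: mult_ge_const_iff)
    then show False using that by (simp add: fm tri_r m_def L tri_inj)
  qed
  have not_dvd: "\<not> f a dvd f b" if "a \<noteq> b" for a b
  proof
    assume "f a dvd f b"
    then obtain u where u: "f b = f a * u" by (auto simp: dvd_def)
    have "form 0 u" using form_quotient(2)[of "s - 1" "f a" u "s - 1"] ff u by (metis diff_self_eq_0)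
    then obtain c where c: "u = const c" using form_const_if_form_0 by blast
    have "c \<noteq> 0" using ff(2)[of b] u c by (auto simp: const_simps)
    then show False using not_assoc[OF that, of c] u c by (simp add: mult.commute)
  qed
  define l where "l = lf p"
  have l1: "form 1 (l a)" and l0: "l a \<noteq> 0" for a using lf_neq_0[OF d] by (simp_all add: l_def)
  have lind: "lin_indep l"
    unfolding lin_indep_def
  proof (intro allI impI)
    fix c a assume c: "(\<Sum>b\<in>UNIV. const (c b) * l b) = 0"
    have "poly_eval (\<Sum>b\<in>UNIV. const (c b) * l b) (p a) = c a * delta p"
      using cof_self[of p] by (simp add: eval_hom l_def sum_cyc[of _ a])
    then show "c a = 0" using c d by (simp add: eval_hom)
  qed
  define g where "g a = l a * f (a + 1) * f (a + 2)" for a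
  have gF: "g a \<in> linear_system F" for a
  proof -
    have "form (1 + (s - 1) + (s - 1)) (g a)" unfolding g_def by (intro form_mult l1 ff)
    then have "form (2 * s - 1) (g a)" using s by (simp add: mult_2)
    moreover have "mult_ge (2 * L x) (P x) (g a)" if x: "x < r" for x
    proof -
      define n where "n b = nat (m b x)" for b
      have nonneg: "0 \<le> m b x" for b using fm[OF x, of 0 b] by simp
      have fn: "mult_ge (n b) (P x) (f b)" for b using fm[OF x, of "n b" b] nonneg[of b] by (simp add: n_def)
      define k where "k = (if cof p a (P x) = 0 then 1 else 0 :: nat)"
      have "mult_ge (k + n (a + 1) + n (a + 2)) (P x) (g a)"
        unfolding g_def by (intro mult_ge_mult fn) (simp add: l_def mult_ge_lf_iff[OF d] k_def)
      \<comment> \<open>At \<open>tri a\<close> both curves contribute \<open>t\<close> and the line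
        misses the point; at the other two vertices the line adds 1 to \<open>t + (t - 1)\<close>;
        elsewhere each curve contributes \<open>L x\<close>.\<close>
      moreover have "2 * L x \<le> k + n (a + 1) + n (a + 2)"
      proof (cases "x < 3")
        case True
        then obtain b where b: "x = tri b" using ex_tri by blast
        have "P x = p b" by (simp add: b p_def)
        then have "k = (if a = b then 0 else 1)" using d by (simp add: k_def cof_self)
        then show ?thesis using nonneg[of "a + 1"] nonneg[of "a + 2"] cyc_cases[of b a]
          by (auto simp: n_def m_def b tri_inj)
      next
        case False
        then have "x \<noteq> tri b" for b using tri_less[of b] by auto
        then show ?thesis by (simp add: n_def m_def)
      qed
      ultimately show ?thesis by (rule mult_ge_mono)
    qed
    ultimately show ?thesis using good by (simp add: good_net_def complete_net_def)
  qed
  \<comment> \<open>\<open>f a\<close> divides the other two products, so a relation would make it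
    divide the third, hence another curve or the line \<open>l a\<close>; the latter fails because
    \<open>s - 1 >= 2\<close>.\<close>
  have gind: "lin_indep g"
    unfolding lin_indep_def
  proof (intro allI impI, rule ccontr)
    fix c a assume c: "(\<Sum>b\<in>UNIV. const (c b) * g b) = 0" and ca: "c a \<noteq> 0"
    have "const (c a) * g a = - (const (c (a + 1)) * g (a + 1) + const (c (a + 2)) * g (a + 2))"
      using c unfolding sum_cyc[of _ a] add.assoc eq_neg_iff_add_eq_0 .
    moreover have "f a dvd g (a + 1)" "f a dvd g (a + 2)" by (simp_all add: g_def)
    ultimately have "f a dvd const (c a) * g a" by simp
    then have "f a dvd l a * f (a + 1) * f (a + 2)" unfolding dvd_const_mult_iff[OF ca] g_def .
    then have "f a dvd l a * f (a + 1) \<or> f a dvd f (a + 2)"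
      by (rule prime_formD[OF f form_mult[OF l1 ff(1)] ff(1)])
    then have "f a dvd l a" using prime_formD[OF f l1 ff(1)] not_dvd[of a "a + 1"] not_dvd[of a "a + 2"] by auto
    from prime_form_dvd_degree[OF f l1 l0 this] show False using s by simp
  qed
  have "ideal_gen (range F) = ideal_gen (range g)"
  proof (rule ideal_gen_eqI)
    fix i
    show "F i \<in> linear_system g" using linear_system_exchange[OF gind gF] linear_system_memI[of F i] by (rule subsetD)
    show "g i \<in> linear_system F" by (rule gF)
  qed
  moreover have "range g = {l 2 * f 0 * f 1, l 1 * f 0 * f 2, l 0 * f 1 * f 2}"
  proof -
    have "g 0 = l 0 * f 1 * f 2" "g 1 = l 1 * f 0 * f 2" "g 2 = l 2 * f 0 * f 1"
      by (simp_all add: g_def mult.assoc mult.commute[of "f 2"])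
    then show ?thesis unfolding range_3 by (simp only: insert_commute)
  qed
  ultimately have "base_ideal F = ideal_gen {l 2 * f 0 * f 1, l 1 * f 0 * f 2, l 0 * f 1 * f 2}"
    unfolding base_ideal_def range_3[of F, symmetric] by (simp only:)
  moreover have "\<forall>i j. i \<noteq> j \<longrightarrow> \<not> same_curve (f i) (f j)"
    unfolding same_curve_def using not_assoc by blast
  ultimately show ?thesis
    using principal l1 lind by (intro exI[of _ f] exI[of _ l] conjI allI) simp_all
qed

lemma sum_list_lessThan: "sum_list (map h xs) = (\<Sum>l<length xs. h (xs ! l))"
  by (simp add: sum_list_sum_nth atLeast0LessThan)

theorem theorem4p11:
  fixes s :: nat and \<mu> :: "nat list"
  assumes "s \<ge> 3" and "odd s"
    and "sub_homaloidal s (replicate 3 ((s - 1) div 2) @ \<mu>)"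
    and "proper_homaloidal_type TYPE('k::alg_closed_field) (2 * s - 1)
           (replicate 3 (s - 1) @ map (\<lambda>m. 2 * m) \<mu>)"
  shows "\<exists>U :: 'k proj2 list set. zariski_open (3 + length \<mu>) U \<and> U \<noteq> {} \<and>
    (\<forall>ps\<in>U. \<forall>F. cremona_on_points (2 * s - 1)
          (replicate 3 (s - 1) @ map (\<lambda>m. 2 * m) \<mu>) ps F \<longrightarrow>
      (\<exists>(f :: 3 \<Rightarrow> (3, 'k) mpoly) (l :: 3 \<Rightarrow> (3, 'k) mpoly).
         (\<forall>i. principal_curve F (s - 1) (f i)) \<and>
         (\<forall>i j. i \<noteq> j \<longrightarrow> \<not> same_curve (f i) (f j)) \<and>
         (\<forall>i. form 1 (l i)) \<and> lin_indep l \<and>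
         base_ideal F = ideal_gen {l 2 * f 0 * f 1, l 1 * f 0 * f 2, l 0 * f 1 * f 2}))"
proof -
  define t where "t = (s - 1) div 2"
  define L where "L = replicate 3 t @ \<mu>"
  define r where "r = 3 + length \<mu>"
  have s: "s = 2 * t + 1" using assms(2) by (simp add: t_def odd_two_times_div_two_nat)
  have len: "length L = r" by (simp add: L_def r_def)
  have Ltri: "L ! tri a = t" for a by (simp add: L_def nth_append tri_less)
  have \<nu>: "replicate 3 (s - 1) @ map (\<lambda>m. 2 * m) \<mu> = map (\<lambda>m. 2 * m) L"
    by (simp add: L_def s)
  have sub: "sub_homaloidal s L" using assms(3) by (simp add: L_def t_def)
  have sum1: "(\<Sum>l<r. int (L ! l)) = 3 * (int s - 1)"
    using sub sum_list_lessThan[of "\<lambda>x. x" L] by (simp add: sub_homaloidal_def len)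
  have sum2: "(\<Sum>l<r. int (L ! l) * int (L ! l)) = int s * (int s - 1)"
    using sub sum_list_lessThan[of "\<lambda>x. x ^ 2" L] by (simp add: sub_homaloidal_def len power2_eq_square)
  have h: "htype r (2 * s - 1) (\<lambda>l. 2 * L ! l)"
  proof -
    have "int (2 * s - 1) = 2 * int s - 1" using s by simp
    moreover have "(\<Sum>l<r. int (2 * L ! l) * int (2 * L ! l)) = 4 * (int s * (int s - 1))"
      unfolding sum2[symmetric] by (simp add: sum_distrib_left mult_ac)
    moreover have "(\<Sum>l<r. int (2 * L ! l) * 1) = 2 * (3 * (int s - 1))"
      unfolding sum1[symmetric] by (simp add: sum_distrib_left)
    ultimately show ?thesis unfolding htype_def bil_def by (simp only:) (simp add: algebra_simps)
  qed
  let ?Q = "\<lambda>P :: nat \<Rightarrow> 3 \<Rightarrow> 'k. delta (\<lambda>a. P (tri a)) \<noteq> 0 \<and>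
    (\<forall>F. net r (2 * s - 1) (\<lambda>l. 2 * L ! l) P F \<longrightarrow> good_net r (2 * s - 1) (\<lambda>l. 2 * L ! l) P F)"
  have "inj tri" by (simp add: inj_def tri_inj)
  have "generic ?Q"
  proof (rule generic_conj)
    show "generic (\<lambda>P :: nat \<Rightarrow> 3 \<Rightarrow> 'k. delta (\<lambda>a. P (tri a)) \<noteq> 0)"
      \<comment> \<open>With bound 0 a general triangle is just a non-degenerate one.\<close>
      by (rule generic_mono[OF generic_general_triangle[OF \<open>inj tri\<close>, of 0]]) (simp add: general_triangle_def)
    show "generic (\<lambda>P :: nat \<Rightarrow> 3 \<Rightarrow> 'k. \<forall>F. net r (2 * s - 1) (\<lambda>l. 2 * L ! l) P F \<longrightarrow>
        good_net r (2 * s - 1) (\<lambda>l. 2 * L ! l) P F)"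
      by (rule generic_good_net[OF h]) (simp add: r_def)
  qed
  moreover have "?Q P'" if c: "\<And>l. l < r \<Longrightarrow> c l \<noteq> 0 \<and> P l = (\<lambda>j. c l * P' l j)" and Q: "?Q P" for P P' c
  proof
    have "(\<lambda>a. P (tri a)) = (\<lambda>a j. c (tri a) * P' (tri a) j)"
    proof
      fix a
      have "tri a < r" using tri_less[of a] by (simp add: r_def)
      then show "P (tri a) = (\<lambda>j. c (tri a) * P' (tri a) j)" using c by blast
    qed
    then have "delta (\<lambda>a. P (tri a)) = c (tri 0) * c (tri 1) * c (tri 2) * delta (\<lambda>a. P' (tri a))"
      by (simp only: delta_scale)
    then show "delta (\<lambda>a. P' (tri a)) \<noteq> 0" using Q by auto
    show "\<forall>F. net r (2 * s - 1) (\<lambda>l. 2 * L ! l) P' F \<longrightarrow> good_net r (2 * s - 1) (\<lambda>l. 2 * L ! l) P' F"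
      using Q good_net_cong[of r c P P', OF c] by simp
  qed
  ultimately obtain U :: "'k proj2 list set" where U: "zariski_open r U" "U \<noteq> {}"
    "\<And>ps. ps \<in> U \<Longrightarrow> length ps = r \<and> ?Q (\<lambda>l. coords (ps ! l))"
    using zariski_open_if_generic[OF alg_closed_infinite, of ?Q r] by blast
  show ?thesis
  proof (intro exI[of _ U] conjI ballI allI impI)
    fix ps and F :: "3 \<Rightarrow> (3, 'k) mpoly"
    assume ps: "ps \<in> U" and F: "cremona_on_points (2 * s - 1) (replicate 3 (s - 1) @ map (\<lambda>m. 2 * m) \<mu>) ps F"
    let ?P = "\<lambda>l. coords (ps ! l)"
    have lp: "length ps = r" using U(3)[OF ps] by simp
    have "net r (2 * s - 1) (\<lambda>l. map (\<lambda>m. 2 * m) L ! l) ?P F"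
      using net_if_cremona_on_points[OF alg_closed_infinite F] unfolding lp \<nu> .
    then have net: "net r (2 * s - 1) (\<lambda>l. 2 * L ! l) ?P F"
      unfolding net_def by (simp add: len)
    have "good_net r (2 * s - 1) (\<lambda>l. 2 * L ! l) ?P F" and "delta (\<lambda>a. ?P (tri a)) \<noteq> 0"
      using U(3)[OF ps] net by blast+
    from good_net_decomposition[OF assms(1) _ s Ltri sum1 sum2 this(2) net this(1)]
    show "\<exists>(f :: 3 \<Rightarrow> (3, 'k) mpoly) (l :: 3 \<Rightarrow> (3, 'k) mpoly).
         (\<forall>i. principal_curve F (s - 1) (f i)) \<and>
         (\<forall>i j. i \<noteq> j \<longrightarrow> \<not> same_curve (f i) (f j)) \<and>
         (\<forall>i. form 1 (l i)) \<and> lin_indep l \<and>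
         base_ideal F = ideal_gen {l 2 * f 0 * f 1, l 1 * f 0 * f 2, l 0 * f 1 * f 2}"
      by (simp add: r_def)
  qed (use U in \<open>simp_all add: r_def\<close>)
qed

end
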